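(* Let $\prec$ be the lexicographic term order on $K[\mathbf T_{\lambda-\mu}]$ with $T_{rc}>T_{r'c'}$ iff $r<r'$, or $r=r'$ and $c<c'$. (a) The initial ideal $\mathrm{in}_\prec(I_2(\mathbf T_{\lambda-\mu}))$ is squarefree, has height $\sum_{i=2}^n(\lambda_i-\mu_i-1)$, and its associated simplicial complex (the complex whose Stanley–Reisner ideal it is) is vertex decomposable; in particular it is Cohen–Macaulay. (b) The initial ideal $\mathrm{in}_\prec(I_2(\mathbf S_{\lambda-\mu}))$ is squarefree, has height $\max\{0,n-1-\mu_1\}+\sum_{i=2}^n(\lambda_i-\mu_i-1)$, and its associated simplicial complex is vertex decomposable; in particular it is Cohen–Macaulay. Moreover, if either of these initial ideals is nonzero, it can be obtained from an ideal generated by variables by a finite sequence of basic double links.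
   Context: Let $K$ be a field. Fix an integer $n\ge1$, a partition $\lambda=(\lambda_1,\dots,\lambda_n)$ of positive integers with $m:=\lambda_1\ge\lambda_2\ge\cdots\ge\lambda_n$, and an integer vector $\mu=(\mu_1,\dots,\mu_n)$ with $0\le\mu_1\le\cdots\le\mu_n<\lambda_n$ and $\mu_i\ge i-1$ for all $i$. The tableau $\mathbf T_{\lambda-\mu}$ is the set of positions $\{(i,j):1\le i\le n,\ \mu_i<j\le\lambda_i\}$ in an $m\times m$ array, and $K[\mathbf T_{\lambda-\mu}]$ is the polynomial ring over $K$ in the variables $T_{ij}$, $(i,j)\in\mathbf T_{\lambda-\mu}$; the entry of $\mathbf T_{\lambda-\mu}$ at $(i,j)$ is $T_{ij}$. The symmetrized tableau $\mathbf S_{\lambda-\mu}$ is the partially filled $m\times m$ array with set of positions $\{(i,j):(i,j)\in\mathbf T_{\lambda-\mu}\text{ or }(j,i)\in\mathbf T_{\lambda-\mu}\}$, whose entry at $(i,j)$ is $T_{ij}$ if $(i,j)\in\mathbf T_{\lambda-\mu}$ and $T_{ji}$ otherwise. For such an array $A$ with set of positions $P$ and entries $a_{ij}$, a 2-minor of $A$ is a polynomial $a_{ij}a_{kl}-a_{il}a_{kj}$ with $i<k$, $j<l$ and $(i,j),(i,l),(k,j),(k,l)\in P$. $I_2(\mathbf T_{\lambda-\mu})$ and $I_2(\mathbf S_{\lambda-\mu})$ denote the ideals of $K[\mathbf T_{\lambda-\mu}]$ generated by the 2-minors of $\mathbf T_{\lambda-\mu}$ and of $\mathbf S_{\lambda-\mu}$.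 A simplicial complex $\Delta$ is vertex decomposable if it is a simplex, or empty, or there is a vertex $k$ such that the link $\mathrm{lk}_\Delta(k)$ and the deletion $\Delta_{-k}$ are both pure and vertex decomposable and $\dim\Delta=\dim\Delta_{-k}=\dim\mathrm{lk}_\Delta(k)+1$. An ideal $I'$ of a polynomial ring $R$ is a basic double link of an ideal $I$ if $I'=fI+J$ for homogeneous ideals $J\subset I$ and a homogeneous polynomial $f$ with $\operatorname{ht}J=\operatorname{ht}I-1$, $J:f=J$, and $R/I$ and $R/J$ Cohen–Macaulay. *)

theory Defs
  imports "HOL-Library.Poly_Mapping" "HOL-Library.Product_Lexorder" "HOL-Library.Extended_Nat"
begin

text \<open>Multivariate polynomials over a field: maps from monomials (exponent vectors
 'v \<Rightarrow>0 nat) to coefficients. The polynomial ring K[V] in the variables V is the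
 set of polynomials all of whose monomials only involve variables of V.\<close>

type_synonym ('v, 'k) mpoly = "('v \<Rightarrow>\<^sub>0 nat) \<Rightarrow>\<^sub>0 'k"

definition polys :: "'v set \<Rightarrow> ('v, 'k::field) mpoly set" where
  "polys V = {p :: ('v, 'k) mpoly. \<forall>m \<in> Poly_Mapping.keys p. Poly_Mapping.keys m \<subseteq> V}"

definition var :: "'v \<Rightarrow> ('v, 'k::field) mpoly" where
  "var v = Poly_Mapping.single (Poly_Mapping.single v 1) 1"

definition monom :: "('v \<Rightarrow>\<^sub>0 nat) \<Rightarrow> ('v, 'k::field) mpoly" where
  "monom m = Poly_Mapping.single m 1"

definition sqf_monom :: "'v set \<Rightarrow> ('v, 'k::field) mpoly" where
  "sqf_monom F = monom (\<Sum>v\<in>F. Poly_Mapping.single v 1)"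

definition homogeneous :: "('v, 'k::field) mpoly \<Rightarrow> bool" where
  "homogeneous p \<longleftrightarrow> (\<forall>m\<in>Poly_Mapping.keys p. \<forall>m'\<in>Poly_Mapping.keys p. (\<Sum>v\<in>Poly_Mapping.keys m. Poly_Mapping.lookup m v) = (\<Sum>v\<in>Poly_Mapping.keys m'. Poly_Mapping.lookup m' v))"

definition ideal_gen :: "'v set \<Rightarrow> ('v, 'k::field) mpoly set \<Rightarrow> ('v, 'k) mpoly set" where
  "ideal_gen V G = {p. \<exists>S f. finite S \<and> S \<subseteq> G \<and> (\<forall>g\<in>S. f g \<in> polys V) \<and> p = (\<Sum>g\<in>S. f g * g)}"

definition is_ideal :: "'v set \<Rightarrow> ('v, 'k::field) mpoly set \<Rightarrow> bool" where
  "is_ideal V I \<longleftrightarrow> I \<subseteq> polys V \<and> 0 \<in> I \<and> (\<forall>a\<in>I. \<forall>b\<in>I. a + b \<in> I)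
     \<and> (\<forall>r\<in>polys V. \<forall>a\<in>I. r * a \<in> I)"

definition homogeneous_ideal :: "'v set \<Rightarrow> ('v, 'k::field) mpoly set \<Rightarrow> bool" where
  "homogeneous_ideal V I \<longleftrightarrow> (\<exists>G. G \<subseteq> polys V \<and> (\<forall>g\<in>G. homogeneous g) \<and> I = ideal_gen V G)"

definition prime_ideal :: "'v set \<Rightarrow> ('v, 'k::field) mpoly set \<Rightarrow> bool" where
  "prime_ideal V P \<longleftrightarrow> is_ideal V P \<and> P \<noteq> polys V \<and>
     (\<forall>a\<in>polys V. \<forall>b\<in>polys V. a * b \<in> P \<longrightarrow> a \<in> P \<or> b \<in> P)"

definition prime_chain :: "'v set \<Rightarrow> nat \<Rightarrow> (nat \<Rightarrow> ('v, 'k::field) mpoly set) \<Rightarrow> bool" where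
  "prime_chain V n P \<longleftrightarrow> (\<forall>i\<le>n. prime_ideal V (P i)) \<and> (\<forall>i<n. P i \<subset> P (Suc i))"

definition height_prime :: "'v set \<Rightarrow> ('v, 'k::field) mpoly set \<Rightarrow> enat" where
  "height_prime V Q = (SUP n \<in> {n. \<exists>P. prime_chain V n P \<and> P n = Q}. enat n)"

text \<open>height of an ideal: minimum height of a prime containing it (\<infinity> for the unit ideal)\<close>
definition height :: "'v set \<Rightarrow> ('v, 'k::field) mpoly set \<Rightarrow> enat" where
  "height V I = (INF Q \<in> {Q. prime_ideal V Q \<and> I \<subseteq> Q}. height_prime V Q)"

definition krull_dim :: "'v set \<Rightarrow> ('v, 'k::field) mpoly set \<Rightarrow> enat" where
  "krull_dim V I = (SUP n \<in> {n. \<exists>P. prime_chain V n P \<and> I \<subseteq> P 0}. enat n)"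

definition colon :: "'v set \<Rightarrow> ('v, 'k::field) mpoly set \<Rightarrow> ('v, 'k) mpoly \<Rightarrow> ('v, 'k) mpoly set" where
  "colon V J f = {p \<in> polys V. p * f \<in> J}"

definition regular_seq :: "'v set \<Rightarrow> ('v, 'k::field) mpoly set \<Rightarrow> ('v, 'k) mpoly list \<Rightarrow> bool" where
  "regular_seq V I fs \<longleftrightarrow>
     set fs \<subseteq> ideal_gen V (var ` V) \<and>
     ideal_gen V (I \<union> set fs) \<noteq> polys V \<and>
     (\<forall>i<length fs. colon V (ideal_gen V (I \<union> set (take i fs))) (fs ! i)
                     = ideal_gen V (I \<union> set (take i fs)))"

definition depth :: "'v set \<Rightarrow> ('v, 'k::field) mpoly set \<Rightarrow> enat" where
  "depth V I = (SUP fs \<in> {fs. regular_seq V I fs}. enat (length fs))"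

text \<open>K[V]/I Cohen-Macaulay (graded setting: depth of the homogeneous maximal ideal equals dimension)\<close>
definition cohen_macaulay :: "'v set \<Rightarrow> ('v, 'k::field) mpoly set \<Rightarrow> bool" where
  "cohen_macaulay V I \<longleftrightarrow> depth V I = krull_dim V I"

text \<open>Lexicographic monomial order: variable v is larger than w iff v < w in the linorder
 on variables; m \<prec> m' iff at the largest variable where they differ, m' has larger exponent.\<close>
definition lex_less :: "('v::linorder \<Rightarrow>\<^sub>0 nat) \<Rightarrow> ('v \<Rightarrow>\<^sub>0 nat) \<Rightarrow> bool" where
  "lex_less m m' \<longleftrightarrow> m \<noteq> m' \<and>
     (let v = (LEAST v. Poly_Mapping.lookup m v \<noteq> Poly_Mapping.lookup m' v) in Poly_Mapping.lookup m v < Poly_Mapping.lookup m' v)"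

definition lead_monom :: "('v::linorder, 'k::field) mpoly \<Rightarrow> ('v \<Rightarrow>\<^sub>0 nat)" where
  "lead_monom p = (THE m. m \<in> Poly_Mapping.keys p \<and> (\<forall>m'\<in>Poly_Mapping.keys p. m' \<noteq> m \<longrightarrow> lex_less m' m))"

definition initial_ideal :: "'v::linorder set \<Rightarrow> ('v, 'k::field) mpoly set \<Rightarrow> ('v, 'k) mpoly set" where
  "initial_ideal V I = ideal_gen V {monom (lead_monom p) | p. p \<in> I \<and> p \<noteq> 0}"

definition squarefree_monomial_ideal :: "'v set \<Rightarrow> ('v, 'k::field) mpoly set \<Rightarrow> bool" where
  "squarefree_monomial_ideal V I \<longleftrightarrow>
     (\<exists>G. G \<subseteq> {sqf_monom F | F. finite F \<and> F \<subseteq> V} \<and> I = ideal_gen V G)"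

definition sr_complex :: "'v set \<Rightarrow> ('v, 'k::field) mpoly set \<Rightarrow> 'v set set" where
  "sr_complex V I = {F. finite F \<and> F \<subseteq> V \<and> sqf_monom F \<notin> I}"

definition link :: "'v set set \<Rightarrow> 'v \<Rightarrow> 'v set set" where
  "link \<Delta> k = {F \<in> \<Delta>. k \<notin> F \<and> insert k F \<in> \<Delta>}"

definition deletion :: "'v set set \<Rightarrow> 'v \<Rightarrow> 'v set set" where
  "deletion \<Delta> k = {F \<in> \<Delta>. k \<notin> F}"

definition facets :: "'v set set \<Rightarrow> 'v set set" where
  "facets \<Delta> = {F \<in> \<Delta>. \<forall>G\<in>\<Delta>. F \<subseteq> G \<longrightarrow> G = F}"

definition pure :: "'v set set \<Rightarrow> bool" where
  "pure \<Delta> \<longleftrightarrow> (\<forall>F\<in>facets \<Delta>. \<forall>G\<in>facets \<Delta>. card F = card G)"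

text \<open>dimension of a complex (max face cardinality minus one; -1 for {{}}, and for the void complex)\<close>
definition cdim :: "'v set set \<Rightarrow> int" where
  "cdim \<Delta> = (if \<Delta> = {} then -1 else int (Max (card ` \<Delta>)) - 1)"

inductive vertex_decomposable :: "'v set set \<Rightarrow> bool" where
  vd_simplex: "finite F \<Longrightarrow> vertex_decomposable (Pow F)"
| vd_empty: "vertex_decomposable {}"
| vd_step: "{k} \<in> \<Delta> \<Longrightarrow> pure (link \<Delta> k) \<Longrightarrow> pure (deletion \<Delta> k) \<Longrightarrow>
    vertex_decomposable (link \<Delta> k) \<Longrightarrow> vertex_decomposable (deletion \<Delta> k) \<Longrightarrow>
    cdim \<Delta> = cdim (deletion \<Delta> k) \<Longrightarrow> cdim \<Delta> = cdim (link \<Delta> k) + 1 \<Longrightarrow>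
    vertex_decomposable \<Delta>"

definition basic_double_link :: "'v set \<Rightarrow> ('v, 'k::field) mpoly set \<Rightarrow> ('v, 'k) mpoly set \<Rightarrow> bool" where
  "basic_double_link V I' I \<longleftrightarrow>
     (\<exists>J f. homogeneous_ideal V I \<and> homogeneous_ideal V J \<and> f \<in> polys V \<and> homogeneous f \<and>
        J \<subseteq> I \<and> I' = {f * a + b | a b. a \<in> I \<and> b \<in> J} \<and>
        height V J + 1 = height V I \<and> colon V J f = J \<and>
        cohen_macaulay V I \<and> cohen_macaulay V J)"

definition obtained_by_bdl_from_variables :: "'v set \<Rightarrow> ('v, 'k::field) mpoly set \<Rightarrow> bool" where
  "obtained_by_bdl_from_variables V I \<longleftrightarrow>
     (\<exists>k L W. W \<subseteq> V \<and> L 0 = ideal_gen V (var ` W) \<and> L k = I \<and>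
        (\<forall>i<k. basic_double_link V (L (Suc i)) (L i)))"

definition tab_T :: "nat \<Rightarrow> (nat \<Rightarrow> nat) \<Rightarrow> (nat \<Rightarrow> nat) \<Rightarrow> (nat \<times> nat) set" where
  "tab_T n lam mu = {(i, j). 1 \<le> i \<and> i \<le> n \<and> mu i < j \<and> j \<le> lam i}"

definition tab_S :: "nat \<Rightarrow> (nat \<Rightarrow> nat) \<Rightarrow> (nat \<Rightarrow> nat) \<Rightarrow> (nat \<times> nat) set" where
  "tab_S n lam mu = {(i, j). (i, j) \<in> tab_T n lam mu \<or> (j, i) \<in> tab_T n lam mu}"

definition entry_S :: "nat \<Rightarrow> (nat \<Rightarrow> nat) \<Rightarrow> (nat \<Rightarrow> nat) \<Rightarrow> nat \<times> nat \<Rightarrow> (nat \<times> nat, 'k::field) mpoly" where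
  "entry_S n lam mu = (\<lambda>(i, j). if (i, j) \<in> tab_T n lam mu then var (i, j) else var (j, i))"

definition two_minors :: "(nat \<times> nat) set \<Rightarrow> (nat \<times> nat \<Rightarrow> (nat \<times> nat, 'k::field) mpoly) \<Rightarrow> (nat \<times> nat, 'k) mpoly set" where
  "two_minors P a = {a (i, j) * a (k, l) - a (i, l) * a (k, j) | i j k l.
      i < k \<and> j < l \<and> (i, j) \<in> P \<and> (i, l) \<in> P \<and> (k, j) \<in> P \<and> (k, l) \<in> P}"

definition I2_T :: "nat \<Rightarrow> (nat \<Rightarrow> nat) \<Rightarrow> (nat \<Rightarrow> nat) \<Rightarrow> (nat \<times> nat, 'k::field) mpoly set" where
  "I2_T n lam mu = ideal_gen (tab_T n lam mu) (two_minors (tab_T n lam mu) var)"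

definition I2_S :: "nat \<Rightarrow> (nat \<Rightarrow> nat) \<Rightarrow> (nat \<Rightarrow> nat) \<Rightarrow> (nat \<times> nat, 'k::field) mpoly set" where
  "I2_S n lam mu = ideal_gen (tab_T n lam mu) (two_minors (tab_S n lam mu) (entry_S n lam mu))"

end

theory Submission
  imports Defs "HOL.Vector_Spaces" "HOL-Library.FuncSet"
begin

text \<open>The 2-minors are binomials whose two terms have the same row and column degrees (for the symmetrized
 tableau: the same vertex degrees). Hence an element of the ideal has coefficient sum zero on each
 multidegree, and its leading monomial is not the smallest one of its multidegree. A suitable weight shows
 that such a monomial is divisible by the leading monomial of a 2-minor, so both initial ideals are
 Stanley--Reisner ideals of independence complexes of explicit graphs. Shedding the last entry of the last
 row decomposes these complexes: the deletion is a smaller tableau, and in the link the rest of the last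
 row consists of cone points.

 A shedding vertex \<open>x\<close> of a complex with ideal \<open>I\<close> gives \<open>0 \<rightarrow> R/(I : x) \<rightarrow> R/I \<rightarrow> R/(I + x) \<rightarrow> 0\<close>, with star
 and deletion at the ends. The elementary symmetric polynomials of degrees \<open>d, \<dots>, 1\<close> form a regular sequence
 modulo every ideal of a simplex with \<open>d\<close> vertices, hence modulo \<open>I\<close>; this holds over finite fields, too,
 where linear parameters need not exist. Moreover \<open>I = x (I : x) + J\<close> with \<open>J\<close> the ideal of the cone over
 the deletion is a basic double link. Heights and dimensions are controlled by bounding chains of primes:
 elements chosen along a chain are algebraically independent.\<close>

section \<open>Polynomial rings and ideals\<close>

text \<open>Modulo the ideal of the simplex on \<open>F\<close> with \<open>card F = d\<close>,
  \<open>esym V d\<close> is the product of the variables of \<open>F\<close>; adding it leaves the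
  boundary of the simplex, which sheds down to simplices with \<open>d - 1\<close> vertices. One
  list thus serves a complex, its stars and its deletions, provided that none of them changes the
  ring or the dimension; hence stars replace links on the algebraic side. Height and dimension range
  over all primes, not only monomial ones. Chains are bounded by counting: \<open>N ^ k\<close>
  independent products against a number of monomials of order \<open>N ^ d\<close>. The condition
  \<open>i - 1 \<le> mu i\<close> puts all positions on or above the diagonal, so minors of the
  symmetrized tableau that use reflected entries add edges with \<open>j < k\<close> to those with
  \<open>mu k < j\<close>. In the link of the shedding vertex the columns up to \<open>n\<close>
  disappear, and with them the extra edges: the symmetric case falls back on the ordinary one, but
  with columns missing. This is why the ordinary case is proved for nested column sets instead of
  intervals.\<close>

declare One_nat_def [simp del]

abbreviation supp :: "('a \<Rightarrow>\<^sub>0 'b::zero) \<Rightarrow> 'a set" where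
  "supp \<equiv> Poly_Mapping.keys"

abbreviation coeff :: "('a \<Rightarrow>\<^sub>0 'b::zero) \<Rightarrow> 'a \<Rightarrow> 'b" where
  "coeff \<equiv> Poly_Mapping.lookup"

lemma supp_add_nat: "supp (a + b) = supp a \<union> supp (b :: 'v \<Rightarrow>\<^sub>0 nat)"
  by (auto simp: in_keys_iff lookup_add)

lemma supp_sum_single: "finite F \<Longrightarrow> supp (\<Sum>v\<in>F. Poly_Mapping.single v (1::nat)) = F"
  by (induction F rule: finite_induct) (auto simp: supp_add_nat)

lemma coeff_sum_single:
  "finite F \<Longrightarrow> coeff (\<Sum>v\<in>F. Poly_Mapping.single v (1::nat)) v = (if v \<in> F then 1 else 0)"
  by (simp add: lookup_sum lookup_single when_def)

lemma poly_eq_sum_terms: "p = (\<Sum>m\<in>supp p. Poly_Mapping.single m (coeff p m))"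
  by (rule poly_mapping_eqI) (auto simp: lookup_sum lookup_single when_def in_keys_iff)

lemma single_eq_const_mult_monom: "Poly_Mapping.single m c = Poly_Mapping.single 0 c * monom m"
  by (simp add: monom_def mult_single)

lemma monom_add: "monom (a + b) = monom a * monom b"
  by (simp add: monom_def mult_single)

lemma supp_monom [simp]: "supp (monom m :: ('v, 'k::field) mpoly) = {m}"
  by (simp add: monom_def)

lemma supp_var [simp]: "supp (var v :: ('v, 'k::field) mpoly) = {Poly_Mapping.single v 1}"
  by (simp add: var_def)

lemma var_eq_monom: "var v = monom (Poly_Mapping.single v 1)"
  by (simp add: var_def monom_def)

lemma polys_0 [simp]: "0 \<in> polys V"
  by (simp add: polys_def)

lemma polys_single [simp]: "supp m \<subseteq> V \<Longrightarrow> Poly_Mapping.single m c \<in> polys V"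
  by (simp add: polys_def)

lemma polys_1 [simp]: "1 \<in> polys V"
  by (simp add: polys_def)

lemma polys_const [simp]: "Poly_Mapping.single 0 c \<in> polys V"
  by simp

lemma polys_monom [simp]: "monom m \<in> polys V \<longleftrightarrow> supp m \<subseteq> V"
  by (simp add: polys_def)

lemma polys_var [simp]: "var v \<in> polys V \<longleftrightarrow> v \<in> V"
  by (simp add: polys_def)

lemma polys_add [simp]: "p \<in> polys V \<Longrightarrow> q \<in> polys V \<Longrightarrow> p + q \<in> polys V"
  using Poly_Mapping.keys_add[of p q] unfolding polys_def by blast

lemma polys_mult [simp]:
  assumes "p \<in> polys V" "q \<in> polys V" shows "p * q \<in> polys V"
proof -
  have "supp m \<subseteq> V" if m: "m \<in> supp (p * q)" for m
  proof -
    obtain a b where "m = a + b" "a \<in> supp p" "b \<in> supp q"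
      using m keys_mult[of p q] by blast
    then show ?thesis using assms by (auto simp: polys_def supp_add_nat)
  qed
  then show ?thesis by (simp add: polys_def)
qed

lemma polys_uminus [simp]: "p \<in> polys V \<Longrightarrow> - p \<in> polys V"
  by (auto simp: polys_def in_keys_iff)

lemma polys_diff [simp]: "p \<in> polys V \<Longrightarrow> q \<in> polys V \<Longrightarrow> p - q \<in> polys V"
  using polys_add[of p V "- q"] by simp

lemma polys_sum: "(\<And>i. i \<in> A \<Longrightarrow> f i \<in> polys V) \<Longrightarrow> sum f A \<in> polys V"
  by (induction A rule: infinite_finite_induct) auto

lemma polys_prod: "(\<And>i. i \<in> A \<Longrightarrow> f i \<in> polys V) \<Longrightarrow> prod f A \<in> polys V"
  by (induction A rule: infinite_finite_induct) auto

lemma polys_power [simp]: "p \<in> polys V \<Longrightarrow> p ^ j \<in> polys V"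
  by (induction j) auto

lemma polys_mono: "V \<subseteq> W \<Longrightarrow> polys V \<subseteq> polys W"
  unfolding polys_def by blast

lemma is_idealD:
  assumes "is_ideal V I"
  shows "I \<subseteq> polys V" "0 \<in> I" "\<And>a b. a \<in> I \<Longrightarrow> b \<in> I \<Longrightarrow> a + b \<in> I"
    "\<And>r a. r \<in> polys V \<Longrightarrow> a \<in> I \<Longrightarrow> r * a \<in> I"
    "\<And>r a. r \<in> polys V \<Longrightarrow> a \<in> I \<Longrightarrow> a * r \<in> I"
  using assms unfolding is_ideal_def by (auto simp: mult.commute)

lemma ideal_uminus: "is_ideal V I \<Longrightarrow> a \<in> I \<Longrightarrow> - a \<in> I"
  using is_idealD(4)[of V I "- 1" a] polys_uminus[OF polys_1] by simp

lemma ideal_diff: "is_ideal V I \<Longrightarrow> a \<in> I \<Longrightarrow> b \<in> I \<Longrightarrow> a - b \<in> I"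
  using is_idealD(3)[of V I a "- b"] ideal_uminus[of V I b] by simp

lemma ideal_sum: "is_ideal V I \<Longrightarrow> (\<And>i. i \<in> A \<Longrightarrow> f i \<in> I) \<Longrightarrow> sum f A \<in> I"
  by (induction A rule: infinite_finite_induct) (auto simp: is_idealD)

lemma ideal_gen_is_ideal:
  fixes G :: "('v, 'k::field) mpoly set"
  assumes "G \<subseteq> polys V" shows "is_ideal V (ideal_gen V G)"
  unfolding is_ideal_def
proof (intro conjI ballI subsetI)
  fix p assume "p \<in> ideal_gen V G"
  then obtain S f where "finite S" "S \<subseteq> G" "\<forall>g\<in>S. f g \<in> polys V" "p = (\<Sum>g\<in>S. f g * g)"
    unfolding ideal_gen_def by blast
  with assms show "p \<in> polys V" by (auto intro!: polys_sum polys_mult)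
next
  show "0 \<in> ideal_gen V G" unfolding ideal_gen_def
    by (intro CollectI exI[of _ "{}"]) auto
next
  fix a b assume "a \<in> ideal_gen V G" "b \<in> ideal_gen V G"
  then obtain S f T h where
    S: "finite S" "S \<subseteq> G" "\<forall>g\<in>S. f g \<in> polys V" "a = (\<Sum>g\<in>S. f g * g)" and
    T: "finite T" "T \<subseteq> G" "\<forall>g\<in>T. h g \<in> polys V" "b = (\<Sum>g\<in>T. h g * g)"
    unfolding ideal_gen_def by blast
  define k where "k g = (if g \<in> S then f g else 0) + (if g \<in> T then h g else 0)" for g
  have 1: "(\<Sum>g\<in>S \<union> T. (if g \<in> S then f g else 0) * g) = a"
    using S T(1) by (auto intro: sum.mono_neutral_cong_right)
  have 2: "(\<Sum>g\<in>S \<union> T. (if g \<in> T then h g else 0) * g) = b"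
    using T S(1) by (auto intro: sum.mono_neutral_cong_right)
  have "a + b = (\<Sum>g\<in>S \<union> T. k g * g)"
    unfolding k_def distrib_right sum.distrib 1 2 ..
  then show "a + b \<in> ideal_gen V G"
    unfolding ideal_gen_def using S T by (intro CollectI exI[of _ "S \<union> T"] exI[of _ k]) (auto simp: k_def)
next
  fix r a :: "('v, 'k) mpoly" assume r: "r \<in> polys V" and "a \<in> ideal_gen V G"
  then obtain S f where
    S: "finite S" "S \<subseteq> G" "\<forall>g\<in>S. f g \<in> polys V" "a = (\<Sum>g\<in>S. f g * g)"
    unfolding ideal_gen_def by blast
  then have "r * a = (\<Sum>g\<in>S. (r * f g) * g)" by (simp add: sum_distrib_left mult.assoc)
  then show "r * a \<in> ideal_gen V G" unfolding ideal_gen_def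
    using S r by (intro CollectI exI[of _ S] exI[of _ "\<lambda>g. r * f g"]) auto
qed

lemma ideal_gen_superset: "G \<subseteq> ideal_gen V G"
proof
  fix g assume "g \<in> G"
  then show "g \<in> ideal_gen V G" unfolding ideal_gen_def
    by (intro CollectI exI[of _ "{g}"] exI[of _ "\<lambda>_. 1"]) auto
qed

lemma ideal_gen_least:
  assumes "is_ideal V I" "G \<subseteq> I" shows "ideal_gen V G \<subseteq> I"
  unfolding ideal_gen_def
  using assms by (auto intro!: ideal_sum is_idealD(4)[OF assms(1)])

lemma ideal_gen_ideal: "is_ideal V I \<Longrightarrow> ideal_gen V I = I"
  by (intro equalityI ideal_gen_least ideal_gen_superset) auto

text \<open>The explicit form lets arguments about regular elements read off the coefficient
  \<open>r\<close>; \<open>adjoin_eq_ideal_gen\<close> ties it to generated ideals.\<close>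

definition adjoin :: "'v set \<Rightarrow> ('v, 'k::field) mpoly set \<Rightarrow> ('v, 'k) mpoly \<Rightarrow> ('v, 'k) mpoly set" where
  "adjoin V I f = {a + r * f | a r. a \<in> I \<and> r \<in> polys V}"

lemma adjoin_is_ideal:
  fixes I :: "('v, 'k::field) mpoly set"
  assumes I: "is_ideal V I" and f: "f \<in> polys V" shows "is_ideal V (adjoin V I f)"
  unfolding is_ideal_def
proof (intro conjI ballI subsetI)
  fix p assume "p \<in> adjoin V I f" then show "p \<in> polys V"
    using is_idealD(1)[OF I] f by (auto simp: adjoin_def)
next
  show "0 \<in> adjoin V I f" unfolding adjoin_def
    using is_idealD(2)[OF I] by (intro CollectI exI[of _ 0]) auto
next
  fix p q assume "p \<in> adjoin V I f" "q \<in> adjoin V I f"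
  then obtain a r b s where *: "p = a + r * f" "q = b + s * f" "a \<in> I" "b \<in> I" "r \<in> polys V" "s \<in> polys V"
    unfolding adjoin_def by blast
  then have "p + q = (a + b) + (r + s) * f" by (simp add: algebra_simps)
  then show "p + q \<in> adjoin V I f" unfolding adjoin_def using * is_idealD(3)[OF I] polys_add by blast
next
  fix t p :: "('v, 'k) mpoly" assume t: "t \<in> polys V" and "p \<in> adjoin V I f"
  then obtain a r where *: "p = a + r * f" "a \<in> I" "r \<in> polys V" unfolding adjoin_def by blast
  then have "t * p = (t * a) + (t * r) * f" by (simp add: algebra_simps)
  then show "t * p \<in> adjoin V I f" unfolding adjoin_def using * t is_idealD(4)[OF I] polys_mult by blast
qed

lemma adjoin_superset: "is_ideal V I \<Longrightarrow> I \<subseteq> adjoin V I f"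
  unfolding adjoin_def by clarify (metis add.right_neutral mult_zero_left polys_0)

lemma adjoin_member: "is_ideal V I \<Longrightarrow> f \<in> adjoin V I f"
  unfolding adjoin_def by clarify (metis add.left_neutral is_idealD(2) mult_1 polys_1)

lemma adjoin_eq_ideal_gen:
  assumes I: "is_ideal V I" and f: "f \<in> polys V" shows "ideal_gen V (insert f I) = adjoin V I f"
proof (intro equalityI ideal_gen_least adjoin_is_ideal assms)
  show "insert f I \<subseteq> adjoin V I f" using adjoin_superset adjoin_member I by blast
  have id: "is_ideal V (ideal_gen V (insert f I))"
    using is_idealD(1)[OF I] f by (intro ideal_gen_is_ideal) auto
  have "insert f I \<subseteq> ideal_gen V (insert f I)" by (rule ideal_gen_superset)
  then show "adjoin V I f \<subseteq> ideal_gen V (insert f I)"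
    unfolding adjoin_def using is_idealD(3,4)[OF id] by auto
qed

lemma adjoin_adjoin_commute: "adjoin V (adjoin V I f) g = adjoin V (adjoin V I g) f"
proof -
  have "adjoin V (adjoin V I f) g \<subseteq> adjoin V (adjoin V I g) f" for f g
  proof
    fix p assume "p \<in> adjoin V (adjoin V I f) g"
    then obtain a r s where "p = (a + r * f) + s * g" "a \<in> I" "r \<in> polys V" "s \<in> polys V"
      unfolding adjoin_def by blast
    moreover from this have "p = (a + s * g) + r * f" by (simp add: algebra_simps)
    ultimately show "p \<in> adjoin V (adjoin V I g) f" unfolding adjoin_def by blast
  qed
  then show ?thesis by blast
qed

lemma colon_superset: "is_ideal V I \<Longrightarrow> f \<in> polys V \<Longrightarrow> I \<subseteq> colon V I f"
  unfolding colon_def using is_idealD(1,5) by blast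

section \<open>Squarefree monomial ideals\<close>

definition down_closed :: "'v set set \<Rightarrow> bool" where
  "down_closed \<Delta> \<longleftrightarrow> (\<forall>F\<in>\<Delta>. \<forall>G. G \<subseteq> F \<longrightarrow> G \<in> \<Delta>)"

lemma down_closedD: "down_closed \<Delta> \<Longrightarrow> F \<in> \<Delta> \<Longrightarrow> G \<subseteq> F \<Longrightarrow> G \<in> \<Delta>"
  unfolding down_closed_def by blast

text \<open>Supports instead of generators: membership, colons and sums become statements about
  faces. For a down-closed complex this is the usual Stanley-Reisner ideal, by
  \<open>sr_ideal_eq_ideal_gen\<close>.\<close>

definition sr_ideal :: "'v set \<Rightarrow> 'v set set \<Rightarrow> ('v, 'k::field) mpoly set" where
  "sr_ideal V \<Delta> = {p \<in> polys V. \<forall>m\<in>supp p. supp m \<notin> \<Delta>}"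

lemma sr_ideal_is_ideal:
  assumes "down_closed \<Delta>" shows "is_ideal V (sr_ideal V \<Delta> :: ('v, 'k::field) mpoly set)"
proof -
  have "r * a \<in> sr_ideal V \<Delta>" if "r \<in> polys V" "a \<in> sr_ideal V \<Delta>" for r a :: "('v, 'k) mpoly"
  proof -
    have "supp m \<notin> \<Delta>" if m: "m \<in> supp (r * a)" for m
    proof -
      obtain b c where "m = b + c" "c \<in> supp a"
        using m subsetD[OF keys_mult[of r a]] by fast
      then show ?thesis using \<open>a \<in> sr_ideal V \<Delta>\<close> down_closedD[OF assms, of "supp m" "supp c"]
        by (auto simp: sr_ideal_def supp_add_nat)
    qed
    then show ?thesis using that by (auto simp: sr_ideal_def)
  qed
  moreover have "a + b \<in> sr_ideal V \<Delta>" if "a \<in> sr_ideal V \<Delta>" "b \<in> sr_ideal V \<Delta>" for a b :: "('v, 'k) mpoly"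
    using that Poly_Mapping.keys_add[of a b] by (auto simp: sr_ideal_def)
  moreover have "sr_ideal V \<Delta> \<subseteq> polys V" "0 \<in> sr_ideal V \<Delta>" by (auto simp: sr_ideal_def)
  ultimately show ?thesis unfolding is_ideal_def by blast
qed

lemma monom_in_sr_ideal [simp]:
  "monom m \<in> sr_ideal V \<Delta> \<longleftrightarrow> supp m \<subseteq> V \<and> supp m \<notin> \<Delta>"
  by (auto simp: sr_ideal_def)

lemma var_in_sr_ideal [simp]: "var v \<in> sr_ideal V \<Delta> \<longleftrightarrow> v \<in> V \<and> {v} \<notin> \<Delta>"
  by (simp add: var_eq_monom)

lemma sqf_monom_in_sr_ideal [simp]:
  "finite F \<Longrightarrow> sqf_monom F \<in> sr_ideal V \<Delta> \<longleftrightarrow> F \<subseteq> V \<and> F \<notin> \<Delta>"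
  by (simp add: sqf_monom_def supp_sum_single)

lemma sr_ideal_subset_ideal:
  fixes I :: "('v, 'k::field) mpoly set"
  assumes I: "is_ideal V I" and "\<And>m. supp m \<subseteq> V \<Longrightarrow> supp m \<notin> \<Delta> \<Longrightarrow> monom m \<in> I"
  shows "sr_ideal V \<Delta> \<subseteq> I"
proof
  fix p :: "('v, 'k) mpoly" assume p: "p \<in> sr_ideal V \<Delta>"
  show "p \<in> I"
  proof (subst poly_eq_sum_terms, rule ideal_sum[OF I])
    fix m assume "m \<in> supp p"
    then have "monom m \<in> I" using p assms(2) by (auto simp: sr_ideal_def polys_def)
    then show "Poly_Mapping.single m (coeff p m) \<in> I"
      by (subst single_eq_const_mult_monom) (rule is_idealD(4)[OF I polys_const])
  qed
qed

lemma sr_ideal_mono: "\<Delta> \<subseteq> \<Gamma> \<Longrightarrow> sr_ideal V \<Gamma> \<subseteq> sr_ideal V \<Delta>"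
  unfolding sr_ideal_def by blast

text \<open>Subtraction of exponents is truncated; \<open>F \<subseteq> supp m\<close> makes it
  exact, so that it is division by a squarefree monomial.\<close>

lemma monomial_split_support:
  assumes "F \<subseteq> supp (m :: 'v \<Rightarrow>\<^sub>0 nat)"
  shows "(m - (\<Sum>v\<in>F. Poly_Mapping.single v 1)) + (\<Sum>v\<in>F. Poly_Mapping.single v 1) = m"
proof -
  have "finite F" using assms finite_keys finite_subset by blast
  then show ?thesis using assms
    by (intro poly_mapping_eqI) (auto simp: lookup_add lookup_minus coeff_sum_single in_keys_iff subset_iff Suc_le_eq)
qed

lemma supp_minus_nat: "supp (m - a) \<subseteq> supp (m :: 'v \<Rightarrow>\<^sub>0 nat)"
  by (auto simp: in_keys_iff lookup_minus)

lemma monom_eq_mult_var: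
  "v \<in> supp m \<Longrightarrow> monom m = monom (m - Poly_Mapping.single v 1) * var v"
  using monomial_split_support[of "{v}" m] by (simp add: var_eq_monom monom_add[symmetric])

lemma sr_ideal_Pow_subset:
  fixes I :: "('v, 'k::field) mpoly set"
  assumes I: "is_ideal V I" and "\<And>v. v \<in> V - F \<Longrightarrow> var v \<in> I"
  shows "sr_ideal V (Pow F) \<subseteq> I"
proof (rule sr_ideal_subset_ideal[OF I])
  fix m :: "'v \<Rightarrow>\<^sub>0 nat" assume "supp m \<subseteq> V" "supp m \<notin> Pow F"
  then obtain v where v: "v \<in> supp m" "var v \<in> I" using assms(2) by auto
  show "monom m \<in> I" unfolding monom_eq_mult_var[OF v(1)]
    using v(2) \<open>supp m \<subseteq> V\<close> supp_minus_nat[of m "Poly_Mapping.single v 1"]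
    by (intro is_idealD(4)[OF I]) auto
qed

lemma sr_ideal_eq_ideal_gen:
  assumes "down_closed \<Delta>"
  shows "sr_ideal V \<Delta> = ideal_gen V {sqf_monom F | F. finite F \<and> F \<subseteq> V \<and> F \<notin> \<Delta>}" (is "_ = ideal_gen V ?G")
proof
  have G: "?G \<subseteq> sr_ideal V \<Delta>" by auto
  then show "ideal_gen V ?G \<subseteq> sr_ideal V \<Delta>" by (rule ideal_gen_least[OF sr_ideal_is_ideal[OF assms]])
  have I: "is_ideal V (ideal_gen V ?G)" using G by (intro ideal_gen_is_ideal) (auto simp: sr_ideal_def)
  show "sr_ideal V \<Delta> \<subseteq> ideal_gen V ?G"
  proof (rule sr_ideal_subset_ideal[OF I])
    fix m :: "'a \<Rightarrow>\<^sub>0 nat" assume m: "supp m \<subseteq> V" "supp m \<notin> \<Delta>"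
    let ?F = "\<Sum>v\<in>supp m. Poly_Mapping.single v (1::nat)"
    have e: "monom m = monom (m - ?F) * sqf_monom (supp m)"
      unfolding sqf_monom_def monom_add[symmetric] using monomial_split_support[of "supp m" m] by simp
    moreover have "sqf_monom (supp m) \<in> ideal_gen V ?G"
      using m by (intro subsetD[OF ideal_gen_superset]) auto
    moreover have "monom (m - ?F) \<in> polys V" using m supp_minus_nat[of m ?F] by auto
    ultimately show "monom m \<in> ideal_gen V ?G" unfolding e by (intro is_idealD(4)[OF I])
  qed
qed

lemma squarefree_sr_ideal: "down_closed \<Delta> \<Longrightarrow> squarefree_monomial_ideal V (sr_ideal V \<Delta>)"
  unfolding squarefree_monomial_ideal_def
  by (rule exI[of _ "{sqf_monom F | F. finite F \<and> F \<subseteq> V \<and> F \<notin> \<Delta>}"])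
    (auto simp: sr_ideal_eq_ideal_gen)

lemma homogeneous_monom: "homogeneous (monom m :: ('v, 'k::field) mpoly)"
  by (simp add: homogeneous_def)

lemma homogeneous_sr_ideal: "down_closed \<Delta> \<Longrightarrow> homogeneous_ideal V (sr_ideal V \<Delta> :: ('v, 'k::field) mpoly set)"
  unfolding homogeneous_ideal_def
  by (rule exI[of _ "{sqf_monom F | F. finite F \<and> F \<subseteq> V \<and> F \<notin> \<Delta>}"])
    (auto simp: sr_ideal_eq_ideal_gen sqf_monom_def homogeneous_monom supp_sum_single)

lemma sr_complex_sr_ideal:
  "finite V \<Longrightarrow> \<Delta> \<subseteq> Pow V \<Longrightarrow> sr_complex V (sr_ideal V \<Delta> :: ('v, 'k::field) mpoly set) = \<Delta>"
proof (intro set_eqI)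
  fix F assume "finite V" "\<Delta> \<subseteq> Pow V"
  then have "F \<in> \<Delta> \<Longrightarrow> finite F \<and> F \<subseteq> V" using finite_subset[of F V] by auto
  then show "F \<in> sr_complex V (sr_ideal V \<Delta> :: ('v, 'k) mpoly set) \<longleftrightarrow> F \<in> \<Delta>"
    unfolding sr_complex_def by auto
qed

text \<open>For a down-closed complex this is the cone over the link. The link no longer has
  \<open>x\<close> as a vertex, while the ideal of the star in the same ring is exactly the colon
  ideal.\<close>

definition star :: "'v set set \<Rightarrow> 'v \<Rightarrow> 'v set set" where
  "star \<Delta> x = {F. insert x F \<in> \<Delta>}"

lemma colon_sr_ideal_var:
  assumes x: "x \<in> V"
  shows "colon V (sr_ideal V \<Delta>) (var x) = sr_ideal V (star \<Delta> x)"
proof -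
  \<comment> \<open>Multiplication by a variable shifts exponents injectively, so no terms cancel
    and the colon can be tested monomial by monomial.\<close>
  have *: "supp (p * var x) = (\<lambda>m. m + Poly_Mapping.single x 1) ` supp p" for p :: "('a, 'b::field) mpoly"
  proof -
    have c: "coeff (p * var x) (m + Poly_Mapping.single x 1) = coeff p m" for m
    proof -
      have "p * var x = (\<Sum>k\<in>supp p. Poly_Mapping.single (k + Poly_Mapping.single x 1) (coeff p k))"
        by (subst (1) poly_eq_sum_terms) (simp add: sum_distrib_right var_def mult_single)
      then show ?thesis by (auto simp: lookup_sum lookup_single when_def in_keys_iff)
    qed
    have "supp (p * var x) \<subseteq> (\<lambda>m. m + Poly_Mapping.single x 1) ` supp p"
      using keys_mult[of p "var x"] by auto
    moreover have "(\<lambda>m. m + Poly_Mapping.single x 1) ` supp p \<subseteq> supp (p * var x)"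
      using c by (auto simp: in_keys_iff)
    ultimately show ?thesis by blast
  qed
  show ?thesis
    unfolding colon_def sr_ideal_def star_def using x
    by (auto simp: * supp_add_nat)
qed

lemma adjoin_sr_ideal_var:
  assumes x: "x \<in> V" and D: "down_closed \<Delta>"
  shows "adjoin V (sr_ideal V \<Delta>) (var x) = sr_ideal V (deletion \<Delta> x)"
proof
  have D': "down_closed (deletion \<Delta> x)"
    using D unfolding down_closed_def deletion_def by blast
  have I: "is_ideal V (sr_ideal V (deletion \<Delta> x) :: ('a,'b::field) mpoly set)" using D' by (rule sr_ideal_is_ideal)
  show "adjoin V (sr_ideal V \<Delta>) (var x :: ('a,'b) mpoly) \<subseteq> sr_ideal V (deletion \<Delta> x)"
  proof
    fix p :: "('a,'b) mpoly" assume "p \<in> adjoin V (sr_ideal V \<Delta>) (var x)"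
    then obtain a r where *: "p = a + r * var x" "a \<in> sr_ideal V \<Delta>" "r \<in> polys V"
      unfolding adjoin_def by blast
    have "var x \<in> (sr_ideal V (deletion \<Delta> x) :: ('a,'b) mpoly set)" using x by (simp add: deletion_def)
    moreover have "a \<in> sr_ideal V (deletion \<Delta> x)" using *(2) by (auto simp: sr_ideal_def deletion_def)
    ultimately show "p \<in> sr_ideal V (deletion \<Delta> x)" using * is_idealD(3,4)[OF I] by simp
  qed
  have J: "is_ideal V (adjoin V (sr_ideal V \<Delta>) (var x :: ('a,'b) mpoly))"
    using x D by (intro adjoin_is_ideal sr_ideal_is_ideal) auto
  show "sr_ideal V (deletion \<Delta> x) \<subseteq> adjoin V (sr_ideal V \<Delta>) (var x :: ('a,'b) mpoly)"
  proof (rule sr_ideal_subset_ideal[OF J])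
    fix m :: "'a \<Rightarrow>\<^sub>0 nat" assume m: "supp m \<subseteq> V" "supp m \<notin> deletion \<Delta> x"
    show "monom m \<in> adjoin V (sr_ideal V \<Delta>) (var x :: ('a,'b) mpoly)"
    proof (cases "x \<in> supp m")
      case False
      then have "monom m \<in> (sr_ideal V \<Delta> :: ('a,'b) mpoly set)" using m by (simp add: deletion_def)
      then show ?thesis using adjoin_superset[OF sr_ideal_is_ideal[OF D]] by blast
    next
      case True
      show ?thesis unfolding monom_eq_mult_var[OF True]
        using m supp_minus_nat[of m "Poly_Mapping.single x 1"]
        by (intro is_idealD(4)[OF J] adjoin_member sr_ideal_is_ideal D) auto
    qed
  qed
qed

section \<open>Chains of prime ideals\<close>

text \<open>The substitution of 0 for the variables outside \<open>F\<close>. Its kernel on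
  \<open>polys V\<close> is the ideal of the simplex on \<open>F\<close>.\<close>

definition proj :: "'v set \<Rightarrow> ('v, 'k::field) mpoly \<Rightarrow> ('v, 'k) mpoly" where
  "proj F p = (\<Sum>m\<in>{m \<in> supp p. supp m \<subseteq> F}. Poly_Mapping.single m (coeff p m))"

lemma coeff_proj: "coeff (proj F p) m = (if supp m \<subseteq> F then coeff p m else 0)"
  by (auto simp: proj_def lookup_sum lookup_single when_def in_keys_iff)

lemma coeff_const_mult: "coeff (Poly_Mapping.single 0 c * p) m = c * coeff p m"
  by (simp add: mult_map_scale_conv_mult[symmetric] Poly_Mapping.map.rep_eq when_def)

lemma proj_const_mult: "proj F (Poly_Mapping.single 0 c * p) = Poly_Mapping.single 0 c * proj F p"
  by (rule poly_mapping_eqI) (simp add: coeff_proj coeff_const_mult)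

lemma proj_add: "proj F (p + q) = proj F p + proj F q"
  by (rule poly_mapping_eqI) (simp add: coeff_proj lookup_add)

lemma proj_0 [simp]: "proj F 0 = 0"
  by (rule poly_mapping_eqI) (simp add: coeff_proj)

lemma proj_sum: "proj F (sum f A) = (\<Sum>a\<in>A. proj F (f a))"
  by (induction A rule: infinite_finite_induct) (simp_all add: proj_add)

lemma supp_proj: "supp (proj F p) = {m \<in> supp p. supp m \<subseteq> F}"
  by (rule set_eqI) (simp add: in_keys_iff[of _ "proj F p"] in_keys_iff[of _ p] coeff_proj)

lemma proj_in_polys: "proj F p \<in> polys F"
  by (auto simp: polys_def supp_proj)

lemma diff_proj_in_sr_ideal:
  assumes "p \<in> polys V" shows "p - proj F p \<in> sr_ideal V (Pow F)"
proof -
  have s: "m \<in> supp p \<and> \<not> supp m \<subseteq> F" if "m \<in> supp (p - proj F p)" for m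
    using that by (auto simp: in_keys_iff lookup_minus coeff_proj split: if_splits)
  then show ?thesis using assms unfolding sr_ideal_def polys_def by fastforce
qed

lemma polys_inter_sr_ideal_Pow: "p \<in> polys F \<Longrightarrow> p \<in> sr_ideal V (Pow F) \<Longrightarrow> p = 0"
  unfolding polys_def sr_ideal_def
  by (metis (mono_tags, lifting) PowI ex_in_conv keys_eq_empty mem_Collect_eq)

lemma down_closed_Pow [simp]: "down_closed (Pow F)"
  by (auto simp: down_closed_def)

text \<open>Modulo this ideal every polynomial equals its image under \<open>proj F\<close>, and
  \<open>polys F\<close> has no zero divisors. The latter comes from the linear order on exponent
  vectors that the order on the variables induces.\<close>

lemma prime_sr_ideal_Pow:
  assumes F: "F \<subseteq> V"
  shows "prime_ideal V (sr_ideal V (Pow F) :: ('v::linorder, 'k::field) mpoly set)" (is "prime_ideal V ?P")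
proof -
  have I: "is_ideal V ?P" by (simp add: sr_ideal_is_ideal)
  have "1 \<notin> ?P" by (simp add: sr_ideal_def)
  then have ne: "?P \<noteq> polys V" using polys_1 by blast
  have "a \<in> ?P \<or> b \<in> ?P" if a: "a \<in> polys V" and b: "b \<in> polys V" and ab: "a * b \<in> ?P" for a b
  proof -
    let ?a = "proj F a" and ?b = "proj F b"
    have "?b \<in> polys V" using proj_in_polys polys_mono[OF F] by blast
    then have "(a - ?a) * ?b \<in> ?P" "a * (b - ?b) \<in> ?P"
      using a b is_idealD(4,5)[OF I] diff_proj_in_sr_ideal by blast+
    then have "a * b - a * (b - ?b) - (a - ?a) * ?b \<in> ?P"
      using ab by (intro ideal_diff[OF I])
    moreover have "a * b - a * (b - ?b) - (a - ?a) * ?b = ?a * ?b" by (simp add: algebra_simps)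
    moreover have "?a * ?b \<in> polys F" by (intro polys_mult proj_in_polys)
    ultimately have "?a * ?b = 0" by (metis polys_inter_sr_ideal_Pow)
    then have "?a = 0 \<or> ?b = 0" by simp
    then show ?thesis using diff_proj_in_sr_ideal[OF a, of F] diff_proj_in_sr_ideal[OF b, of F] by auto
  qed
  then show ?thesis unfolding prime_ideal_def using I ne by blast
qed

lemma prime_idealD:
  assumes "prime_ideal V P"
  shows "is_ideal V P" "1 \<notin> P" "a \<in> polys V \<Longrightarrow> b \<in> polys V \<Longrightarrow> a * b \<in> P \<Longrightarrow> a \<in> P \<or> b \<in> P"
proof -
  show I: "is_ideal V P" using assms by (simp add: prime_ideal_def)
  show "1 \<notin> P"
  proof
    assume "1 \<in> P"
    then have "polys V \<subseteq> P" using is_idealD(4)[OF I, of _ 1] by auto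
    then show False using assms is_idealD(1)[OF I] by (auto simp: prime_ideal_def)
  qed
  show "a \<in> polys V \<Longrightarrow> b \<in> polys V \<Longrightarrow> a * b \<in> P \<Longrightarrow> a \<in> P \<or> b \<in> P"
    using assms by (simp add: prime_ideal_def)
qed

lemma prime_ideal_power_cancel:
  assumes P: "prime_ideal V P" and x: "x \<in> polys V" "x \<notin> P" and y: "y \<in> polys V" and "x ^ h * y \<in> P"
  shows "y \<in> P"
  using assms(5)
proof (induction h)
  case (Suc h)
  then have "x * (x ^ h * y) \<in> P" by (simp add: mult.assoc)
  then show ?case using Suc prime_idealD(3)[OF P, of x "x ^ h * y"] x y by auto
qed simp

lemma prime_ideal_const:
  assumes P: "prime_ideal V P" and c: "Poly_Mapping.single 0 c \<in> P" shows "c = 0"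
proof (rule ccontr)
  assume "c \<noteq> 0"
  have "Poly_Mapping.single 0 (inverse c) * Poly_Mapping.single 0 c \<in> P"
    by (intro is_idealD(4)[OF prime_idealD(1)[OF P]] c) simp
  then show False using \<open>c \<noteq> 0\<close> prime_idealD(2)[OF P] by (simp add: mult_single)
qed

text \<open>Choosing \<open>x i \<in> P (i + 1) - P i\<close> along a chain of primes gives elements that are algebraically
 independent modulo \<open>P 0\<close>: divide a relation by the smallest power of \<open>x 0\<close> that occurs in it and
 reduce modulo \<open>P 1\<close>.\<close>
lemma prime_chain_independent:
  fixes P :: "nat \<Rightarrow> ('v, 'k::field) mpoly set"
  assumes "prime_chain V k P" "\<And>i. i < k \<Longrightarrow> x i \<in> P (Suc i) - P i" "finite A"
    "\<And>a. a \<in> A \<Longrightarrow> length a = k"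
    "(\<Sum>a\<in>A. Poly_Mapping.single 0 (c a) * (\<Prod>i<k. x i ^ (a ! i))) \<in> P 0" "a \<in> A"
  shows "c a = 0"
  using assms
proof (induction k arbitrary: P x A c a)
  case 0
  then have "A = {[]}" by auto
  moreover have "prime_ideal V (P 0)" using 0(1) by (simp add: prime_chain_def)
  ultimately show ?case using 0 prime_ideal_const[of V "P 0" "c []"] by auto
next
  case (Suc k)
  have prime: "prime_ideal V (P i)" if "i \<le> Suc k" for i using Suc.prems(1) that by (simp add: prime_chain_def)
  have sub: "P 0 \<subseteq> P 1" using Suc.prems(1) by (auto simp: prime_chain_def One_nat_def)
  have xV: "x i \<in> polys V" if "i < Suc k" for i
    using Suc.prems(2)[OF that] is_idealD(1)[OF prime_idealD(1)[OF prime[of "Suc i"]]] that by auto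
  have x0: "x 0 \<in> P 1" "x 0 \<notin> P 0" "x 0 \<in> polys V" using Suc.prems(2)[of 0] xV by (auto simp: One_nat_def)
  define Y where "Y a = (\<Prod>i<k. x (Suc i) ^ (tl a ! i))" for a
  have YV: "Y a \<in> polys V" for a unfolding Y_def by (intro polys_prod polys_power xV) auto
  show ?case
  proof (rule ccontr)
    assume "c a \<noteq> 0"
    define B where "B = {a \<in> A. c a \<noteq> 0}"
    have fin: "finite B" using Suc.prems(3) by (simp add: B_def)
    have "hd ` B \<noteq> {}" using \<open>c a \<noteq> 0\<close> Suc.prems(6) by (auto simp: B_def)
    then have "Min (hd ` B) \<in> hd ` B" using fin by (intro Min_in) auto
    then obtain b where b: "b \<in> B" "hd b = Min (hd ` B)" by auto
    have b_min: "hd b \<le> hd a" if "a \<in> B" for a using fin that by (simp add: b(2))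
    define h where "h = hd b"
    define B1 where "B1 = {a \<in> B. hd a = h}"
    define B2 where "B2 = {a \<in> B. hd a \<noteq> h}"
    have pr: "(\<Prod>i<Suc k. x i ^ (a ! i)) = x 0 ^ hd a * Y a" if "a \<in> B" for a
    proof -
      have "length a = Suc k" using that Suc.prems(4) by (auto simp: B_def)
      then show ?thesis unfolding Y_def prod.lessThan_Suc_shift by (cases a) auto
    qed
    let ?g = "\<Sum>a\<in>B1. Poly_Mapping.single 0 (c a) * Y a"
    let ?r = "\<Sum>a\<in>B2. Poly_Mapping.single 0 (c a) * x 0 ^ (hd a - h - 1) * Y a"
    have "(\<Sum>a\<in>A. Poly_Mapping.single 0 (c a) * (\<Prod>i<Suc k. x i ^ (a ! i)))
        = (\<Sum>a\<in>B. Poly_Mapping.single 0 (c a) * (x 0 ^ hd a * Y a))"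
      using Suc.prems(3) pr by (intro sum.mono_neutral_cong_right) (auto simp: B_def)
    also have "\<dots> = (\<Sum>a\<in>B1. Poly_Mapping.single 0 (c a) * (x 0 ^ hd a * Y a)) + (\<Sum>a\<in>B2. Poly_Mapping.single 0 (c a) * (x 0 ^ hd a * Y a))"
      using fin by (subst sum.union_disjoint[symmetric]) (auto simp: B1_def B2_def intro!: sum.cong)
    also have "(\<Sum>a\<in>B1. Poly_Mapping.single 0 (c a) * (x 0 ^ hd a * Y a)) = x 0 ^ h * ?g"
      unfolding sum_distrib_left by (intro sum.cong) (auto simp: B1_def algebra_simps)
    also have "(\<Sum>a\<in>B2. Poly_Mapping.single 0 (c a) * (x 0 ^ hd a * Y a)) = x 0 ^ h * (x 0 * ?r)"
      unfolding sum_distrib_left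
    proof (intro sum.cong refl)
      fix a assume "a \<in> B2"
      then have "hd a > h" using b_min[of a] by (auto simp: B2_def h_def)
      then have "hd a = h + (1 + (hd a - h - 1))" by simp
      then have "x 0 ^ hd a = x 0 ^ h * (x 0 * x 0 ^ (hd a - h - 1))"
        by (metis power_add power_one_right)
      then show "Poly_Mapping.single 0 (c a) * (x 0 ^ hd a * Y a)
          = x 0 ^ h * (x 0 * (Poly_Mapping.single 0 (c a) * x 0 ^ (hd a - h - 1) * Y a))"
        by (simp add: mult.assoc mult.left_commute)
    qed
    finally have "x 0 ^ h * (?g + x 0 * ?r) \<in> P 0" using Suc.prems(5) by (simp add: distrib_left)
    moreover have gV: "?g \<in> polys V" and rV: "?r \<in> polys V"
      using YV x0 by (auto intro!: polys_sum polys_mult)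
    ultimately have "?g + x 0 * ?r \<in> P 0"
      using x0 by (intro prime_ideal_power_cancel[OF prime[of 0], of "x 0" "?g + x 0 * ?r" h]) auto
    then have "?g + x 0 * ?r \<in> P 1" using sub by blast
    moreover have P1: "is_ideal V (P 1)" using prime[of 1] prime_idealD(1) by auto
    moreover have "x 0 * ?r \<in> P 1" using x0 rV is_idealD(5)[OF P1] by blast
    ultimately have g: "?g \<in> P 1" using ideal_diff[of V "P 1" "?g + x 0 * ?r" "x 0 * ?r"] by simp
    have len: "length a = Suc k" if "a \<in> B1" for a using that Suc.prems(4) by (auto simp: B1_def B_def)
    have inj: "inj_on tl B1"
    proof (rule inj_onI)
      fix a a' assume *: "a \<in> B1" "a' \<in> B1" "tl a = tl a'"
      then have "a \<noteq> []" "a' \<noteq> []" using len[of a] len[of a'] by force+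
      then show "a = a'" using * by (auto simp: B1_def intro: list.expand)
    qed
    have hd_tl: "h # tl a = a" if "a \<in> B1" for a using that len[OF that] by (cases a) (auto simp: B1_def)
    have "c (h # tl b) = 0"
    proof (rule Suc.IH[of "\<lambda>i. P (Suc i)" "\<lambda>i. x (Suc i)" "tl ` B1" "\<lambda>t. c (h # t)"])
      show "prime_chain V k (\<lambda>i. P (Suc i))" using Suc.prems(1) by (simp add: prime_chain_def)
      show "(\<Sum>a\<in>tl ` B1. Poly_Mapping.single 0 (c (h # a)) * (\<Prod>i<k. x (Suc i) ^ (a ! i))) \<in> P (Suc 0)"
        using g inj by (simp add: sum.reindex hd_tl Y_def One_nat_def cong: sum.cong)
      show "tl b \<in> tl ` B1" using b(1) by (auto simp: B1_def h_def)
    qed (use Suc.prems(2) fin len in \<open>auto simp: B1_def\<close>)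
    moreover have "b \<in> B1" using b(1) by (simp add: B1_def h_def)
    ultimately show False using b(1) hd_tl by (auto simp: B_def)
  qed
qed

section \<open>Counting monomials to bound chains of primes\<close>

definition exponent_bounded :: "nat \<Rightarrow> ('v, 'k::field) mpoly \<Rightarrow> bool" where
  "exponent_bounded b p \<longleftrightarrow> (\<forall>m\<in>supp p. \<forall>v. coeff m v \<le> b)"

lemma exponent_bounded_mult:
  assumes "exponent_bounded b p" "exponent_bounded c q" shows "exponent_bounded (b + c) (p * q)"
  unfolding exponent_bounded_def
proof (intro ballI allI)
  fix m v assume "m \<in> supp (p * q)"
  then obtain s t where "m = s + t" "s \<in> supp p" "t \<in> supp q" using subsetD[OF keys_mult[of p q]] by fast
  then show "coeff m v \<le> b + c" using assms by (simp add: exponent_bounded_def lookup_add add_mono)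
qed

lemma exponent_bounded_1: "exponent_bounded b 1"
  by (simp add: exponent_bounded_def)

lemma exponent_bounded_power: "exponent_bounded b p \<Longrightarrow> exponent_bounded (j * b) (p ^ j)"
  by (induction j) (simp_all add: exponent_bounded_mult exponent_bounded_1)

lemma exponent_bounded_mono: "exponent_bounded b p \<Longrightarrow> b \<le> c \<Longrightarrow> exponent_bounded c p"
  by (meson exponent_bounded_def le_trans)

lemma exponent_bounded_prod:
  "(\<And>i. i < k \<Longrightarrow> exponent_bounded b (f i)) \<Longrightarrow> exponent_bounded (k * b) (\<Prod>i<k. f i)"
proof (induction k)
  case (Suc k)
  then show ?case using exponent_bounded_mult[of "k * b" "\<Prod>i<k. f i" b "f k"] by (simp add: add.commute)
qed (simp add: exponent_bounded_1)

lemma exponent_bounded_ex: "\<exists>b. exponent_bounded b p"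
proof -
  let ?b = "\<Sum>m\<in>supp p. \<Sum>v\<in>supp m. coeff m v"
  have "coeff m v \<le> ?b" if "m \<in> supp p" for m v
  proof -
    have "coeff m v \<le> (\<Sum>v\<in>supp m. coeff m v)"
      by (cases "v \<in> supp m") (auto intro: member_le_sum simp: in_keys_iff)
    also have "\<dots> \<le> ?b" by (rule member_le_sum[OF that]) auto
    finally show ?thesis .
  qed
  then show ?thesis by (auto simp: exponent_bounded_def)
qed

text \<open>Bounding each exponent, rather than the degree, makes the count a plain power.\<close>

lemma card_bounded_monomials:
  assumes "finite F"
  shows "finite {m :: 'v \<Rightarrow>\<^sub>0 nat. supp m \<subseteq> F \<and> (\<forall>v. coeff m v \<le> b)}" (is "finite ?M")
    and "card {m :: 'v \<Rightarrow>\<^sub>0 nat. supp m \<subseteq> F \<and> (\<forall>v. coeff m v \<le> b)} \<le> (b + 1) ^ card F"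
proof -
  let ?f = "\<lambda>m. restrict (coeff m) F"
  have inj: "inj_on ?f ?M"
  proof (rule inj_onI, rule poly_mapping_eqI)
    fix m m' v assume *: "m \<in> ?M" "m' \<in> ?M" "?f m = ?f m'"
    show "coeff m v = coeff m' v"
    proof (cases "v \<in> F")
      case True then show ?thesis using fun_cong[OF *(3), of v] by simp
    next
      case False then have "v \<notin> supp m" "v \<notin> supp m'" using * by auto
      then show ?thesis by (simp add: in_keys_iff)
    qed
  qed
  have sub: "?f ` ?M \<subseteq> F \<rightarrow>\<^sub>E {..b}" by auto
  have fin: "finite (F \<rightarrow>\<^sub>E {..b})" using assms by (simp add: finite_PiE)
  show "finite ?M" using finite_imageD[OF finite_subset[OF sub fin] inj] .
  have "card ?M = card (?f ` ?M)" using inj by (simp add: card_image)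
  also have "\<dots> \<le> card (F \<rightarrow>\<^sub>E {..b})" by (rule card_mono[OF fin sub])
  also have "\<dots> = (b + 1) ^ card F" using assms by (simp add: card_funcsetE One_nat_def)
  finally show "card ?M \<le> (b + 1) ^ card F" .
qed

lemma vector_space_mpoly: "vector_space (\<lambda>c (p :: ('v, 'k::field) mpoly). Poly_Mapping.single 0 c * p)"
  by unfold_locales (simp_all add: distrib_left distrib_right single_add mult_single mult.assoc[symmetric])

text \<open>A growth argument with \<open>d\<close> variables outside \<open>P 0\<close>. The
  products of powers below \<open>N\<close> of elements chosen along the chain are
  \<open>N ^ k\<close> independent polynomials modulo \<open>P 0\<close>; \<open>proj F\<close>
  keeps them independent and moves them into a span of at most constant times \<open>N ^ d\<close>
  monomials. For \<open>k > d\<close> a large \<open>N\<close> is a contradiction.\<close>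

theorem prime_chain_length_le:
  fixes P :: "nat \<Rightarrow> ('v, 'k::field) mpoly set"
  assumes V: "finite V" and chain: "prime_chain V k P"
  shows "k \<le> card {v \<in> V. var v \<notin> P 0}"
proof (rule ccontr)
  interpret vs: vector_space "\<lambda>c (p :: ('v, 'k) mpoly). Poly_Mapping.single 0 c * p"
    by (rule vector_space_mpoly)
  define F where "F = {v \<in> V. var v \<notin> P 0}"
  define d where "d = card F"
  have finF: "finite F" using V by (simp add: F_def)
  assume "\<not> ?thesis"
  then have kd: "d < k" by (simp add: d_def F_def)
  have P0: "is_ideal V (P 0)" using chain by (auto simp: prime_chain_def prime_idealD(1))
  have PF: "sr_ideal V (Pow F) \<subseteq> P 0"
    by (rule sr_ideal_Pow_subset[OF P0]) (simp add: F_def)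
  have "\<forall>i<k. \<exists>y. y \<in> P (Suc i) - P i" using chain by (auto simp: prime_chain_def)
  then obtain x where x: "\<And>i. i < k \<Longrightarrow> x i \<in> P (Suc i) - P i" by metis
  have xV: "x i \<in> polys V" if "i < k" for i
  proof -
    have "is_ideal V (P (Suc i))" using chain that by (auto simp: prime_chain_def intro: prime_idealD(1))
    then show ?thesis using x[OF that] is_idealD(1) by blast
  qed
  define X where "X a = (\<Prod>i<k. x i ^ (a ! i))" for a
  have XV: "X a \<in> polys V" for a unfolding X_def by (intro polys_prod polys_power xV) auto
  obtain D where D: "\<And>i. i < k \<Longrightarrow> exponent_bounded D (x i)"
  proof -
    have "\<forall>i. \<exists>b. exponent_bounded b (x i)" using exponent_bounded_ex by blast
    then obtain b where b: "\<And>i. exponent_bounded (b i) (x i)" by metis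
    have "exponent_bounded (\<Sum>i<k. b i) (x i)" if "i < k" for i
      by (rule exponent_bounded_mono[OF b]) (use that in \<open>auto intro: member_le_sum\<close>)
    then show ?thesis using that by blast
  qed
  \<comment> \<open>All exponents in the products are at most \<open>k * (N * D)\<close>, and
    \<open>k * (N * D) + 1 \<le> c * N\<close>, so at most \<open>(c * N) ^ d\<close> monomials
    occur. The choice of \<open>N\<close> is the least one with
    \<open>c ^ d * N ^ d < N ^ Suc d\<close>.\<close>
  define c where "c = k * D + 1"
  define N where "N = c ^ d + 1"
  define L where "L = {a. set a \<subseteq> {..<N} \<and> length a = k}"
  have finL: "finite L" unfolding L_def by (rule finite_lists_length_eq) simp
  have cardL: "card L = N ^ k" unfolding L_def by (simp add: card_lists_length_eq)
  \<comment> \<open>A relation among the projections lifts to one modulo \<open>P 0\<close>, because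
    the kernel of \<open>proj F\<close> on \<open>polys V\<close> lies in
    \<open>P 0\<close>.\<close>
  have indep: "u a = 0" if "A \<subseteq> L" "(\<Sum>a\<in>A. Poly_Mapping.single 0 (u a) * proj F (X a)) = 0" "a \<in> A" for A u a
  proof (rule prime_chain_independent[where P = P and x = x and A = A and c = u and a = a, OF chain x])
    have "finite A" using that(1) finL finite_subset by blast
    let ?s = "\<Sum>a\<in>A. Poly_Mapping.single 0 (u a) * X a"
    have "?s \<in> polys V" using XV by (auto intro!: polys_sum)
    then have "?s - proj F ?s \<in> P 0" using diff_proj_in_sr_ideal PF by blast
    moreover have "proj F ?s = 0" using that(2) by (simp add: proj_sum proj_const_mult)
    ultimately show "(\<Sum>a\<in>A. Poly_Mapping.single 0 (u a) * (\<Prod>i<k. x i ^ (a ! i))) \<in> P 0"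
      by (simp add: X_def)
    show "finite A" by fact
    show "\<And>a. a \<in> A \<Longrightarrow> length a = k" using that(1) by (auto simp: L_def)
    show "a \<in> A" by fact
  qed
  have inj: "inj_on (\<lambda>a. proj F (X a)) L"
  proof (rule inj_onI, rule ccontr)
    fix a b assume *: "a \<in> L" "b \<in> L" "proj F (X a) = proj F (X b)" "a \<noteq> b"
    have "(1 :: 'k) = 0" using * indep[of "{a, b}" "\<lambda>t. if t = a then 1 else - 1" a]
      by (auto simp: single_uminus)
    then show False by simp
  qed
  have ind: "vs.independent ((\<lambda>a. proj F (X a)) ` L)"
    unfolding vs.dependent_explicit
  proof clarify
    fix t u v assume *: "finite t" "t \<subseteq> (\<lambda>a. proj F (X a)) ` L"
      "(\<Sum>v\<in>t. Poly_Mapping.single 0 (u v) * v) = 0" "v \<in> t" "u v \<noteq> 0"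
    then obtain A where A: "A \<subseteq> L" "t = (\<lambda>a. proj F (X a)) ` A" by (auto simp: subset_image_iff)
    have "inj_on (\<lambda>a. proj F (X a)) A" using inj A(1) inj_on_subset by blast
    then have "(\<Sum>a\<in>A. Poly_Mapping.single 0 (u (proj F (X a))) * proj F (X a)) = 0"
      using *(3) by (simp add: A(2) sum.reindex)
    then show False using indep[OF A(1), of "\<lambda>a. u (proj F (X a))"] *(4,5) A(2) by auto
  qed
  define b where "b = k * (N * D)"
  define M where "M = {m :: 'v \<Rightarrow>\<^sub>0 nat. supp m \<subseteq> F \<and> (\<forall>v. coeff m v \<le> b)}"
  have M: "finite M" "card M \<le> (b + 1) ^ d" unfolding M_def d_def by (rule card_bounded_monomials[OF finF])+
  have span: "(\<lambda>a. proj F (X a)) ` L \<subseteq> vs.span (monom ` M)"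
  proof clarify
    fix a assume a: "a \<in> L"
    have "exponent_bounded (N * D) (x i ^ (a ! i))" if "i < k" for i
    proof (rule exponent_bounded_mono[OF exponent_bounded_power[OF D[OF that]]])
      have "a ! i < N" using a that nth_mem[of i a] unfolding L_def by blast
      then show "a ! i * D \<le> N * D" by simp
    qed
    then have "exponent_bounded b (X a)" unfolding X_def b_def by (rule exponent_bounded_prod)
    then have "m \<in> M" if "m \<in> supp (proj F (X a))" for m
      using that by (auto simp: M_def supp_proj exponent_bounded_def)
    then have "(\<Sum>m\<in>supp (proj F (X a)). Poly_Mapping.single 0 (coeff (proj F (X a)) m) * monom m) \<in> vs.span (monom ` M)"
      by (intro vs.span_sum vs.span_scale vs.span_base) auto
    then show "proj F (X a) \<in> vs.span (monom ` M)"
      by (simp only: single_eq_const_mult_monom[symmetric] poly_eq_sum_terms[symmetric])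
  qed
  have "card ((\<lambda>a. proj F (X a)) ` L) \<le> card (monom ` M :: ('v,'k) mpoly set)"
    using vs.independent_span_bound[OF _ ind span] M(1) by blast
  then have "N ^ k \<le> card (monom ` M :: ('v,'k) mpoly set)" using cardL by (simp add: card_image[OF inj])
  also have "\<dots> \<le> card M" by (rule card_image_le[OF M(1)])
  also have "\<dots> \<le> (b + 1) ^ d" by (rule M(2))
  also have "\<dots> \<le> (c * N) ^ d" by (intro power_mono) (auto simp: b_def c_def N_def algebra_simps)
  also have "\<dots> = c ^ d * N ^ d" by (rule power_mult_distrib)
  also have "\<dots> < N * N ^ d" by (simp add: N_def)
  also have "\<dots> = N ^ (Suc d)" by simp
  also have "\<dots> \<le> N ^ k" using kd by (intro power_increasing) (auto simp: N_def)
  finally show False by simp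
qed

section \<open>Height and dimension of Stanley-Reisner ideals\<close>

lemma sr_ideal_Pow_strict:
  assumes "F \<subset> G" "G \<subseteq> V"
  shows "sr_ideal V (Pow G) \<subset> (sr_ideal V (Pow F) :: ('v, 'k::field) mpoly set)"
proof -
  obtain v where v: "v \<in> G" "v \<notin> F" using assms by blast
  have "var v \<in> (sr_ideal V (Pow F) :: ('v, 'k) mpoly set)" "var v \<notin> (sr_ideal V (Pow G) :: ('v, 'k) mpoly set)"
    using v assms by auto
  moreover have "sr_ideal V (Pow G) \<subseteq> (sr_ideal V (Pow F) :: ('v, 'k) mpoly set)"
    using assms by (intro sr_ideal_mono) auto
  ultimately show ?thesis by blast
qed

lemma monomial_prime_chain:
  assumes "F \<subseteq> G" "G \<subseteq> V" "finite V"
  obtains P :: "nat \<Rightarrow> ('v::linorder, 'k::field) mpoly set"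
  where "prime_chain V (card (G - F)) P" "P 0 = sr_ideal V (Pow G)" "P (card (G - F)) = sr_ideal V (Pow F)"
proof -
  obtain vs where vs: "set vs = G - F" "distinct vs"
    using finite_distinct_list[of "G - F"] assms by (meson finite_Diff finite_subset)
  have len: "length vs = card (G - F)" using distinct_card[OF vs(2)] vs(1) by simp
  let ?F = "\<lambda>i. F \<union> set (drop i vs)"
  let ?P = "\<lambda>i. sr_ideal V (Pow (?F i)) :: ('v, 'k) mpoly set"
  have FV: "?F i \<subseteq> V" for i using vs assms set_drop_subset[of i vs] by auto
  have "?P i \<subset> ?P (Suc i)" if i: "i < length vs" for i
  proof (rule sr_ideal_Pow_strict[OF _ FV])
    have d: "drop i vs = vs ! i # drop (Suc i) vs" using i by (rule Cons_nth_drop_Suc[symmetric])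
    have "distinct (drop i vs)" using vs(2) by simp
    then have "vs ! i \<notin> set (drop (Suc i) vs)" by (simp add: d)
    moreover have "vs ! i \<in> G - F" using vs(1) i nth_mem by blast
    ultimately show "?F (Suc i) \<subset> ?F i" by (auto simp: d)
  qed
  then have "prime_chain V (card (G - F)) ?P"
    unfolding prime_chain_def len[symmetric] using prime_sr_ideal_Pow[OF FV] by blast
  then show ?thesis using that[of ?P] vs(1) len assms(1) by (simp add: Un_absorb1)
qed

lemma prime_chain_append:
  assumes "prime_chain V k P" "prime_chain V l Q" "P k = Q 0"
  shows "prime_chain V (k + l) (\<lambda>i. if i \<le> k then P i else Q (i - k))"
  unfolding prime_chain_def
proof (intro conjI allI impI)
  fix i assume "i < k + l"
  then consider "i < k" | "i = k" "0 < l" | "k < i" "i - k < l" by linarith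
  then show "(if i \<le> k then P i else Q (i - k)) \<subset> (if Suc i \<le> k then P (Suc i) else Q (Suc i - k))"
  proof cases
    case 3
    then have "Suc i - k = Suc (i - k)" by simp
    then show ?thesis using 3 assms(2) by (simp add: prime_chain_def)
  qed (use assms in \<open>auto simp: prime_chain_def\<close>)
qed (use assms in \<open>auto simp: prime_chain_def\<close>)

text \<open>If these variables formed a nonface, their product would lie in the ideal, hence in
  \<open>Q\<close>, and primality would put one of them in \<open>Q\<close>. In this way arbitrary
  primes are compared with faces.\<close>

lemma nonvanishing_face:
  fixes Q :: "('v, 'k::field) mpoly set"
  assumes Q: "prime_ideal V Q" and sub: "sr_ideal V \<Delta> \<subseteq> Q" and V: "finite V"
  shows "{v \<in> V. var v \<notin> Q} \<in> \<Delta>"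
proof (rule ccontr)
  let ?F = "{v \<in> V. var v \<notin> Q}"
  assume "?F \<notin> \<Delta>"
  then have "sqf_monom ?F \<in> sr_ideal V \<Delta>" using V by simp
  then have "sqf_monom ?F \<in> Q" using sub by blast
  moreover have "sqf_monom G \<notin> Q" if "finite G" "G \<subseteq> ?F" for G
    using that
  proof (induction G rule: finite_induct)
    case empty
    then show ?case using prime_idealD(2)[OF Q] by (simp add: sqf_monom_def monom_def)
  next
    case (insert v G)
    have "sqf_monom (insert v G) = var v * (sqf_monom G :: ('v, 'k) mpoly)"
      using insert by (simp add: sqf_monom_def monom_add var_eq_monom)
    moreover have "(sqf_monom G :: ('v, 'k) mpoly) \<in> polys V"
      using insert by (auto simp: sqf_monom_def supp_sum_single)
    moreover have "v \<in> V" "var v \<notin> Q" "sqf_monom G \<notin> Q" using insert by auto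
    ultimately show ?case using prime_idealD(3)[OF Q, of "var v" "sqf_monom G"] by force
  qed
  ultimately show False using V by simp
qed

text \<open>Upper bound: a chain ending in the prime of the largest face \<open>F\<close> extends by
  \<open>card F\<close> steps to the ideal of all variables, and its total length is at most
  \<open>card V\<close>. Lower bound: every prime over the ideal contains the monomial prime of a
  face, from which a chain descends to 0.\<close>

lemma height_sr_ideal:
  assumes V: "finite V" and F: "F \<in> \<Delta>" "F \<subseteq> V" and D: "down_closed \<Delta>"
    and max: "\<And>G. G \<in> \<Delta> \<Longrightarrow> card G \<le> card F"
  shows "height V (sr_ideal V \<Delta> :: ('v::linorder, 'k::field) mpoly set) = enat (card V - card F)"
proof (rule antisym)
  let ?Q = "sr_ideal V (Pow F) :: ('v, 'k) mpoly set"
  have "prime_ideal V ?Q" by (rule prime_sr_ideal_Pow[OF F(2)])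
  moreover have "sr_ideal V \<Delta> \<subseteq> ?Q" using F D by (intro sr_ideal_mono) (auto intro: down_closedD)
  ultimately have "height V (sr_ideal V \<Delta> :: ('v, 'k) mpoly set) \<le> height_prime V ?Q"
    unfolding height_def by (intro INF_lower) auto
  also have "\<dots> \<le> enat (card V - card F)"
    unfolding height_prime_def
  proof (rule SUP_least)
    fix k assume "k \<in> {k. \<exists>P. prime_chain V k P \<and> P k = ?Q}"
    then obtain P where P: "prime_chain V k P" "P k = ?Q" by blast
    obtain R :: "nat \<Rightarrow> ('v, 'k) mpoly set" where R: "prime_chain V (card (F - {})) R" "R 0 = ?Q"
      by (rule monomial_prime_chain[OF empty_subsetI F(2) V])
    have "prime_chain V (k + card F) (\<lambda>i. if i \<le> k then P i else R (i - k))"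
      using prime_chain_append[OF P(1) R(1)] P(2) R(2) by simp
    from prime_chain_length_le[OF V this] have "k + card F \<le> card V"
      by (rule order_trans) (auto intro: card_mono V)
    then show "enat k \<le> enat (card V - card F)" by simp
  qed
  finally show "height V (sr_ideal V \<Delta> :: ('v, 'k) mpoly set) \<le> enat (card V - card F)" .
  show "enat (card V - card F) \<le> height V (sr_ideal V \<Delta> :: ('v, 'k) mpoly set)"
    unfolding height_def
  proof (rule INF_greatest)
    fix Q :: "('v, 'k) mpoly set" assume "Q \<in> {Q. prime_ideal V Q \<and> sr_ideal V \<Delta> \<subseteq> Q}"
    then have Q: "prime_ideal V Q" "sr_ideal V \<Delta> \<subseteq> Q" by auto
    define G where "G = {v \<in> V. var v \<notin> Q}"
    have "G \<in> \<Delta>" unfolding G_def by (rule nonvanishing_face[OF Q V])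
    then have card: "card G \<le> card F" by (rule max)
    show "enat (card V - card F) \<le> height_prime V Q"
    \<comment> \<open>For \<open>G = V\<close> the claim is trivial, since
      \<open>card V \<le> card F\<close> makes the truncated difference 0.\<close>
    proof (cases "G = V")
      case True
      then show ?thesis using card by (simp add: enat_0)
    next
      case False
      then obtain w where w: "w \<in> V" "w \<notin> G" by (auto simp: G_def)
      have GV: "insert w G \<subseteq> V" "finite G" using w V by (auto simp: G_def)
      obtain P :: "nat \<Rightarrow> ('v, 'k) mpoly set" where P: "prime_chain V (card (V - insert w G)) P"
        "P (card (V - insert w G)) = sr_ideal V (Pow (insert w G))"
        by (rule monomial_prime_chain[OF GV(1) subset_refl V])
      have "sr_ideal V (Pow G) \<subseteq> Q"
        by (rule sr_ideal_Pow_subset[OF prime_idealD(1)[OF Q(1)]]) (simp add: G_def)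
      moreover have "sr_ideal V (Pow (insert w G)) \<subset> (sr_ideal V (Pow G) :: ('v, 'k) mpoly set)"
        using w GV by (intro sr_ideal_Pow_strict) auto
      ultimately have lt: "sr_ideal V (Pow (insert w G)) \<subset> Q" by blast
      define k where "k = card (V - insert w G)"
      \<comment> \<open>\<open>Q\<close> takes the place of the monomial prime of \<open>G\<close>
        at the top of the chain, so it does not matter whether the two coincide.\<close>
      have "prime_chain V (Suc k) (\<lambda>i. if i \<le> k then P i else Q)"
        using P lt Q(1) unfolding k_def[symmetric] prime_chain_def by (auto simp: le_Suc_eq less_Suc_eq)
      then have "enat (Suc k) \<le> height_prime V Q"
        unfolding height_prime_def by (intro SUP_upper CollectI exI[of _ "\<lambda>i. if i \<le> k then P i else Q"]) auto
      moreover have "Suc k = card V - card G" 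
      proof -
        have "card (V - insert w G) = card V - card (insert w G)" using GV V by (intro card_Diff_subset) auto
        moreover have "card (insert w G) \<le> card V" using GV V by (intro card_mono)
        ultimately show ?thesis using w GV by (simp add: k_def)
      qed
      ultimately show ?thesis using card by (metis diff_le_mono2 enat_ord_simps(1) order_trans)
    qed
  qed
qed

lemma krull_dim_sr_ideal:
  assumes V: "finite V" and F: "F \<in> \<Delta>" "F \<subseteq> V" and D: "down_closed \<Delta>"
    and max: "\<And>G. G \<in> \<Delta> \<Longrightarrow> card G \<le> card F"
  shows "krull_dim V (sr_ideal V \<Delta> :: ('v::linorder, 'k::field) mpoly set) = enat (card F)"
proof (rule antisym)
  show "krull_dim V (sr_ideal V \<Delta> :: ('v, 'k) mpoly set) \<le> enat (card F)"
    unfolding krull_dim_def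
  proof (rule SUP_least)
    fix k assume "k \<in> {k. \<exists>P. prime_chain V k P \<and> (sr_ideal V \<Delta> :: ('v, 'k) mpoly set) \<subseteq> P 0}"
    then obtain P :: "nat \<Rightarrow> ('v, 'k) mpoly set" where P: "prime_chain V k P" "sr_ideal V \<Delta> \<subseteq> P 0" by blast
    have "prime_ideal V (P 0)" using P(1) by (simp add: prime_chain_def)
    then have "{v \<in> V. var v \<notin> P 0} \<in> \<Delta>" using P(2) V by (rule nonvanishing_face)
    then have "card {v \<in> V. var v \<notin> P 0} \<le> card F" by (rule max)
    then show "enat k \<le> enat (card F)" using prime_chain_length_le[OF V P(1)] by simp
  qed
  obtain P :: "nat \<Rightarrow> ('v, 'k) mpoly set" where P: "prime_chain V (card (F - {})) P" "P 0 = sr_ideal V (Pow F)"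
    by (rule monomial_prime_chain[OF empty_subsetI F(2) V])
  have "sr_ideal V \<Delta> \<subseteq> P 0" unfolding P(2) using F D by (intro sr_ideal_mono) (auto intro: down_closedD)
  then show "enat (card F) \<le> krull_dim V (sr_ideal V \<Delta> :: ('v, 'k) mpoly set)"
    unfolding krull_dim_def using P(1) by (intro SUP_upper) auto
qed

section \<open>Depth\<close>

text \<open>Krull's argument: an ideal maximal among those that contain \<open>J\<close> and miss a
  multiplicative set is prime. Zorn's lemma supplies it.\<close>

lemma ex_prime_ideal_disjoint:
  fixes J :: "('v, 'k::field) mpoly set"
  assumes J: "is_ideal V J" and S: "1 \<in> S" "\<And>s t. s \<in> S \<Longrightarrow> t \<in> S \<Longrightarrow> s * t \<in> S"
    and disj: "J \<inter> S = {}"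
  obtains Q where "prime_ideal V Q" "J \<subseteq> Q" "Q \<inter> S = {}"
proof -
  define A where "A = {I. is_ideal V I \<and> J \<subseteq> I \<and> I \<inter> S = {}}"
  have "A \<noteq> {}" using J disj by (auto simp: A_def)
  moreover have "\<Union>C \<in> A" if C: "C \<noteq> {}" "subset.chain A C" for C
  proof -
    have CA: "I \<in> A" if "I \<in> C" for I using C that by (auto simp: subset.chain_def)
    have "is_ideal V (\<Union>C)" unfolding is_ideal_def
    proof (intro conjI ballI)
      show "\<Union>C \<subseteq> polys V" using CA is_idealD(1) by (fastforce simp: A_def)
      show "0 \<in> \<Union>C" using C(1) CA is_idealD(2) by (fastforce simp: A_def)
    next
      fix a b assume "a \<in> \<Union>C" "b \<in> \<Union>C"
      then obtain I I' where I: "I \<in> C" "I' \<in> C" "a \<in> I" "b \<in> I'" by blast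
      then have "I \<subseteq> I' \<or> I' \<subseteq> I" using C(2) by (auto simp: subset.chain_def)
      then obtain I'' where "I'' \<in> C" "a \<in> I''" "b \<in> I''" using I by blast
      then show "a + b \<in> \<Union>C" using CA[of I''] is_idealD(3)[of V I'' a b] by (auto simp: A_def)
    next
      fix r a :: "('v, 'k) mpoly" assume "r \<in> polys V" "a \<in> \<Union>C"
      then obtain I where "I \<in> C" "a \<in> I" by blast
      then show "r * a \<in> \<Union>C" using CA[of I] is_idealD(4)[of V I r a] \<open>r \<in> polys V\<close> by (auto simp: A_def)
    qed
    then show ?thesis using C(1) CA unfolding A_def by blast
  qed
  ultimately obtain M where M: "M \<in> A" and max: "\<And>X. X \<in> A \<Longrightarrow> M \<subseteq> X \<Longrightarrow> X = M"
    using subset_Zorn_nonempty[of A] by metis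
  have I: "is_ideal V M" "J \<subseteq> M" "M \<inter> S = {}" using M by (auto simp: A_def)
  have meets: "\<exists>m r. m \<in> M \<and> r \<in> polys V \<and> m + r * a \<in> S" if "a \<in> polys V" "a \<notin> M" for a
  proof (rule ccontr)
    assume "\<not> ?thesis"
    then have "adjoin V M a \<inter> S = {}" by (auto simp: adjoin_def)
    then have "adjoin V M a \<in> A"
      using adjoin_is_ideal[OF I(1) that(1)] adjoin_superset[OF I(1), of a] I(2) by (auto simp: A_def)
    then have "adjoin V M a = M" using max adjoin_superset[OF I(1)] by blast
    then show False using adjoin_member[OF I(1), of a] that(2) by blast
  qed
  have "a \<in> M \<or> b \<in> M" if ab: "a \<in> polys V" "b \<in> polys V" "a * b \<in> M" for a b
  proof (rule ccontr)
    assume "\<not> ?thesis"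
    then obtain m r n t where *: "m \<in> M" "r \<in> polys V" "m + r * a \<in> S" "n \<in> M" "t \<in> polys V" "n + t * b \<in> S"
      using meets ab by metis
    then have in_S: "(m + r * a) * (n + t * b) \<in> S" by (intro S(2))
    have "(m + r * a) * (n + t * b) = (n + t * b) * m + ((r * a) * n + (r * t) * (a * b))"
      by (simp add: algebra_simps)
    with in_S have in_S': "(n + t * b) * m + ((r * a) * n + (r * t) * (a * b)) \<in> S" by simp
    have nV: "n \<in> polys V" using * is_idealD(1)[OF I(1)] by blast
    have "(n + t * b) * m \<in> M" by (rule is_idealD(4)[OF I(1)]) (use * ab nV in simp_all)
    moreover have "(r * a) * n \<in> M" by (rule is_idealD(4)[OF I(1)]) (use * ab in simp_all)
    moreover have "(r * t) * (a * b) \<in> M" by (rule is_idealD(4)[OF I(1)]) (use * ab in simp_all)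
    ultimately have "(n + t * b) * m + ((r * a) * n + (r * t) * (a * b)) \<in> M"
      using is_idealD(3)[OF I(1)] by blast
    then show False using I(3) in_S' by blast
  qed
  moreover have "M \<noteq> polys V" using I(3) S(1) polys_1 by blast
  ultimately have "prime_ideal V M" using I(1) by (simp add: prime_ideal_def)
  then show ?thesis using that I by blast
qed

text \<open>The chain grows downwards, starting from a prime over the whole sequence. Each element,
  taken from the last to the first, yields a strictly smaller prime that omits it and still contains
  the ideal of the preceding elements.\<close>

theorem regular_seq_length_le_krull_dim:
  fixes I :: "('v, 'k::field) mpoly set"
  assumes I: "is_ideal V I" and reg: "regular_seq V I fs"
  shows "enat (length fs) \<le> krull_dim V I"
proof -
  define J where "J i = ideal_gen V (I \<union> set (take i fs))" for i
  have "var ` V \<subseteq> (polys V :: ('v, 'k) mpoly set)" by auto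
  from is_idealD(1)[OF ideal_gen_is_ideal[OF this]]
  have fsV: "set fs \<subseteq> polys V" using reg unfolding regular_seq_def by blast
  have sub: "I \<union> set (take i fs) \<subseteq> polys V" for i
    using fsV is_idealD(1)[OF I] set_take_subset[of i fs] by auto
  have ideal: "is_ideal V (J i)" for i unfolding J_def by (rule ideal_gen_is_ideal[OF sub])
  have "\<exists>P. prime_chain V j P \<and> J (length fs - j) \<subseteq> P 0" if "j \<le> length fs" for j
    using that
  proof (induction j)
    case 0
    have "J (length fs) \<noteq> polys V" using reg by (simp add: J_def regular_seq_def)
    have "J (length fs) \<inter> {1} = {}"
    proof (rule ccontr)
      assume "J (length fs) \<inter> {1} \<noteq> {}"
      then have "polys V \<subseteq> J (length fs)" using is_idealD(4)[OF ideal, of _ 1 "length fs"] by auto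
      then show False using \<open>J (length fs) \<noteq> polys V\<close> is_idealD(1)[OF ideal] by blast
    qed
    from ex_prime_ideal_disjoint[OF ideal _ _ this]
    obtain Q where "prime_ideal V Q" "J (length fs) \<subseteq> Q" by auto
    then show ?case by (intro exI[of _ "\<lambda>_. Q"]) (auto simp: prime_chain_def)
  next
    case (Suc j)
    then obtain P where P: "prime_chain V j P" "J (length fs - j) \<subseteq> P 0" by auto
    define i where "i = length fs - Suc j"
    have i: "length fs - j = Suc i" "i < length fs" using Suc.prems by (auto simp: i_def)
    define f where "f = fs ! i"
    have P0: "prime_ideal V (P 0)" using P(1) by (simp add: prime_chain_def)
    have "f \<in> set (take (Suc i) fs)" using i by (simp add: take_Suc_conv_app_nth f_def)
    then have fP: "f \<in> P 0" using P(2) i ideal_gen_superset[of "I \<union> set (take (Suc i) fs)" V] by (auto simp: J_def)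
    have fV: "f \<in> polys V" using fsV i by (auto simp: f_def)
    have "J i \<subseteq> J (Suc i)" unfolding J_def
      by (rule ideal_gen_least[OF ideal[unfolded J_def]])
        (use ideal_gen_superset[of "I \<union> set (take (Suc i) fs)" V] set_take_subset_set_take[of i "Suc i" fs] in auto)
    then have JP: "J i \<subseteq> P 0" using P(2) i by auto
    have colon: "colon V (J i) f = J i" using reg i by (simp add: regular_seq_def J_def f_def)
    have cancel: "s \<in> J i" if "s \<in> polys V" "s * f ^ e \<in> J i" for s e
      using that
    proof (induction e arbitrary: s)
      case (Suc e)
      have "(s * f) * f ^ e \<in> J i" using Suc.prems(2) by (simp add: mult.assoc)
      moreover have "s * f \<in> polys V" using Suc.prems(1) fV by simp
      ultimately have "s * f \<in> J i" by (rule Suc.IH[rotated])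
      then show ?case using Suc.prems colon by (auto simp: colon_def)
    qed simp
    \<comment> \<open>A prime that avoids \<open>S\<close> lies inside \<open>P 0\<close> (take
      \<open>e = 0\<close>) and omits \<open>f\<close> (take \<open>s = 1\<close>). That
      \<open>J i\<close> avoids \<open>S\<close> is where regularity enters, through
      \<open>cancel\<close>.\<close>
    define S where "S = {s * f ^ e | s e. s \<in> polys V - P 0}"
    have one: "1 \<in> polys V - P 0" using prime_idealD(2)[OF P0] by simp
    obtain Q where Q: "prime_ideal V Q" "J i \<subseteq> Q" "Q \<inter> S = {}"
    proof (rule ex_prime_ideal_disjoint[OF ideal])
      show "1 \<in> S" unfolding S_def using one by (intro CollectI exI[of _ 1] exI[of _ 0]) auto
      show "s * t \<in> S" if st: "s \<in> S" "t \<in> S" for s t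
      proof -
        obtain a e b e' where "s = a * f ^ e" "t = b * f ^ e'" "a \<in> polys V - P 0" "b \<in> polys V - P 0"
          using st unfolding S_def by blast
        moreover from this have "s * t = (a * b) * f ^ (e + e')" by (simp add: power_add algebra_simps)
        moreover from calculation have "a * b \<in> polys V - P 0" using prime_idealD(3)[OF P0, of a b] by auto
        ultimately show ?thesis unfolding S_def by blast
      qed
      show "J i \<inter> S = {}" unfolding S_def using cancel JP by blast
    qed
    have "f \<notin> Q"
    proof -
      have "f \<in> S" unfolding S_def using one by (intro CollectI exI[of _ 1]) auto
      then show ?thesis using Q(3) by blast
    qed
    moreover have "Q \<subseteq> P 0"
    proof
      fix q assume q: "q \<in> Q"
      show "q \<in> P 0"
      proof (rule ccontr)
        assume "q \<notin> P 0"
        then have "q \<in> S" unfolding S_def using q is_idealD(1)[OF prime_idealD(1)[OF Q(1)]]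
          by (intro CollectI exI[of _ q] exI[of _ 0]) auto
        then show False using q Q(3) by blast
      qed
    qed
    ultimately have "Q \<subset> P 0" using fP by blast
    then have "prime_chain V (Suc j) (case_nat Q P)"
      using P(1) Q(1) unfolding prime_chain_def by (auto split: nat.split)
    moreover have "J (length fs - Suc j) \<subseteq> case_nat Q P 0" using Q(2) by (simp add: i_def)
    ultimately show ?case by blast
  qed
  from this[of "length fs"] obtain P where P: "prime_chain V (length fs) P" "J 0 \<subseteq> P 0" by auto
  moreover have "J 0 = I" using ideal_gen_ideal[OF I] by (simp add: J_def)
  ultimately show ?thesis unfolding krull_dim_def by (intro SUP_upper) auto
qed

section \<open>Regular sequences and vertex decomposition\<close>

text \<open>The colon condition of \<open>regular_seq\<close> in recursive form: the ideal grows
  instead of the prefix, so inductions can vary the ideal. Properness is established in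
  \<open>star_decomposable_cohen_macaulay\<close>, where everything lies in the ideal of all
  variables.\<close>

fun regular_on :: "'v set \<Rightarrow> ('v, 'k::field) mpoly set \<Rightarrow> ('v, 'k) mpoly list \<Rightarrow> bool" where
  "regular_on V I [] \<longleftrightarrow> True"
| "regular_on V I (f # fs) \<longleftrightarrow> colon V I f \<subseteq> I \<and> regular_on V (adjoin V I f) fs"

lemma ideal_gen_adjoin_Un:
  assumes I: "is_ideal V I" and f: "f \<in> polys V" and T: "T \<subseteq> polys V"
  shows "ideal_gen V (I \<union> insert f T) = ideal_gen V (adjoin V I f \<union> T)"
proof (intro equalityI ideal_gen_least)
  have A: "adjoin V I f \<union> T \<subseteq> polys V" using is_idealD(1)[OF adjoin_is_ideal[OF I f]] T by blast
  show "is_ideal V (ideal_gen V (adjoin V I f \<union> T))" by (rule ideal_gen_is_ideal[OF A])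
  show "I \<union> insert f T \<subseteq> ideal_gen V (adjoin V I f \<union> T)"
    using ideal_gen_superset[of "adjoin V I f \<union> T" V] adjoin_superset[OF I, of f] adjoin_member[OF I, of f] by blast
  have B: "I \<union> insert f T \<subseteq> polys V" using is_idealD(1)[OF I] f T by blast
  show i: "is_ideal V (ideal_gen V (I \<union> insert f T))" by (rule ideal_gen_is_ideal[OF B])
  have "ideal_gen V (insert f I) \<subseteq> ideal_gen V (I \<union> insert f T)"
    using ideal_gen_superset[of "I \<union> insert f T" V] by (intro ideal_gen_least[OF i]) blast
  then show "adjoin V I f \<union> T \<subseteq> ideal_gen V (I \<union> insert f T)"
    using ideal_gen_superset[of "I \<union> insert f T" V] adjoin_eq_ideal_gen[OF I f] by blast
qed

lemma regular_on_colon: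
  assumes "is_ideal V I" "set fs \<subseteq> polys V" "regular_on V I fs" "i < length fs"
  shows "colon V (ideal_gen V (I \<union> set (take i fs))) (fs ! i) = ideal_gen V (I \<union> set (take i fs))"
  using assms
proof (induction fs arbitrary: I i)
  case (Cons f fs)
  have I: "is_ideal V I" and f: "f \<in> polys V" and fs: "set fs \<subseteq> polys V" using Cons.prems by auto
  show ?case
  proof (cases i)
    case 0
    then show ?thesis using Cons.prems(3) colon_superset[OF I f] ideal_gen_ideal[OF I] by auto
  next
    case (Suc j)
    have "set (take j fs) \<subseteq> polys V" using fs set_take_subset by fast
    from ideal_gen_adjoin_Un[OF I f this]
    show ?thesis using Suc Cons.IH[OF adjoin_is_ideal[OF I f] fs, of j] Cons.prems by simp
  qed
qed simp

text \<open>The colon and sum ideals are the outer terms of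
 \<open>0 \<rightarrow> R/(I : x) \<rightarrow> R/I \<rightarrow> R/(I + x) \<rightarrow> 0\<close>, which stays exact modulo an element regular on both.\<close>
lemma regular_on_colon_adjoin:
  assumes "is_ideal V I" "x \<in> polys V" "set fs \<subseteq> polys V"
    "regular_on V (colon V I x) fs" "regular_on V (adjoin V I x) fs"
  shows "regular_on V I fs"
  using assms
proof (induction fs arbitrary: I)
  case (Cons f fs)
  have I: "is_ideal V I" and x: "x \<in> polys V" and f: "f \<in> polys V" and fs: "set fs \<subseteq> polys V"
    using Cons.prems by auto
  have c1: "p \<in> colon V I x" if "p \<in> polys V" "p * f \<in> colon V I x" for p
    using Cons.prems(4) that by (auto simp: colon_def)
  have c2: "p \<in> adjoin V I x" if "p \<in> polys V" "p * f \<in> adjoin V I x" for p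
    using Cons.prems(5) that by (auto simp: colon_def)
  have "colon V I f \<subseteq> I"
  proof
    fix p assume p: "p \<in> colon V I f"
    then have pV: "p \<in> polys V" "p * f \<in> I" by (auto simp: colon_def)
    then obtain a q where a: "p = a + q * x" "a \<in> I" "q \<in> polys V"
      using c2[of p] adjoin_superset[OF I, of x] unfolding adjoin_def by blast
    have "p * f - f * a \<in> I" using pV(2) is_idealD(4)[OF I f a(2)] by (rule ideal_diff[OF I])
    then have "q * f * x \<in> I" by (simp add: a(1) algebra_simps)
    then have "q * f \<in> colon V I x" using a f by (auto simp: colon_def)
    then have "q * x \<in> I" using c1 a by (auto simp: colon_def)
    then show "p \<in> I" using a is_idealD(3)[OF I] by simp
  qed
  \<comment> \<open>To apply the induction hypothesis to \<open>adjoin V I f\<close>, the colon by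
    \<open>x\<close> must commute with adding \<open>f\<close>. This is where regularity of
    \<open>f\<close> modulo \<open>adjoin V I x\<close> is used again.\<close>
  moreover have "colon V (adjoin V I f) x = adjoin V (colon V I x) f"
  proof (intro equalityI subsetI)
    fix p assume "p \<in> colon V (adjoin V I f) x"
    then obtain a r where p: "p \<in> polys V" "p * x = a + r * f" "a \<in> I" "r \<in> polys V"
      by (auto simp: colon_def adjoin_def)
    have "r * f = (- a) + p * x" using p(2) by simp
    then have "r * f \<in> adjoin V I x" unfolding adjoin_def using p ideal_uminus[OF I] by blast
    then obtain b s where r: "r = b + s * x" "b \<in> I" "s \<in> polys V" using c2[OF p(4)] unfolding adjoin_def by blast
    have "(p - s * f) * x = a + f * b" using p(2) by (simp add: r(1) algebra_simps)
    moreover have "a + f * b \<in> I" using p r f is_idealD(3,4)[OF I] by blast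
    ultimately have "p - s * f \<in> colon V I x" using p r f by (auto simp: colon_def)
    then have "(p - s * f) + s * f \<in> adjoin V (colon V I x) f" using r(3) unfolding adjoin_def by blast
    then show "p \<in> adjoin V (colon V I x) f" by simp
  next
    fix p assume "p \<in> adjoin V (colon V I x) f"
    then obtain a r where p: "p = a + r * f" "a \<in> polys V" "a * x \<in> I" "r \<in> polys V"
      by (auto simp: colon_def adjoin_def)
    have "p * x = a * x + (r * x) * f" by (simp add: p(1) algebra_simps)
    then have "p * x \<in> adjoin V I f" unfolding adjoin_def using p x polys_mult by blast
    then show "p \<in> colon V (adjoin V I f) x" using p f by (auto simp: colon_def)
  qed
  moreover have "adjoin V (adjoin V I f) x = adjoin V (adjoin V I x) f" by (rule adjoin_adjoin_commute)
  ultimately show ?case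
    using Cons.IH[OF adjoin_is_ideal[OF I f] x fs] Cons.prems(4,5) by simp
qed simp

section \<open>Elementary symmetric polynomials as regular sequences\<close>

definition esym :: "'v set \<Rightarrow> nat \<Rightarrow> ('v, 'k::field) mpoly" where
  "esym V d = (\<Sum>F\<in>{F. F \<subseteq> V \<and> card F = d}. sqf_monom F)"

text \<open>The degrees descend: on a simplex with \<open>d\<close> vertices the polynomial of
  degree \<open>d\<close> reduces to a single monomial, and adding it lowers the dimension by one,
  so that degree \<open>d - 1\<close> is next.\<close>

fun esyms :: "'v set \<Rightarrow> nat \<Rightarrow> ('v, 'k::field) mpoly list" where
  "esyms V 0 = []"
| "esyms V (Suc d) = esym V (Suc d) # esyms V d"

lemma length_esyms [simp]: "length (esyms V d) = d"
  by (induction d) auto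

lemma esym_in_sr_ideal:
  assumes "finite V" "d > 0" shows "(esym V d :: ('v, 'k::field) mpoly) \<in> sr_ideal V (Pow {})"
  unfolding esym_def
proof (intro ideal_sum[OF sr_ideal_is_ideal])
  fix F assume F: "F \<in> {F. F \<subseteq> V \<and> card F = d}"
  then have "finite F" "F \<noteq> {}" using assms finite_subset by auto
  then show "(sqf_monom F :: ('v, 'k) mpoly) \<in> sr_ideal V (Pow {})" using F by simp
qed (rule down_closed_Pow)

lemma set_esyms_subset:
  "finite V \<Longrightarrow> set (esyms V d :: ('v, 'k::field) mpoly list) \<subseteq> sr_ideal V (Pow {})"
  by (induction d) (auto simp: esym_in_sr_ideal simp del: Pow_empty)

lemma sr_ideal_subset_polys: "sr_ideal V \<Delta> \<subseteq> polys V"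
  by (auto simp: sr_ideal_def)

text \<open>Any other set of the same size has a vertex outside \<open>F\<close>, so its monomial
  vanishes on the simplex.\<close>

lemma esym_cong_sqf_monom:
  assumes V: "finite V" and F: "F \<subseteq> V"
  shows "(esym V (card F) :: ('v, 'k::field) mpoly) - sqf_monom F \<in> sr_ideal V (Pow F)"
proof -
  let ?S = "{G. G \<subseteq> V \<and> card G = card F}"
  have fin: "finite ?S" using V by simp
  have "(esym V (card F) :: ('v, 'k) mpoly) - sqf_monom F = (\<Sum>G\<in>?S - {F}. sqf_monom G)"
    unfolding esym_def using fin F by (subst sum.remove[of _ F]) auto
  also have "\<dots> \<in> sr_ideal V (Pow F)"
  proof (intro ideal_sum[OF sr_ideal_is_ideal])
    fix G assume G: "G \<in> ?S - {F}"
    then have "finite G" "finite F" using V F finite_subset by auto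
    moreover have "\<not> G \<subseteq> F" using G card_subset_eq[of F G] \<open>finite F\<close> by auto
    ultimately show "(sqf_monom G :: ('v, 'k) mpoly) \<in> sr_ideal V (Pow F)" using G by simp
  qed simp
  finally show ?thesis .
qed

lemma adjoin_esym:
  assumes V: "finite V" and F: "F \<subseteq> V"
  shows "adjoin V (sr_ideal V (Pow F)) (esym V (card F) :: ('v, 'k::field) mpoly) = sr_ideal V {H. H \<subseteq> F \<and> \<not> F \<subseteq> H}"
    (is "adjoin V ?P ?e = sr_ideal V ?D")
proof
  have finF: "finite F" using V F finite_subset by blast
  have D: "down_closed ?D" by (auto simp: down_closed_def)
  have P: "is_ideal V ?P" by (simp add: sr_ideal_is_ideal)
  have ID: "is_ideal V (sr_ideal V ?D :: ('v, 'k) mpoly set)" by (rule sr_ideal_is_ideal[OF D])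
  have PD: "?P \<subseteq> sr_ideal V ?D" by (rule sr_ideal_mono) auto
  have s: "sqf_monom F \<in> (sr_ideal V ?D :: ('v, 'k) mpoly set)" using finF F by simp
  have "?e - sqf_monom F \<in> sr_ideal V ?D" using esym_cong_sqf_monom[OF V F] PD by blast
  then have e: "?e \<in> sr_ideal V ?D" using is_idealD(3)[OF ID _ s] by fastforce
  then have eV: "?e \<in> polys V" using sr_ideal_subset_polys by blast
  show "adjoin V ?P ?e \<subseteq> sr_ideal V ?D"
    unfolding adjoin_def using PD e is_idealD(3,4)[OF ID] by blast
  have A: "is_ideal V (adjoin V ?P ?e)" by (rule adjoin_is_ideal[OF P eV])
  show "sr_ideal V ?D \<subseteq> adjoin V ?P ?e"
  proof (rule sr_ideal_subset_ideal[OF A])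
    fix m :: "'v \<Rightarrow>\<^sub>0 nat" assume m: "supp m \<subseteq> V" "supp m \<notin> ?D"
    show "monom m \<in> adjoin V ?P ?e"
    proof (cases "supp m \<subseteq> F")
      case False
      then have "monom m \<in> ?P" using m by simp
      then show ?thesis using adjoin_superset[OF P] by blast
    next
      case True
      then have "supp m = F" using m by auto
      then have eq: "monom m = monom (m - (\<Sum>v\<in>F. Poly_Mapping.single v 1)) * (sqf_monom F :: ('v, 'k) mpoly)"
        unfolding sqf_monom_def monom_add[symmetric] by (simp add: monomial_split_support)
      have "?e - (?e - sqf_monom F) \<in> adjoin V ?P ?e"
        by (rule ideal_diff[OF A adjoin_member[OF P] subsetD[OF adjoin_superset[OF P] esym_cong_sqf_monom[OF V F]]])
      then have "sqf_monom F \<in> adjoin V ?P ?e" by simp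
      then show ?thesis unfolding eq using m supp_minus_nat[of m "\<Sum>v\<in>F. Poly_Mapping.single v 1"]
        by (intro is_idealD(4)[OF A]) auto
    qed
  qed
qed

text \<open>The simplex ideal is prime, so the first polynomial is regular as soon as it lies
  outside. What remains is the boundary of the simplex, handled by shedding vertices.\<close>

lemma regular_on_esyms_simplex:
  assumes V: "finite V" and F: "F \<subseteq> V"
  shows "regular_on V (sr_ideal V (Pow F) :: ('v::linorder, 'k::field) mpoly set) (esyms V (card F))"
  using F
proof (induction "card F" arbitrary: F)
  case 0
  then have "esyms V (card F) = ([] :: ('v, 'k) mpoly list)" by (metis esyms.simps(1))
  then show ?case by simp
next
  case (Suc d)
  let ?e = "esym V (Suc d) :: ('v, 'k) mpoly"
  let ?P = "sr_ideal V (Pow F) :: ('v, 'k) mpoly set"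
  have finF: "finite F" using V Suc.prems finite_subset by blast
  have prime: "prime_ideal V ?P" by (rule prime_sr_ideal_Pow[OF Suc.prems])
  have P: "is_ideal V ?P" by (rule prime_idealD(1)[OF prime])
  have eV: "?e \<in> polys V" using esym_in_sr_ideal[OF V, of "Suc d"] sr_ideal_subset_polys by blast
  have es: "set (esyms V d :: ('v, 'k) mpoly list) \<subseteq> polys V" for d
    using set_esyms_subset[OF V] sr_ideal_subset_polys by blast
  have "?e \<notin> ?P"
  proof
    assume "?e \<in> ?P"
    moreover have "?e - sqf_monom F \<in> ?P" using esym_cong_sqf_monom[OF V Suc.prems] Suc.hyps(2) by simp
    ultimately have "?e - (?e - sqf_monom F) \<in> ?P" by (rule ideal_diff[OF P])
    then show False using finF by simp
  qed
  then have "colon V ?P ?e \<subseteq> ?P" using prime_idealD(3)[OF prime _ eV] by (auto simp: colon_def)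
  \<comment> \<open>These complexes lead from a simplex with \<open>d\<close> vertices
    (\<open>G\<close> a singleton) to the boundary of the simplex on \<open>F\<close>
    (\<open>G = F\<close>). Shedding a vertex of \<open>G\<close> gives a simplex as deletion and
    the complex of a smaller \<open>G\<close> as star.\<close>
  moreover have "regular_on V (sr_ideal V {H. H \<subseteq> F \<and> \<not> G \<subseteq> H}) (esyms V d :: ('v, 'k) mpoly list)"
    if "finite G" "G \<noteq> {}" "G \<subseteq> F" for G
    using that
  proof (induction G rule: finite_ne_induct)
    case (singleton v)
    have "{H. H \<subseteq> F \<and> \<not> {v} \<subseteq> H} = Pow (F - {v})" by auto
    moreover have "d = card (F - {v})" using Suc.hyps(2) singleton finF by simp
    ultimately show ?case using Suc.hyps(1)[of "F - {v}"] Suc.prems by auto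
  next
    case (insert v G)
    let ?D = "{H. H \<subseteq> F \<and> \<not> insert v G \<subseteq> H}"
    have D: "down_closed ?D" by (auto simp: down_closed_def)
    have vV: "v \<in> V" using insert Suc.prems by auto
    show ?case
    proof (rule regular_on_colon_adjoin[OF sr_ideal_is_ideal[OF D] _ es])
      show "(var v :: ('v, 'k) mpoly) \<in> polys V" using vV by simp
      have "star ?D v = {H. H \<subseteq> F \<and> \<not> G \<subseteq> H}" using insert by (auto simp: star_def)
      then show "regular_on V (colon V (sr_ideal V ?D) (var v)) (esyms V d :: ('v, 'k) mpoly list)"
        using insert by (simp add: colon_sr_ideal_var[OF vV])
      have "deletion ?D v = Pow (F - {v})" by (auto simp: deletion_def)
      moreover have "d = card (F - {v})" using Suc.hyps(2) insert finF by simp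
      ultimately show "regular_on V (adjoin V (sr_ideal V ?D) (var v)) (esyms V d :: ('v, 'k) mpoly list)"
        unfolding adjoin_sr_ideal_var[OF vV D] using Suc.hyps(1)[of "F - {v}"] Suc.prems by auto
    qed
  qed
  from this[OF finF _ subset_refl]
  have "regular_on V (adjoin V ?P ?e) (esyms V d)"
    using adjoin_esym[OF V Suc.prems, where ?'k='k] Suc.hyps(2) by (cases "F = {}") simp_all
  ultimately show ?case by (simp add: Suc.hyps(2)[symmetric])
qed

text \<open>\<open>star_decomposable d \<Delta>\<close> is vertex decomposability of a pure complex with facets of size \<open>d\<close>, with
 the star of the shedding vertex in place of its link, so that all complexes involved have the same
 dimension.\<close>
inductive star_decomposable :: "nat \<Rightarrow> 'v set set \<Rightarrow> bool" where
  simplex: "finite F \<Longrightarrow> star_decomposable (card F) (Pow F)"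
| shed: "down_closed \<Delta> \<Longrightarrow> {x} \<in> \<Delta> \<Longrightarrow> star_decomposable d (deletion \<Delta> x) \<Longrightarrow>
    star_decomposable d (star \<Delta> x) \<Longrightarrow> star_decomposable d \<Delta>"

lemma star_decomposable_down_closed: "star_decomposable d \<Delta> \<Longrightarrow> down_closed \<Delta>"
  by (induction rule: star_decomposable.induct) auto

lemma star_subset: "down_closed \<Delta> \<Longrightarrow> star \<Delta> x \<subseteq> \<Delta>"
  unfolding star_def by (auto intro: down_closedD)

lemma star_decomposable_face:
  "star_decomposable d \<Delta> \<Longrightarrow> (\<exists>F\<in>\<Delta>. card F = d) \<and> (\<forall>G\<in>\<Delta>. card G \<le> d)"
proof (induction rule: star_decomposable.induct)
  case (simplex F)
  then show ?case by (auto intro: card_mono)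
next
  case (shed \<Delta> x d)
  have "card G \<le> d" if "G \<in> \<Delta>" for G
  proof (cases "x \<in> G")
    case True
    then have "G \<in> star \<Delta> x" using that by (simp add: star_def insert_absorb)
    then show ?thesis using shed by blast
  next
    case False
    then have "G \<in> deletion \<Delta> x" using that by (simp add: deletion_def)
    then show ?thesis using shed by blast
  qed
  moreover have "deletion \<Delta> x \<subseteq> \<Delta>" by (auto simp: deletion_def)
  ultimately show ?case using shed by blast
qed

text \<open>The list depends on \<open>V\<close> and \<open>d\<close> only, so star and deletion
  supply the same list and \<open>regular_on_colon_adjoin\<close> combines them.\<close>

lemma star_decomposable_regular_on:
  assumes V: "finite V"
  shows "star_decomposable d \<Delta> \<Longrightarrow> \<Delta> \<subseteq> Pow V \<Longrightarrow>
    regular_on V (sr_ideal V \<Delta> :: ('v::linorder, 'k::field) mpoly set) (esyms V d)"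
proof (induction rule: star_decomposable.induct)
  case (simplex F)
  then show ?case by (intro regular_on_esyms_simplex V) auto
next
  case (shed \<Delta> x d)
  have x: "x \<in> V" using shed by auto
  have es: "set (esyms V d :: ('v, 'k) mpoly list) \<subseteq> polys V"
    using set_esyms_subset[OF V] sr_ideal_subset_polys by blast
  have "star \<Delta> x \<subseteq> Pow V" "deletion \<Delta> x \<subseteq> Pow V"
    using shed.prems star_subset[OF shed.hyps(1)] by (auto simp: deletion_def)
  then show ?case using shed x
    by (intro regular_on_colon_adjoin[OF sr_ideal_is_ideal[OF shed.hyps(1)] _ es, of "var x"])
      (auto simp: colon_sr_ideal_var adjoin_sr_ideal_var)
qed

lemma sr_ideal_Pow_eq_ideal_gen_vars:
  assumes "W \<subseteq> V"
  shows "sr_ideal V (Pow (V - W)) = ideal_gen V (var ` W :: ('v, 'k::field) mpoly set)"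
proof
  have "var ` W \<subseteq> (polys V :: ('v, 'k) mpoly set)" using assms by auto
  then have I: "is_ideal V (ideal_gen V (var ` W :: ('v, 'k) mpoly set))" by (rule ideal_gen_is_ideal)
  show "sr_ideal V (Pow (V - W)) \<subseteq> ideal_gen V (var ` W :: ('v, 'k) mpoly set)"
    by (rule sr_ideal_Pow_subset[OF I]) (auto intro: subsetD[OF ideal_gen_superset])
  show "ideal_gen V (var ` W :: ('v, 'k) mpoly set) \<subseteq> sr_ideal V (Pow (V - W))"
    by (rule ideal_gen_least[OF sr_ideal_is_ideal]) (use assms in auto)
qed

text \<open>The \<open>d\<close> symmetric polynomials bound the depth from below, and the Krull
  dimension, which is also \<open>d\<close>, bounds it from above.\<close>

theorem star_decomposable_cohen_macaulay:
  assumes V: "finite V" and D: "star_decomposable d \<Delta>" "\<Delta> \<subseteq> Pow V"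
  shows "cohen_macaulay V (sr_ideal V \<Delta> :: ('v::linorder, 'k::field) mpoly set)"
    and "height V (sr_ideal V \<Delta> :: ('v, 'k) mpoly set) = enat (card V - d)"
    and "d \<le> card V"
proof -
  let ?I = "sr_ideal V \<Delta> :: ('v, 'k) mpoly set"
  let ?M = "sr_ideal V (Pow {}) :: ('v, 'k) mpoly set"
  let ?fs = "esyms V d :: ('v, 'k) mpoly list"
  have dc: "down_closed \<Delta>" by (rule star_decomposable_down_closed[OF D(1)])
  obtain F where F: "F \<in> \<Delta>" "card F = d" "\<And>G. G \<in> \<Delta> \<Longrightarrow> card G \<le> card F"
    using star_decomposable_face[OF D(1)] by blast
  have FV: "F \<subseteq> V" using F D(2) by blast
  show "height V ?I = enat (card V - d)" using height_sr_ideal[OF V F(1) FV dc F(3)] F(2) by simp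
  show "d \<le> card V" using card_mono[OF V FV] F(2) by simp
  have dim: "krull_dim V ?I = enat d" using krull_dim_sr_ideal[OF V F(1) FV dc F(3)] F(2) by simp
  have I: "is_ideal V ?I" by (rule sr_ideal_is_ideal[OF dc])
  have M: "is_ideal V ?M" by (rule sr_ideal_is_ideal) (rule down_closed_Pow)
  have IM: "?I \<subseteq> ?M" using F(1) dc by (intro sr_ideal_mono) (auto intro: down_closedD)
  have esM: "set ?fs \<subseteq> ?M" by (rule set_esyms_subset[OF V])
  have "ideal_gen V (?I \<union> set ?fs) \<subseteq> ?M" using IM esM by (intro ideal_gen_least[OF M]) blast
  moreover have "1 \<notin> ?M" by (simp add: sr_ideal_def)
  ultimately have "ideal_gen V (?I \<union> set ?fs) \<noteq> polys V" using polys_1 by blast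
  moreover have "?M = ideal_gen V (var ` V)" using sr_ideal_Pow_eq_ideal_gen_vars[of V V] by simp
  moreover have "set ?fs \<subseteq> polys V" using esM sr_ideal_subset_polys by blast
  ultimately have "regular_seq V ?I ?fs"
    unfolding regular_seq_def using regular_on_colon[OF I _ star_decomposable_regular_on[OF V D]] esM by auto
  then have "enat d \<le> depth V ?I"
    unfolding depth_def by (intro SUP_upper2[of ?fs]) auto
  moreover have "depth V ?I \<le> enat d"
    unfolding depth_def dim[symmetric] using regular_seq_length_le_krull_dim[OF I] by (intro SUP_least) auto
  ultimately show "cohen_macaulay V ?I" unfolding cohen_macaulay_def dim by (rule antisym[rotated])
qed

section \<open>Cones and basic double links\<close>

definition cone :: "'v \<Rightarrow> 'v set set \<Rightarrow> 'v set set" where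
  "cone x \<Delta> = {F. F - {x} \<in> \<Delta>}"

lemma star_decomposable_cone:
  "star_decomposable d \<Delta> \<Longrightarrow> {x} \<notin> \<Delta> \<Longrightarrow> star_decomposable (Suc d) (cone x \<Delta>)"
proof (induction rule: star_decomposable.induct)
  case (simplex F)
  then have "cone x (Pow F) = Pow (insert x F)" "x \<notin> F" by (auto simp: cone_def)
  then show ?case using star_decomposable.simplex[of "insert x F"] simplex by simp
next
  case (shed \<Delta> y d)
  have dc: "G - {x} \<in> \<Delta>" if "F - {x} \<in> \<Delta>" "G \<subseteq> F" for F G
    by (rule down_closedD[OF shed.hyps(1) that(1)]) (use that(2) in blast)
  have "y \<noteq> x" using shed by auto
  then have "deletion (cone x \<Delta>) y = cone x (deletion \<Delta> y)" "star (cone x \<Delta>) y = cone x (star \<Delta> y)"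
    by (auto simp: deletion_def star_def cone_def insert_Diff_if)
  moreover have "{x} \<notin> deletion \<Delta> y" "{x} \<notin> star \<Delta> y"
    using shed.prems star_subset[OF shed.hyps(1)] by (auto simp: deletion_def)
  moreover have "{y} \<in> cone x \<Delta>" using shed \<open>y \<noteq> x\<close> by (simp add: cone_def insert_Diff_if)
  moreover have "down_closed (cone x \<Delta>)" unfolding down_closed_def
  proof (intro ballI allI impI)
    fix F G assume "F \<in> cone x \<Delta>" "G \<subseteq> F"
    then show "G \<in> cone x \<Delta>" using dc[of F G] by (simp add: cone_def)
  qed
  ultimately show ?case using shed.IH
    by - (rule star_decomposable.shed[where x = y], simp_all)
qed

text \<open>Monomials of the ideal of \<open>\<Delta>\<close> that involve \<open>x\<close> are
  \<open>x\<close> times monomials of the colon ideal; those that avoid \<open>x\<close> lie in the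
  ideal \<open>J\<close> of the cone over the deletion. The facets of this cone have one more vertex
  than those of the star, hence the heights differ by one.\<close>

lemma basic_double_link_star:
  assumes V: "finite V" and sub: "\<Delta> \<subseteq> Pow V" and dc: "down_closed \<Delta>" and x: "{x} \<in> \<Delta>"
    and del: "star_decomposable d (deletion \<Delta> x)" and st: "star_decomposable d (star \<Delta> x)"
  shows "basic_double_link V (sr_ideal V \<Delta>) (sr_ideal V (star \<Delta> x) :: ('v::linorder, 'k::field) mpoly set)"
proof -
  let ?C = "cone x (deletion \<Delta> x)"
  let ?I = "sr_ideal V (star \<Delta> x) :: ('v, 'k) mpoly set"
  let ?J = "sr_ideal V ?C :: ('v, 'k) mpoly set"
  let ?f = "var x :: ('v, 'k) mpoly"
  have xV: "x \<in> V" using x sub by auto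
  have C: "star_decomposable (Suc d) ?C" by (rule star_decomposable_cone[OF del]) (simp add: deletion_def)
  have dS: "down_closed (star \<Delta> x)" and dC: "down_closed ?C"
    using st C by (auto intro: star_decomposable_down_closed)
  have subS: "star \<Delta> x \<subseteq> Pow V" using star_subset[OF dc] sub by blast
  have subC: "?C \<subseteq> Pow V" using sub xV by (auto simp: cone_def deletion_def)
  have I: "is_ideal V ?I" and J: "is_ideal V ?J" by (rule sr_ideal_is_ideal dS dC)+
  have DC: "\<Delta> \<subseteq> ?C" using dc by (auto simp: cone_def deletion_def intro: down_closedD)
  have JI: "?J \<subseteq> ?I" using DC star_subset[OF dc, of x] by (intro sr_ideal_mono) blast
  have JD: "?J \<subseteq> sr_ideal V \<Delta>" by (rule sr_ideal_mono[OF DC])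
  have ID: "is_ideal V (sr_ideal V \<Delta> :: ('v, 'k) mpoly set)" by (rule sr_ideal_is_ideal[OF dc])
  let ?S = "{?f * a + b | a b. a \<in> ?I \<and> b \<in> ?J}"
  have S: "is_ideal V ?S" unfolding is_ideal_def
  proof (intro conjI ballI)
    show "?S \<subseteq> polys V" using subsetD[OF is_idealD(1)[OF I]] subsetD[OF is_idealD(1)[OF J]] xV by auto
    show "0 \<in> ?S" using is_idealD(2)[OF I] is_idealD(2)[OF J] by (intro CollectI exI[of _ 0]) auto
  next
    fix p q assume "p \<in> ?S" "q \<in> ?S"
    then obtain a b a' b' where *: "p = ?f * a + b" "q = ?f * a' + b'" "a \<in> ?I" "b \<in> ?J" "a' \<in> ?I" "b' \<in> ?J" by blast
    then have "p + q = ?f * (a + a') + (b + b')" by (simp add: algebra_simps)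
    then show "p + q \<in> ?S" using * is_idealD(3)[OF I] is_idealD(3)[OF J] by blast
  next
    fix r p :: "('v, 'k) mpoly" assume r: "r \<in> polys V" "p \<in> ?S"
    then obtain a b where *: "p = ?f * a + b" "a \<in> ?I" "b \<in> ?J" by blast
    then have "r * p = ?f * (r * a) + (r * b)" by (simp add: algebra_simps)
    then show "r * p \<in> ?S" using * r is_idealD(4)[OF I] is_idealD(4)[OF J] by blast
  qed
  have "sr_ideal V \<Delta> \<subseteq> ?S"
  proof (rule sr_ideal_subset_ideal[OF S])
    fix m :: "'v \<Rightarrow>\<^sub>0 nat" assume m: "supp m \<subseteq> V" "supp m \<notin> \<Delta>"
    show "monom m \<in> ?S"
    proof (cases "x \<in> supp m")
      case True
      let ?m = "m - Poly_Mapping.single x 1"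
      have split: "?m + Poly_Mapping.single x 1 = m" using monomial_split_support[of "{x}" m] True by simp
      then have "supp m = insert x (supp ?m)" by (metis (no_types) supp_add_nat keys_single insert_is_Un sup_commute one_neq_zero)
      then have "monom ?m \<in> ?I" using m by (simp add: star_def)
      moreover have "monom m = ?f * monom ?m + 0" using split by (simp add: var_eq_monom monom_add[symmetric] add.commute)
      ultimately show ?thesis using is_idealD(2)[OF J] by blast
    next
      case False
      then have "monom m \<in> ?J" using m by (simp add: cone_def deletion_def)
      moreover have "monom m = ?f * 0 + monom m" by simp
      ultimately show ?thesis using is_idealD(2)[OF I] by blast
    qed
  qed
  moreover have "?S \<subseteq> sr_ideal V \<Delta>"
  proof
    fix p assume "p \<in> ?S"
    then obtain a b where *: "p = ?f * a + b" "a \<in> ?I" "b \<in> ?J" by blast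
    have "a * ?f \<in> sr_ideal V \<Delta>" using *(2) colon_sr_ideal_var[OF xV, of \<Delta>] by (auto simp: colon_def)
    then show "p \<in> sr_ideal V \<Delta>" using * JD is_idealD(3)[OF ID] by (simp add: mult.commute subset_iff)
  qed
  ultimately have eq: "sr_ideal V \<Delta> = ?S" by blast
  \<comment> \<open>A cone is its own star at the apex, so \<open>x\<close> is regular modulo
    \<open>J\<close>.\<close>
  have "star ?C x = ?C" by (auto simp: star_def cone_def)
  then have colon: "colon V ?J ?f = ?J" using colon_sr_ideal_var[OF xV, of ?C] by simp
  have "height V ?J + 1 = height V ?I"
    using star_decomposable_cohen_macaulay(2)[OF V st subS, where ?'k='k]
      star_decomposable_cohen_macaulay(2)[OF V C subC, where ?'k='k] star_decomposable_cohen_macaulay(3)[OF V C subC]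
    by (simp add: one_enat_def)
  then show ?thesis unfolding basic_double_link_def
    using homogeneous_sr_ideal[OF dS, of V, where ?'k='k] homogeneous_sr_ideal[OF dC, of V, where ?'k='k] JI eq colon xV
      star_decomposable_cohen_macaulay(1)[OF V st subS, where ?'k='k] star_decomposable_cohen_macaulay(1)[OF V C subC, where ?'k='k]
      homogeneous_monom[of "Poly_Mapping.single x 1"]
    by (intro exI[of _ ?J] exI[of _ ?f] conjI) (simp_all add: var_eq_monom)
qed

text \<open>The sequence of links runs through stars only, from a simplex up to
  \<open>\<Delta>\<close>. Deletions enter through the auxiliary ideals \<open>J\<close>, which must
  be Cohen-Macaulay.\<close>

theorem star_decomposable_obtained_by_bdl:
  assumes V: "finite V"
  shows "star_decomposable d \<Delta> \<Longrightarrow> \<Delta> \<subseteq> Pow V \<Longrightarrow>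
    obtained_by_bdl_from_variables V (sr_ideal V \<Delta> :: ('v::linorder, 'k::field) mpoly set)"
proof (induction rule: star_decomposable.induct)
  case (simplex F)
  then have "V - (V - F) = F" by auto
  then have "sr_ideal V (Pow F) = ideal_gen V (var ` (V - F) :: ('v, 'k) mpoly set)"
    using sr_ideal_Pow_eq_ideal_gen_vars[of "V - F" V] by simp
  then show ?case unfolding obtained_by_bdl_from_variables_def
    by (intro exI[of _ 0] exI[of _ "\<lambda>_. sr_ideal V (Pow F)"] exI[of _ "V - F"]) auto
next
  case (shed \<Delta> x d)
  have "star \<Delta> x \<subseteq> Pow V" using shed star_subset[OF shed.hyps(1)] by blast
  then obtain k L W where L: "W \<subseteq> V" "L 0 = ideal_gen V (var ` W)"
    "L k = (sr_ideal V (star \<Delta> x) :: ('v, 'k) mpoly set)"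
    "\<forall>i<k. basic_double_link V (L (Suc i)) (L i)"
    using shed.IH(2) unfolding obtained_by_bdl_from_variables_def by blast
  have "basic_double_link V (sr_ideal V \<Delta>) (L k)"
    unfolding L(3) using shed by (intro basic_double_link_star[OF V]) auto
  then show ?case unfolding obtained_by_bdl_from_variables_def
    using L by (intro exI[of _ "Suc k"] exI[of _ "L(Suc k := sr_ideal V \<Delta>)"] exI[of _ W])
      (auto simp: less_Suc_eq)
qed

section \<open>Vertex decomposable independence complexes\<close>

text \<open>The index is the common size of the facets. Recording it makes the purity and dimension
  conditions of \<open>vd_step\<close> consequences, and it determines the height.\<close>

inductive pure_decomposable :: "nat \<Rightarrow> 'v set set \<Rightarrow> bool" where
  simplex: "finite F \<Longrightarrow> pure_decomposable (card F) (Pow F)"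
| shed: "down_closed \<Delta> \<Longrightarrow> {x} \<in> \<Delta> \<Longrightarrow> pure_decomposable (Suc d) (deletion \<Delta> x) \<Longrightarrow>
    pure_decomposable d (link \<Delta> x) \<Longrightarrow> pure_decomposable (Suc d) \<Delta>"

lemma star_eq_cone_link: "down_closed \<Delta> \<Longrightarrow> star \<Delta> x = cone x (link \<Delta> x)"
  unfolding star_def cone_def link_def by (auto intro: down_closedD)

lemma pure_decomposable_imp_star_decomposable: "pure_decomposable d \<Delta> \<Longrightarrow> star_decomposable d \<Delta>"
proof (induction rule: pure_decomposable.induct)
  case (simplex F)
  then show ?case by (rule star_decomposable.simplex)
next
  case (shed \<Delta> x d)
  have "{x} \<notin> link \<Delta> x" by (simp add: link_def)
  then have "star_decomposable (Suc d) (star \<Delta> x)"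
    unfolding star_eq_cone_link[OF shed.hyps(1)] by (rule star_decomposable_cone[OF shed.IH(2)])
  then show ?case using shed by (intro star_decomposable.shed[of \<Delta> x "Suc d"])
qed

text \<open>A facet through \<open>x\<close> gives a facet of the link, one smaller; any other facet
  is a facet of the deletion.\<close>

lemma pure_decomposable_facets:
  "pure_decomposable d \<Delta> \<Longrightarrow> (\<forall>F\<in>\<Delta>. finite F) \<and> (\<forall>F\<in>facets \<Delta>. card F = d)"
proof (induction rule: pure_decomposable.induct)
  case (simplex F)
  then show ?case by (auto simp: facets_def intro: finite_subset)
next
  case (shed \<Delta> x d)
  have in_link: "F - {x} \<in> link \<Delta> x" if "F \<in> \<Delta>" "x \<in> F" for F
    using that down_closedD[OF shed.hyps(1), of F "F - {x}"] by (auto simp: link_def insert_absorb)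
  have in_del: "F \<in> deletion \<Delta> x" if "F \<in> \<Delta>" "x \<notin> F" for F using that by (simp add: deletion_def)
  have fin: "finite F" if "F \<in> \<Delta>" for F
    using in_link[OF that] in_del[OF that] shed.IH by (cases "x \<in> F") auto
  moreover have "card F = Suc d" if F: "F \<in> facets \<Delta>" for F
  proof -
    have F': "F \<in> \<Delta>" and max: "\<And>G. G \<in> \<Delta> \<Longrightarrow> F \<subseteq> G \<Longrightarrow> G = F" using F by (auto simp: facets_def)
    show ?thesis
    proof (cases "x \<in> F")
      case True
      have "F - {x} \<in> facets (link \<Delta> x)" unfolding facets_def
      proof (intro CollectI conjI ballI impI)
        show "F - {x} \<in> link \<Delta> x" by (rule in_link[OF F' True])
        fix G assume G: "G \<in> link \<Delta> x" "F - {x} \<subseteq> G"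
        then have "insert x G = F" using max[of "insert x G"] by (auto simp: link_def)
        then show "G = F - {x}" using G by (auto simp: link_def)
      qed
      then have "card (F - {x}) = d" using shed.IH by blast
      then show ?thesis using fin[OF F'] True by (metis card_Suc_Diff1)
    next
      case False
      have "F \<in> facets (deletion \<Delta> x)" unfolding facets_def
        using in_del[OF F' False] max by (auto simp: deletion_def)
      then show ?thesis using shed.IH by blast
    qed
  qed
  ultimately show ?case by blast
qed

lemma cdim_pure_decomposable:
  assumes "pure_decomposable d \<Delta>" shows "cdim \<Delta> = int d - 1"
proof -
  obtain F where F: "F \<in> \<Delta>" "card F = d" and max: "\<And>G. G \<in> \<Delta> \<Longrightarrow> card G \<le> d"
    using star_decomposable_face[OF pure_decomposable_imp_star_decomposable[OF assms]] by blast
  have "finite (card ` \<Delta>)" by (rule finite_subset[of _ "{..d}"]) (use max in auto)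
  then have "Max (card ` \<Delta>) = d" using F max by (intro Max_eqI) auto
  then show ?thesis using F(1) by (auto simp: cdim_def)
qed

lemma pure_decomposable_vertex_decomposable: "pure_decomposable d \<Delta> \<Longrightarrow> vertex_decomposable \<Delta>"
proof (induction rule: pure_decomposable.induct)
  case (simplex F)
  then show ?case by (rule vd_simplex)
next
  case (shed \<Delta> x d)
  have "pure (link \<Delta> x)" "pure (deletion \<Delta> x)"
    using pure_decomposable_facets[OF shed.hyps(3)] pure_decomposable_facets[OF shed.hyps(4)] by (auto simp: pure_def)
  moreover have "cdim \<Delta> = int (Suc d) - 1"
    by (rule cdim_pure_decomposable[OF pure_decomposable.shed[OF shed.hyps]])
  ultimately show ?case
    using shed cdim_pure_decomposable[OF shed.hyps(3)] cdim_pure_decomposable[OF shed.hyps(4)]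
    by - (rule vd_step[of x], simp_all)
qed

lemma pure_decomposable_cone:
  "pure_decomposable d \<Delta> \<Longrightarrow> {x} \<notin> \<Delta> \<Longrightarrow> pure_decomposable (Suc d) (cone x \<Delta>)"
proof (induction rule: pure_decomposable.induct)
  case (simplex F)
  then have "cone x (Pow F) = Pow (insert x F)" "x \<notin> F" by (auto simp: cone_def)
  then show ?case using pure_decomposable.simplex[of "insert x F"] simplex by simp
next
  case (shed \<Delta> y d)
  have dc: "G - {x} \<in> \<Delta>" if "F - {x} \<in> \<Delta>" "G \<subseteq> F" for F G
    by (rule down_closedD[OF shed.hyps(1) that(1)]) (use that(2) in blast)
  have "y \<noteq> x" using shed by auto
  then have "deletion (cone x \<Delta>) y = cone x (deletion \<Delta> y)" "link (cone x \<Delta>) y = cone x (link \<Delta> y)"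
    by (auto simp: deletion_def link_def cone_def insert_Diff_if)
  moreover have "{x} \<notin> deletion \<Delta> y" "{x} \<notin> link \<Delta> y"
    using shed.prems by (auto simp: deletion_def link_def)
  moreover have "{y} \<in> cone x \<Delta>" using shed \<open>y \<noteq> x\<close> by (simp add: cone_def insert_Diff_if)
  moreover have "down_closed (cone x \<Delta>)" unfolding down_closed_def
  proof (intro ballI allI impI)
    fix F G assume "F \<in> cone x \<Delta>" "G \<subseteq> F"
    then show "G \<in> cone x \<Delta>" using dc[of F G] by (simp add: cone_def)
  qed
  ultimately show ?case using shed.IH
    by - (rule pure_decomposable.shed[where x = y], simp_all)
qed

section \<open>Independence complexes of graphs\<close>

definition indep :: "('v \<Rightarrow> 'v \<Rightarrow> bool) \<Rightarrow> 'v set \<Rightarrow> 'v set set" where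
  "indep E V = {F. F \<subseteq> V \<and> (\<forall>a\<in>F. \<forall>b\<in>F. \<not> E a b)}"

lemma down_closed_indep: "down_closed (indep E V)"
  by (auto simp: down_closed_def indep_def)

lemma indep_no_edges: "(\<And>a b. a \<in> V \<Longrightarrow> b \<in> V \<Longrightarrow> \<not> E a b) \<Longrightarrow> indep E V = Pow V"
  by (auto simp: indep_def)

lemma pure_decomposable_indep_shed:
  assumes "x \<in> V" "\<not> E x x" "pure_decomposable (Suc d) (indep E (V - {x}))"
    "pure_decomposable d (indep E {y \<in> V - {x}. \<not> E x y \<and> \<not> E y x})"
  shows "pure_decomposable (Suc d) (indep E V)"
proof (rule pure_decomposable.shed[OF down_closed_indep])
  show "{x} \<in> indep E V" using assms by (simp add: indep_def)
  have "deletion (indep E V) x = indep E (V - {x})" by (auto simp: deletion_def indep_def)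
  then show "pure_decomposable (Suc d) (deletion (indep E V) x)" using assms by simp
  have "link (indep E V) x = indep E {y \<in> V - {x}. \<not> E x y \<and> \<not> E y x}"
    using assms(1,2) unfolding link_def indep_def by auto
  then show "pure_decomposable d (link (indep E V) x)" using assms by simp
qed

text \<open>Isolated vertices are cone points, so each raises the facet size by one.\<close>

lemma pure_decomposable_indep_isolated:
  assumes "finite U" "U \<inter> V = {}" "pure_decomposable d (indep E V)"
    "\<And>u v. u \<in> U \<Longrightarrow> v \<in> U \<union> V \<Longrightarrow> \<not> E u v \<and> \<not> E v u"
  shows "pure_decomposable (d + card U) (indep E (V \<union> U))"
  using assms
proof (induction U rule: finite_induct)
  case (insert u U)
  have "cone u (indep E (V \<union> U)) = indep E (V \<union> insert u U)"
  proof (intro set_eqI iffI)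
    fix F assume F: "F \<in> cone u (indep E (V \<union> U))"
    then have sub: "F \<subseteq> V \<union> insert u U" by (auto simp: cone_def indep_def)
    have "\<not> E a b" if "a \<in> F" "b \<in> F" for a b
    proof (cases "a = u \<or> b = u")
      case True
      then show ?thesis using insert.prems(3)[of u a] insert.prems(3)[of u b] sub that by auto
    next
      case False
      then show ?thesis using F that by (auto simp: cone_def indep_def)
    qed
    then show "F \<in> indep E (V \<union> insert u U)" using sub by (simp add: indep_def)
  qed (auto simp: cone_def indep_def)
  moreover have "{u} \<notin> indep E (V \<union> U)" using insert by (auto simp: indep_def)
  moreover have "pure_decomposable (d + card U) (indep E (V \<union> U))" using insert by auto
  ultimately show ?case using pure_decomposable_cone[of "d + card U" "indep E (V \<union> U)" u] insert by simp
qed simp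

section \<open>Shedding orders for tableaux\<close>

definition rows :: "nat \<Rightarrow> (nat \<Rightarrow> nat set) \<Rightarrow> (nat \<times> nat) set" where
  "rows n A = {(i, j). 1 \<le> i \<and> i \<le> n \<and> j \<in> A i}"

text \<open>Induction on the number of rows and, inside, on the length of the last row, whose last
  entry is shed. The link loses whole columns, which is why the rows are arbitrary nested sets. For
  a rectangle the facet size is the number of positions on a lattice path between opposite
  corners.\<close>

lemma pure_decomposable_nested_rows:
  fixes A :: "nat \<Rightarrow> nat set"
  assumes "n \<ge> 1" "\<And>i j. 1 \<le> i \<Longrightarrow> i \<le> j \<Longrightarrow> j \<le> n \<Longrightarrow> A j \<subseteq> A i" "finite (A 1)" "A n \<noteq> {}"
    "\<And>i j k l. (i, j) \<in> rows n A \<Longrightarrow> (k, l) \<in> rows n A \<Longrightarrow>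
      E (i, j) (k, l) \<longleftrightarrow> i < k \<and> j < l \<and> j \<in> A k"
  shows "pure_decomposable (card (A 1) + n - 1) (indep E (rows n A))"
  using assms
proof (induction n arbitrary: A rule: dec_induct)
  case base
  have r: "rows 1 A = {1} \<times> A 1" by (auto simp: rows_def)
  have "indep E (rows 1 A) = Pow (rows 1 A)"
    using base(4) by (intro indep_no_edges) (auto simp: r)
  then show ?case using pure_decomposable.simplex[of "rows 1 A"] base(2)
    by (simp add: r card_cartesian_product)
next
  case (step n)
  note IH = step.IH
  show ?case using step.prems
  proof (induction "card (A (Suc n))" arbitrary: A rule: less_induct)
    case less
    note nested = less.prems(1) and fin1 = less.prems(2) and ne = less.prems(3) and E = less.prems(4)
    have sub1: "A i \<subseteq> A 1" if "1 \<le> i" "i \<le> Suc n" for i using nested[of 1 i] that by auto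
    have finN: "finite (A (Suc n))" using sub1[of "Suc n"] fin1 finite_subset by auto
    define M where "M = Max (A (Suc n))"
    have M: "M \<in> A (Suc n)" "\<And>j. j \<in> A (Suc n) \<Longrightarrow> j \<le> M" using finN ne by (auto simp: M_def)
    \<comment> \<open>\<open>M\<close> is the column of the shedding vertex and \<open>D\<close> the
      rest of its row. Higher positions in a column of \<open>D\<close> are adjacent to the shedding
      vertex; hence the link keeps only columns outside \<open>D\<close> above, and there the
      entries of \<open>D\<close> in the last row become isolated.\<close>
    define D where "D = A (Suc n) - {M}"
    have finD: "finite D" using finN by (simp add: D_def)
    define B where "B i = A i - D" for i
    define U where "U = {Suc n} \<times> D"
    have cardU: "card U = card D" by (simp add: U_def card_cartesian_product)
    have U_iso: "\<not> E u v \<and> \<not> E v u" if uU: "u \<in> U" and vUB: "v \<in> U \<union> rows n B" for u v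
    proof -
      obtain l where u: "u = (Suc n, l)" "l \<in> D" using uU by (auto simp: U_def)
      obtain i j where v: "v = (i, j)" by (cases v)
      have uV: "u \<in> rows (Suc n) A" using u by (auto simp: rows_def D_def)
      have vV: "v \<in> rows (Suc n) A" using vUB by (auto simp: rows_def B_def U_def D_def)
      have "i \<le> Suc n" using vV v by (auto simp: rows_def)
      then have "\<not> E u v" using E uV vV u v by auto
      moreover have "\<not> E v u"
      proof
        assume "E v u"
        then have "i < Suc n" "j < l" "j \<in> A (Suc n)" using E uV vV u v by auto
        then have "j \<noteq> M" using M(2)[of l] u(2) by (auto simp: D_def)
        then have "j \<in> D" using \<open>j \<in> A (Suc n)\<close> by (simp add: D_def)
        then show False using vUB v \<open>i < Suc n\<close> by (auto simp: U_def rows_def B_def)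
      qed
      ultimately show ?thesis by blast
    qed
    have cardB: "card (B 1) + card D = card (A 1)"
    proof -
      have "D \<subseteq> A 1" using sub1[of "Suc n"] by (auto simp: D_def)
      then show ?thesis unfolding B_def using fin1 finD
        by (simp add: card_Diff_subset card_mono)
    qed
    have "pure_decomposable (card (B 1) + n - 1) (indep E (rows n B))"
    proof (rule IH)
      show "B j \<subseteq> B i" if "1 \<le> i" "i \<le> j" "j \<le> n" for i j using nested[of i j] that by (auto simp: B_def)
      show "finite (B 1)" using fin1 by (simp add: B_def)
      show "B n \<noteq> {}" using nested[of n "Suc n"] step.hyps(1) M(1) by (auto simp: B_def D_def)
      show "E (i, j) (k, l) \<longleftrightarrow> i < k \<and> j < l \<and> j \<in> B k" if "(i, j) \<in> rows n B" "(k, l) \<in> rows n B" for i j k l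
        using E[of i j k l] that by (auto simp: rows_def B_def)
    qed
    then have "pure_decomposable (card (B 1) + n - 1 + card U) (indep E (rows n B \<union> U))"
      using finD U_iso by (intro pure_decomposable_indep_isolated) (auto simp: U_def rows_def)
    moreover have "card (B 1) + n - 1 + card U = card (A 1) + n - 1"
      using cardB cardU step.hyps(1) by simp
    ultimately have link: "pure_decomposable (card (A 1) + n - 1) (indep E (rows n B \<union> U))" by simp
    let ?x = "(Suc n, M)"
    show ?case
    proof (cases "D = {}")
      \<comment> \<open>An edge to the only entry of the last row would need another column of that
        row to the left of \<open>M\<close>. The entry is therefore a cone point and not
        shed.\<close>
      case True
      then have AN: "A (Suc n) = {M}" using M(1) by (auto simp: D_def)
      have "rows n B = rows n A" using True by (simp add: B_def rows_def)
      moreover have "rows (Suc n) A = rows n A \<union> {?x}" using AN by (auto simp: rows_def le_Suc_eq)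
      moreover have "U = {}" using True by (simp add: U_def)
      moreover have "\<not> E u v \<and> \<not> E v u" if "u = ?x" "v \<in> {?x} \<union> rows n A" for u v
      proof -
        obtain i j where v: "v = (i, j)" by (cases v)
        have "v \<in> rows (Suc n) A" "?x \<in> rows (Suc n) A" using that(2) AN by (auto simp: rows_def)
        then show ?thesis using E[of i j "Suc n" M] E[of "Suc n" M i j] that(1) v AN by (auto simp: rows_def)
      qed
      ultimately have "pure_decomposable (card (A 1) + n - 1 + card {?x}) (indep E (rows (Suc n) A))"
        using link pure_decomposable_indep_isolated[of "{?x}" "rows n A" "card (A 1) + n - 1" E]
        by (auto simp: rows_def)
      then show ?thesis using step.hyps(1) by simp
    next
      case False
      define A' where "A' = A(Suc n := D)"
      have A'1: "A' 1 = A 1" using step.hyps(1) by (simp add: A'_def)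
      have del: "rows (Suc n) A - {?x} = rows (Suc n) A'" by (auto simp: rows_def A'_def D_def split: if_splits)
      have "card (A' (Suc n)) < card (A (Suc n))"
        using finN M(1) by (simp add: A'_def D_def card_Diff1_less del: card_Diff_insert)
      then have "pure_decomposable (card (A' 1) + Suc n - 1) (indep E (rows (Suc n) A'))"
      proof (rule less.hyps)
        show "A' j \<subseteq> A' i" if "1 \<le> i" "i \<le> j" "j \<le> Suc n" for i j
          using nested[of i j] that by (auto simp: A'_def D_def)
        show "finite (A' 1)" using A'1 fin1 by simp
        show "A' (Suc n) \<noteq> {}" using False by (simp add: A'_def)
        \<comment> \<open>Removing \<open>M\<close> from the last row keeps the relation in the
          required form: an edge into that row has \<open>j < l\<close> and
          \<open>l \<le> M\<close>, so \<open>j\<close> is never \<open>M\<close>.\<close>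
        show "E (i, j) (k, l) \<longleftrightarrow> i < k \<and> j < l \<and> j \<in> A' k"
          if "(i, j) \<in> rows (Suc n) A'" "(k, l) \<in> rows (Suc n) A'" for i j k l
        proof -
          have "(i, j) \<in> rows (Suc n) A" "(k, l) \<in> rows (Suc n) A" using that del by blast+
          then show ?thesis using E[of i j k l] that M(2)[of l] by (auto simp: A'_def D_def rows_def)
        qed
      qed
      then have 1: "pure_decomposable (Suc (card (A 1) + n - 1)) (indep E (rows (Suc n) A - {?x}))"
        using A'1 del step.hyps(1) by simp
      have xV: "?x \<in> rows (Suc n) A" using M(1) by (simp add: rows_def)
      have "{y \<in> rows (Suc n) A - {?x}. \<not> E ?x y \<and> \<not> E y ?x} = rows n B \<union> U"
      proof (intro set_eqI iffI)
        fix y assume y: "y \<in> {y \<in> rows (Suc n) A - {?x}. \<not> E ?x y \<and> \<not> E y ?x}"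
        obtain i j where ij: "y = (i, j)" by (cases y)
        then show "y \<in> rows n B \<union> U" using y E[of i j "Suc n" M] xV M(2)[of j]
          by (auto simp: rows_def B_def U_def D_def le_Suc_eq)
      next
        fix y assume y: "y \<in> rows n B \<union> U"
        obtain i j where ij: "y = (i, j)" by (cases y)
        have yV: "y \<in> rows (Suc n) A" using y by (auto simp: rows_def B_def U_def D_def)
        then show "y \<in> {y \<in> rows (Suc n) A - {?x}. \<not> E ?x y \<and> \<not> E y ?x}"
          using y ij E[of i j "Suc n" M] E[of "Suc n" M i j] xV M(2)[of j]
          by (auto simp: rows_def B_def U_def D_def)
      qed
      then have 2: "pure_decomposable (card (A 1) + n - 1) (indep E {y \<in> rows (Suc n) A - {?x}. \<not> E ?x y \<and> \<not> E y ?x})"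
        using link by simp
      have "\<not> E ?x ?x" using E xV by auto
      from pure_decomposable_indep_shed[OF xV this 1 2]
      show ?thesis using step.hyps(1) by simp
    qed
  qed
qed

lemma tab_T_eq_rows: "tab_T n lam mu = rows n (\<lambda>i. {mu i<..lam i})"
  by (auto simp: tab_T_def rows_def)

text \<open>\<open>E\<close> does not depend on \<open>lam\<close>, so it survives the shortening of
  the last row. The facet size is that of the ordinary tableau minus the truncated difference
  \<open>n - 1 - mu 1\<close>.\<close>

lemma pure_decomposable_symmetric_tableau:
  fixes lam mu :: "nat \<Rightarrow> nat"
  assumes E: "\<And>i j k l. E (i, j) (k, l) \<longleftrightarrow> i < k \<and> j < l \<and> (mu k < j \<or> j < k)"
    and "n \<ge> 1"
    "\<And>i j. 1 \<le> i \<Longrightarrow> i \<le> j \<Longrightarrow> j \<le> n \<Longrightarrow> lam j \<le> lam i"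
    "\<And>i j. 1 \<le> i \<Longrightarrow> i \<le> j \<Longrightarrow> j \<le> n \<Longrightarrow> mu i \<le> mu j"
    "mu n < lam n" "\<And>i. 1 \<le> i \<Longrightarrow> i \<le> n \<Longrightarrow> i - 1 \<le> mu i"
  shows "pure_decomposable (lam 1 + n - 1 - max (mu 1) (n - 1)) (indep E (tab_T n lam mu))"
  using assms(2-)
proof (induction n arbitrary: lam rule: dec_induct)
  case base
  have r: "tab_T 1 lam mu = {1} \<times> {mu 1<..lam 1}" by (auto simp: tab_T_def)
  have "indep E (tab_T 1 lam mu) = Pow (tab_T 1 lam mu)"
    by (intro indep_no_edges) (auto simp: r E)
  then show ?case using pure_decomposable.simplex[of "tab_T 1 lam mu"]
    by (simp add: r card_cartesian_product)
next
  case (step n)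
  note IH = step.IH and n1 = step.hyps(1)
  show ?case using step.prems
  proof (induction "lam (Suc n)" arbitrary: lam rule: less_induct)
    case less
    note lam_mono = less.prems(1) and mu_mono = less.prems(2) and lt = less.prems(3) and mu_ge = less.prems(4)
    define N where "N = Suc n"
    let ?V = "tab_T N lam mu" and ?x = "(N, lam N)"
    \<comment> \<open>The part of the link above row \<open>N\<close>: edges with
      \<open>j < k\<close> remove the columns up to \<open>n\<close>, edges with
      \<open>mu k < j\<close> those strictly between \<open>mu N\<close> and \<open>lam N\<close>.
      All remaining columns exceed \<open>n\<close>, so \<open>j < k\<close> never holds among these
      rows and \<open>pure_decomposable_nested_rows\<close> applies.\<close>
    define A where "A i = {j. n < j \<and> mu i < j \<and> j \<le> lam i \<and> \<not> (mu N < j \<and> j < lam N)}" for i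
    define U where "U = {N} \<times> {mu N<..<lam N}"
    define d where "d = lam 1 + n - 1 - max (mu 1) n"
    have muN: "mu i \<le> mu N" if "1 \<le> i" "i \<le> N" for i using mu_mono that by (simp add: N_def)
    have lamN: "lam N \<le> lam i" if "1 \<le> i" "i \<le> N" for i using lam_mono that by (simp add: N_def)
    have muN_lt: "mu N < lam N" using lt by (simp add: N_def)
    have n_le: "n \<le> mu N" using mu_ge[of N] by (simp add: N_def)
    have lam1: "max (mu 1) n < lam 1" using muN[of 1] lamN[of 1] muN_lt n_le by (auto simp: N_def)
    have cardA: "card (A 1) + card U = lam 1 - max (mu 1) n"
    proof -
      have "A 1 = {max (mu 1) n<..lam 1} - {mu N<..<lam N}" by (auto simp: A_def)
      moreover have "{mu N<..<lam N} \<subseteq> {max (mu 1) n<..lam 1}"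
        using muN[of 1] lamN[of 1] n_le by (auto simp: N_def)
      ultimately have "card (A 1) = card {max (mu 1) n<..lam 1} - card {mu N<..<lam N}"
        "card {mu N<..<lam N} \<le> card {max (mu 1) n<..lam 1}"
        by (simp_all add: card_Diff_subset card_mono del: card_greaterThanAtMost card_greaterThanLessThan)
      moreover have "card U = card {mu N<..<lam N}" by (simp add: U_def card_cartesian_product)
      moreover have "card {max (mu 1) n<..lam 1} = lam 1 - max (mu 1) n" by simp
      ultimately show ?thesis by linarith
    qed
    have "pure_decomposable (card (A 1) + n - 1) (indep E (rows n A))"
    proof (rule pure_decomposable_nested_rows[OF n1])
      show "A j \<subseteq> A i" if "1 \<le> i" "i \<le> j" "j \<le> n" for i j
        using lam_mono[of i j] mu_mono[of i j] that by (auto simp: A_def)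
      show "finite (A 1)" by (rule finite_subset[of _ "{..lam 1}"]) (auto simp: A_def)
      have "lam N \<in> A n" using muN[of n] lamN[of n] muN_lt n_le n1 by (auto simp: A_def N_def)
      then show "A n \<noteq> {}" by blast
      show "E (i, j) (k, l) \<longleftrightarrow> i < k \<and> j < l \<and> j \<in> A k" if "(i, j) \<in> rows n A" "(k, l) \<in> rows n A" for i j k l
        using that by (auto simp: E rows_def A_def)
    qed
    then have "pure_decomposable (card (A 1) + n - 1 + card U) (indep E (rows n A \<union> U))"
      by (rule pure_decomposable_indep_isolated[rotated 2])
        (auto simp: U_def rows_def E A_def N_def)
    moreover have "card (A 1) + n - 1 + card U = d" unfolding d_def using cardA lam1 n1 by linarith
    moreover have "{y \<in> ?V - {?x}. \<not> E ?x y \<and> \<not> E y ?x} = rows n A \<union> U"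
    proof (intro set_eqI iffI)
      fix y assume y: "y \<in> {y \<in> ?V - {?x}. \<not> E ?x y \<and> \<not> E y ?x}"
      obtain i j where ij: "y = (i, j)" by (cases y)
      show "y \<in> rows n A \<union> U"
      proof (cases "i = N")
        case True then show ?thesis using y ij by (auto simp: U_def tab_T_def)
      next
        case False
        then have "1 \<le> i" "i \<le> n" "mu i < j" "j \<le> lam i" "\<not> (j < lam N \<and> (mu N < j \<or> j < N))"
          using y ij by (auto simp: tab_T_def N_def E)
        moreover from this have "n < j" using muN_lt n_le by (auto simp: N_def)
        ultimately show ?thesis by (auto simp: rows_def A_def ij)
      qed
    next
      fix y assume y: "y \<in> rows n A \<union> U"
      then show "y \<in> {y \<in> ?V - {?x}. \<not> E ?x y \<and> \<not> E y ?x}"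
        by (auto simp: rows_def A_def U_def tab_T_def N_def E)
    qed
    ultimately have link: "pure_decomposable d (indep E {y \<in> ?V - {?x}. \<not> E ?x y \<and> \<not> E y ?x})" by simp
    have xV: "?x \<in> ?V" using muN_lt by (simp add: tab_T_def N_def)
    have xx: "\<not> E ?x ?x" by (simp add: E)
    have dim: "Suc d = lam 1 + Suc n - 1 - max (mu 1) (Suc n - 1)" using lam1 n1 by (auto simp: d_def)
    show ?case
    proof (cases "mu N + 1 < lam N")
      case True
      define lam' where "lam' = lam(N := lam N - 1)"
      have lam'1: "lam' 1 = lam 1" using n1 by (simp add: lam'_def N_def)
      have "lam' (Suc n) < lam (Suc n)" using muN_lt by (simp add: lam'_def N_def)
      then have "pure_decomposable (lam' 1 + Suc n - 1 - max (mu 1) (Suc n - 1)) (indep E (tab_T (Suc n) lam' mu))"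
      proof (rule less.hyps)
        show "lam' j \<le> lam' i" if "1 \<le> i" "i \<le> j" "j \<le> Suc n" for i j
          using lam_mono[of i j] that by (auto simp: lam'_def N_def)
        show "mu (Suc n) < lam' (Suc n)" using True by (simp add: lam'_def N_def)
      qed (use mu_mono mu_ge in auto)
      moreover have "tab_T (Suc n) lam' mu = ?V - {?x}"
        using True by (auto simp: tab_T_def lam'_def N_def split: if_splits)
      ultimately have "pure_decomposable (Suc d) (indep E (?V - {?x}))" using lam'1 dim by simp
      from pure_decomposable_indep_shed[OF xV xx this link] show ?thesis using dim by (simp add: N_def)
    next
      case False
      then have V: "?V = tab_T n lam mu \<union> {?x}" "?V - {?x} = tab_T n lam mu"
        using muN_lt by (auto simp: tab_T_def N_def le_Suc_eq)
      have "mu n < lam n" using muN[of n] lamN[of n] muN_lt n1 by (simp add: N_def)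
      then have IHn: "pure_decomposable (lam 1 + n - 1 - max (mu 1) (n - 1)) (indep E (tab_T n lam mu))"
        using lam_mono mu_mono mu_ge by (intro IH) auto
      show ?thesis
      \<comment> \<open>The last row has a single entry. If all columns exceed \<open>n\<close>,
        this entry is isolated and raises the facet size by one. Otherwise the facet size is
        \<open>lam 1\<close> both with and without it, as required of a shedding vertex.\<close>
      proof (cases "n \<le> mu 1")
        case True
        have "\<not> E u v \<and> \<not> E v u" if "u \<in> {?x}" "v \<in> {?x} \<union> tab_T n lam mu" for u v
        proof -
          obtain i j where v: "v = (i, j)" by (cases v)
          show ?thesis
          proof (cases "v = ?x")
            case True then show ?thesis using that xx by simp
          next
            case False
            then have "1 \<le> i" "i \<le> n" "mu i < j" using that v by (auto simp: tab_T_def)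
            moreover from this have "mu 1 \<le> mu i" using mu_mono[of 1 i] by simp
            ultimately show ?thesis using that v \<open>n \<le> mu 1\<close> \<open>\<not> mu N + 1 < lam N\<close> by (auto simp: E N_def)
          qed
        qed
        then have "pure_decomposable (lam 1 + n - 1 - max (mu 1) (n - 1) + card {?x}) (indep E (tab_T n lam mu \<union> {?x}))"
          using IHn by (intro pure_decomposable_indep_isolated) (auto simp: tab_T_def N_def)
        moreover have "lam 1 + n - 1 - max (mu 1) (n - 1) + card {?x} = Suc d"
          using True lam1 n1 by (auto simp: d_def)
        ultimately have "pure_decomposable (Suc d) (indep E ?V)" unfolding V(1) by (simp only:)
        then show ?thesis by (simp only: dim N_def)
      next
        case False
        then have "lam 1 + n - 1 - max (mu 1) (n - 1) = Suc d" using lam1 n1 by (auto simp: d_def)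
        then have "pure_decomposable (Suc d) (indep E (?V - {?x}))" using IHn V by simp
        from pure_decomposable_indep_shed[OF xV xx this link] show ?thesis using dim by (simp add: N_def)
      qed
    qed
  qed
qed

section \<open>Initial ideals of toric binomial ideals\<close>

lemma less_monomial_iff:
  "m < m' \<longleftrightarrow> (\<exists>v. coeff m v < coeff m' v \<and> (\<forall>u<v. coeff m u = coeff m' u))"
  for m m' :: "'v::linorder \<Rightarrow>\<^sub>0 nat"
  by (simp add: less_poly_mapping.rep_eq less_fun_def)

text \<open>Identifying the term order with the linear order on exponent vectors makes leading
  monomials maxima of finite supports.\<close>

lemma lex_less_iff: "lex_less m m' \<longleftrightarrow> m < m'" for m m' :: "'v::linorder \<Rightarrow>\<^sub>0 nat"
proof -
  have *: "(LEAST u. coeff m u \<noteq> coeff m' u) = v"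
    if "coeff m v < coeff m' v" "\<forall>u<v. coeff m u = coeff m' u" for v and m m' :: "'v \<Rightarrow>\<^sub>0 nat"
    using that by (intro Least_equality) (auto simp: not_less[symmetric])
  have 1: "lex_less m m'" if less: "m < m'" for m m' :: "'v \<Rightarrow>\<^sub>0 nat"
  proof -
    obtain v where v: "coeff m v < coeff m' v" "\<forall>u<v. coeff m u = coeff m' u"
      using less less_monomial_iff[of m m'] by blast
    show ?thesis unfolding lex_less_def Let_def *[OF v] using v(1) less by simp
  qed
  have "\<not> lex_less m' m" if "lex_less m m'" for m m' :: "'v \<Rightarrow>\<^sub>0 nat"
    using that unfolding lex_less_def Let_def by (simp add: eq_commute[of "coeff m' _"])
  then show ?thesis using 1 by (metis linorder_neqE lex_less_def)
qed

lemma lead_monom_eq_Max: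
  fixes p :: "('v::linorder, 'k::field) mpoly"
  assumes "p \<noteq> 0" shows "lead_monom p = Max (supp p)"
proof -
  have ne: "supp p \<noteq> {}" using assms by simp
  show ?thesis unfolding lead_monom_def lex_less_iff
  proof (rule the_equality)
    show "Max (supp p) \<in> supp p \<and> (\<forall>m'\<in>supp p. m' \<noteq> Max (supp p) \<longrightarrow> m' < Max (supp p))"
      using ne by (auto simp: less_le)
    show "m = Max (supp p)" if "m \<in> supp p \<and> (\<forall>m'\<in>supp p. m' \<noteq> m \<longrightarrow> m' < m)" for m
      using that by (intro Max_eqI[symmetric]) (auto simp: le_less)
  qed
qed

lemma lead_monom_binomial:
  fixes a b :: "'v::linorder \<Rightarrow>\<^sub>0 nat"
  assumes "b < a"
  shows "(monom a - monom b :: ('v, 'k::field) mpoly) \<noteq> 0"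
    and "lead_monom (monom a - monom b :: ('v, 'k) mpoly) = a"
proof -
  have s: "supp (monom a - monom b :: ('v, 'k) mpoly) = {a, b}"
    using assms by (auto simp: in_keys_iff lookup_minus monom_def lookup_single when_def split: if_splits)
  then show nz: "(monom a - monom b :: ('v, 'k) mpoly) \<noteq> 0" by (metis insert_not_empty keys_zero)
  have "Max {a, b} = a" using assms by simp
  then show "lead_monom (monom a - monom b :: ('v, 'k) mpoly) = a" by (simp add: lead_monom_eq_Max[OF nz] s)
qed

section \<open>Weights and multidegrees\<close>

definition weight :: "'v set \<Rightarrow> ('v \<Rightarrow> int) \<Rightarrow> ('v \<Rightarrow>\<^sub>0 nat) \<Rightarrow> int" where
  "weight V w m = (\<Sum>v\<in>V. int (coeff m v) * w v)"

lemma weight_add: "weight V w (a + b) = weight V w a + weight V w b"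
  by (simp add: weight_def lookup_add distrib_right sum.distrib)

lemma weight_single: "finite V \<Longrightarrow> v \<in> V \<Longrightarrow> weight V w (Poly_Mapping.single v 1) = w v"
  by (simp add: weight_def lookup_single when_def if_distrib[of int] if_distrib[of "\<lambda>x. x * _"] cong: if_cong)

text \<open>Before \<open>x\<close> the contributions agree, at \<open>x\<close> that of
  \<open>b\<close> is larger, and after \<open>x\<close> that of \<open>b\<close> is 0 while that of
  \<open>a\<close> is at most 0. This certifies that two monomials have different
  multidegrees.\<close>

lemma weight_less:
  assumes V: "finite V" "x \<in> V" and x: "coeff a x < coeff b x" "\<And>v. v < x \<Longrightarrow> coeff a v = coeff b v"
    and w: "w x > 0" "\<And>v. v \<in> V \<Longrightarrow> x < v \<Longrightarrow> w v \<le> 0" "\<And>v. v \<in> V \<Longrightarrow> x < v \<Longrightarrow> v \<in> supp b \<Longrightarrow> w v = 0"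
  shows "weight V w a < weight V w (b :: 'v::linorder \<Rightarrow>\<^sub>0 nat)"
  unfolding weight_def
proof (rule sum_strict_mono_ex1[OF V(1)])
  show "\<forall>v\<in>V. int (coeff a v) * w v \<le> int (coeff b v) * w v"
  proof
    fix v assume v: "v \<in> V"
    consider "v < x" | "v = x" | "x < v" by fastforce
    then show "int (coeff a v) * w v \<le> int (coeff b v) * w v"
    proof cases
      case 3
      have "int (coeff a v) * w v \<le> 0" by (rule mult_nonneg_nonpos) (use w(2)[OF v 3] in simp_all)
      moreover have "int (coeff b v) * w v = 0" using w(3)[OF v 3] by (cases "v \<in> supp b") (auto simp: in_keys_iff)
      ultimately show ?thesis by linarith
    qed (use x w(1) in auto)
  qed
  show "\<exists>v\<in>V. int (coeff a v) * w v < int (coeff b v) * w v"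
    using V(2) x(1) w(1) by (intro bexI[of _ x]) auto
qed

definition same_weight :: "'v set \<Rightarrow> ('v \<Rightarrow> int) set \<Rightarrow> ('v \<Rightarrow>\<^sub>0 nat) \<Rightarrow> ('v \<Rightarrow>\<^sub>0 nat) \<Rightarrow> bool" where
  "same_weight V \<Omega> a b \<longleftrightarrow> (\<forall>w\<in>\<Omega>. weight V w a = weight V w b)"

text \<open>This is a coefficient of the image of \<open>p\<close> under the monomial map belonging
  to \<open>\<Omega>\<close>; for the tableaux the map sends the variable at \<open>(i, j)\<close>
  to x_i y_j, respectively x_i x_j.\<close>

definition fibre_sum :: "'v set \<Rightarrow> ('v \<Rightarrow> int) set \<Rightarrow> ('v \<Rightarrow>\<^sub>0 nat) \<Rightarrow> ('v, 'k::field) mpoly \<Rightarrow> 'k" where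
  "fibre_sum V \<Omega> m p = (\<Sum>k\<in>supp p. if same_weight V \<Omega> k m then coeff p k else 0)"

lemma fibre_sum_add: "fibre_sum V \<Omega> m (p + q) = fibre_sum V \<Omega> m p + fibre_sum V \<Omega> m q"
  unfolding fibre_sum_def
  by (rule setsum_keys_plus_distrib[where f = "\<lambda>k c. if same_weight V \<Omega> k m then c else 0"]) auto

lemma fibre_sum_sum: "fibre_sum V \<Omega> m (sum f A) = (\<Sum>a\<in>A. fibre_sum V \<Omega> m (f a))"
proof (induction A rule: infinite_finite_induct)
  case empty then show ?case by (simp add: fibre_sum_def)
next
  case (infinite A) then show ?case by (simp add: fibre_sum_def)
qed (simp add: fibre_sum_add)

lemma fibre_sum_single:
  "fibre_sum V \<Omega> m (Poly_Mapping.single k c) = (if same_weight V \<Omega> k m then c else 0)"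
  by (simp add: fibre_sum_def)

lemma fibre_sum_binomial_multiple:
  assumes "same_weight V \<Omega> a b"
  shows "fibre_sum V \<Omega> m (r * (monom a - monom b)) = 0"
proof -
  have "r * (monom a - monom b) = (\<Sum>k\<in>supp r. Poly_Mapping.single (k + a) (coeff r k) + Poly_Mapping.single (k + b) (- coeff r k))"
    by (subst (1) poly_eq_sum_terms)
      (simp add: sum_distrib_right right_diff_distrib monom_def mult_single single_uminus sum_subtractf)
  moreover have "same_weight V \<Omega> (k + a) m \<longleftrightarrow> same_weight V \<Omega> (k + b) m" for k
    using assms by (simp add: same_weight_def weight_add)
  ultimately show ?thesis by (auto simp: fibre_sum_sum fibre_sum_add fibre_sum_single intro!: sum.neutral)
qed

text \<open>The coefficients of an element of a binomial ideal sum to zero over each fibre of the weights, so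
 its leading monomial is never the smallest monomial of its fibre. This replaces Buchberger's
 criterion.\<close>
theorem initial_ideal_eq_sr_ideal:
  fixes G :: "('v::linorder, 'k::field) mpoly set"
  assumes V: "finite V"
    and binomial: "\<And>g. g \<in> G \<Longrightarrow> \<exists>a b. g = monom a - monom b \<and> supp a \<subseteq> V \<and> supp b \<subseteq> V \<and> same_weight V \<Omega> a b"
    and fibre: "\<And>a b. supp a \<subseteq> V \<Longrightarrow> supp b \<subseteq> V \<Longrightarrow> b < a \<Longrightarrow> same_weight V \<Omega> b a \<Longrightarrow> \<exists>e\<in>supp a. \<exists>f\<in>supp a. E e f"
    and lead: "\<And>e f. e \<in> V \<Longrightarrow> f \<in> V \<Longrightarrow> E e f \<Longrightarrow> e \<noteq> f \<and> (\<exists>b. b < Poly_Mapping.single e 1 + Poly_Mapping.single f 1 \<and>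
      monom (Poly_Mapping.single e 1 + Poly_Mapping.single f 1) - monom b \<in> ideal_gen V G)"
  shows "initial_ideal V (ideal_gen V G) = sr_ideal V (indep E V)"
proof
  have GV: "G \<subseteq> polys V"
  proof
    fix g assume "g \<in> G"
    then obtain a b where "g = monom a - monom b" "supp a \<subseteq> V" "supp b \<subseteq> V" using binomial by blast
    then show "g \<in> polys V" by simp
  qed
  let ?I = "ideal_gen V G"
  let ?L = "{monom (lead_monom p) | p. p \<in> ?I \<and> p \<noteq> 0} :: ('v, 'k) mpoly set"
  have I: "is_ideal V ?I" by (rule ideal_gen_is_ideal[OF GV])
  have zero: "fibre_sum V \<Omega> m p = 0" if p: "p \<in> ?I" for p m
  proof -
    obtain S f where S: "S \<subseteq> G" "p = (\<Sum>g\<in>S. f g * g)" using p unfolding ideal_gen_def by blast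
    have "fibre_sum V \<Omega> m (f g * g) = 0" if "g \<in> S" for g
    proof -
      obtain a b where "g = monom a - monom b" "same_weight V \<Omega> a b" using binomial S(1) \<open>g \<in> S\<close> by blast
      then show ?thesis using fibre_sum_binomial_multiple by blast
    qed
    then show ?thesis by (simp add: S(2) fibre_sum_sum)
  qed
  have L: "?L \<subseteq> sr_ideal V (indep E V)"
  proof clarify
    fix p assume p: "p \<in> ?I" "p \<noteq> 0"
    define a where "a = lead_monom p"
    have a: "a \<in> supp p" "\<And>k. k \<in> supp p \<Longrightarrow> k \<le> a"
      using p(2) by (auto simp: a_def lead_monom_eq_Max)
    have sV: "supp k \<subseteq> V" if "k \<in> supp p" for k using that p(1) is_idealD(1)[OF I] by (auto simp: polys_def)
    have "\<exists>b\<in>supp p. b \<noteq> a \<and> same_weight V \<Omega> b a"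
    proof (rule ccontr)
      assume no: "\<not> ?thesis"
      have "fibre_sum V \<Omega> a p = (\<Sum>k\<in>supp p. if k = a then coeff p k else 0)"
        unfolding fibre_sum_def using no by (intro sum.cong) (auto simp: same_weight_def)
      also have "\<dots> = coeff p a" using a(1) by simp
      finally show False using zero[OF p(1), of a] a(1) by (simp add: in_keys_iff)
    qed
    then obtain b where b: "b \<in> supp p" "b \<noteq> a" "same_weight V \<Omega> b a" by blast
    then have "b < a" using a(2)[of b] by simp
    then have "\<exists>e\<in>supp a. \<exists>f\<in>supp a. E e f" using fibre[OF sV[OF a(1)] sV[OF b(1)]] b(3) by blast
    then have "supp a \<notin> indep E V" by (auto simp: indep_def)
    then show "monom (lead_monom p) \<in> sr_ideal V (indep E V)" using sV[OF a(1)] by (simp add: a_def)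
  qed
  then show "initial_ideal V ?I \<subseteq> sr_ideal V (indep E V)"
    unfolding initial_ideal_def by (rule ideal_gen_least[OF sr_ideal_is_ideal[OF down_closed_indep]])
  have "?L \<subseteq> polys V" using L sr_ideal_subset_polys by blast
  then have II: "is_ideal V (initial_ideal V ?I)" unfolding initial_ideal_def by (rule ideal_gen_is_ideal)
  show "sr_ideal V (indep E V) \<subseteq> initial_ideal V ?I"
  proof (rule sr_ideal_subset_ideal[OF II])
    fix m :: "'v \<Rightarrow>\<^sub>0 nat" assume m: "supp m \<subseteq> V" "supp m \<notin> indep E V"
    then obtain e f where ef: "e \<in> supp m" "f \<in> supp m" "E e f" by (auto simp: indep_def)
    let ?a = "Poly_Mapping.single e 1 + Poly_Mapping.single f 1 :: 'v \<Rightarrow>\<^sub>0 nat"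
    have "e \<noteq> f" and "\<exists>b<?a. monom ?a - monom b \<in> ?I" using lead[of e f] ef m(1) by blast+
    then obtain b where b: "b < ?a" "monom ?a - monom b \<in> ?I" by blast
    have "monom ?a \<in> ?L" using b lead_monom_binomial[OF b(1), where ?'k='k] by (intro CollectI exI[of _ "monom ?a - monom b"]) auto
    then have aI: "monom ?a \<in> initial_ideal V ?I"
      unfolding initial_ideal_def by (rule subsetD[OF ideal_gen_superset])
    \<comment> \<open>\<open>e \<noteq> f\<close> makes the product of the two variables squarefree,
      so it divides every monomial whose support contains both.\<close>
    have "(m - ?a) + ?a = m" using monomial_split_support[of "{e, f}" m] ef \<open>e \<noteq> f\<close> by simp
    then have eq: "monom m = monom (m - ?a) * (monom ?a :: ('v, 'k) mpoly)" unfolding monom_add[symmetric] by simp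
    show "monom m \<in> initial_ideal V ?I" unfolding eq using m(1) supp_minus_nat[of m ?a]
      by (intro is_idealD(4)[OF II _ aI]) auto
  qed
qed

section \<open>Two-minors of tableaux\<close>

text \<open>\<open>e\<close> is the largest variable in the term order and occurs on one side
  only.\<close>

lemma sum_singles_less:
  assumes "e < g" "e < h" "e \<le> f"
  shows "Poly_Mapping.single g 1 + Poly_Mapping.single h 1 < (Poly_Mapping.single e 1 + Poly_Mapping.single f 1 :: 'v::linorder \<Rightarrow>\<^sub>0 nat)"
  unfolding less_monomial_iff using assms
  by (intro exI[of _ e]) (auto simp: lookup_add lookup_single when_def)

lemma monom_two: "var e * var f = monom (Poly_Mapping.single e 1 + Poly_Mapping.single f 1)"
  by (simp add: var_eq_monom monom_add)

lemma finite_tab_T: "finite (tab_T n lam mu)"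
proof (rule finite_subset)
  show "tab_T n lam mu \<subseteq> (SIGMA i : {1..n}. {..lam i})" by (auto simp: tab_T_def)
qed auto

text \<open>The pairs of positions whose product is the leading monomial of a 2-minor of the tableau and of the
 symmetrized tableau, respectively.\<close>
definition diag_T :: "(nat \<Rightarrow> nat) \<Rightarrow> nat \<times> nat \<Rightarrow> nat \<times> nat \<Rightarrow> bool" where
  "diag_T mu = (\<lambda>(i, j) (k, l). i < k \<and> j < l \<and> mu k < j)"

definition diag_S :: "(nat \<Rightarrow> nat) \<Rightarrow> nat \<times> nat \<Rightarrow> nat \<times> nat \<Rightarrow> bool" where
  "diag_S mu = (\<lambda>(i, j) (k, l). i < k \<and> j < l \<and> (mu k < j \<or> j < k))"

definition reflect :: "nat \<Rightarrow> (nat \<Rightarrow> nat) \<Rightarrow> (nat \<Rightarrow> nat) \<Rightarrow> nat \<times> nat \<Rightarrow> nat \<times> nat" where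
  "reflect n lam mu = (\<lambda>(i, j). if (i, j) \<in> tab_T n lam mu then (i, j) else (j, i))"

lemma entry_S_eq_var: "entry_S n lam mu p = var (reflect n lam mu p)"
  by (cases p) (simp add: entry_S_def reflect_def)

lemma reflect_in_tab_T: "p \<in> tab_S n lam mu \<Longrightarrow> reflect n lam mu p \<in> tab_T n lam mu"
  by (auto simp: reflect_def tab_S_def)

context
  fixes n :: nat and lam mu :: "nat \<Rightarrow> nat"
  assumes lam_mono: "\<And>i j. 1 \<le> i \<Longrightarrow> i \<le> j \<Longrightarrow> j \<le> n \<Longrightarrow> lam j \<le> lam i"
    and mu_mono: "\<And>i j. 1 \<le> i \<Longrightarrow> i \<le> j \<Longrightarrow> j \<le> n \<Longrightarrow> mu i \<le> mu j"
    and mu_ge: "\<And>i. 1 \<le> i \<Longrightarrow> i \<le> n \<Longrightarrow> i - 1 \<le> mu i"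
begin

text \<open>Of two distinct mirrored positions, at most one can therefore belong to the
  tableau.\<close>

lemma tab_T_upper: "(i, j) \<in> tab_T n lam mu \<Longrightarrow> i \<le> j"
  using mu_ge[of i] by (auto simp: tab_T_def)

lemma initial_I2_T:
  "initial_ideal (tab_T n lam mu) (I2_T n lam mu) = (sr_ideal (tab_T n lam mu) (indep (diag_T mu) (tab_T n lam mu)) :: (nat \<times> nat, 'k::field) mpoly set)"
  unfolding I2_T_def
proof (rule initial_ideal_eq_sr_ideal[where \<Omega> = "{\<lambda>(a, b). r a + s b | r s. True}"])
  let ?V = "tab_T n lam mu"
  let ?\<Omega> = "{\<lambda>(a, b). r a + s b | r s. True} :: (nat \<times> nat \<Rightarrow> int) set"
  show V: "finite ?V" by (rule finite_tab_T)
  show "\<exists>a b. g = monom a - monom b \<and> supp a \<subseteq> ?V \<and> supp b \<subseteq> ?V \<and> same_weight ?V ?\<Omega> a b"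
    if "g \<in> two_minors ?V var" for g :: "(nat \<times> nat, 'k) mpoly"
  proof -
    obtain i j k l where g: "g = var (i, j) * var (k, l) - var (i, l) * var (k, j)"
      and p: "(i, j) \<in> ?V" "(i, l) \<in> ?V" "(k, j) \<in> ?V" "(k, l) \<in> ?V"
      using \<open>g \<in> two_minors ?V var\<close> unfolding two_minors_def by blast
    let ?a = "Poly_Mapping.single (i, j) 1 + Poly_Mapping.single (k, l) 1 :: nat \<times> nat \<Rightarrow>\<^sub>0 nat"
    let ?b = "Poly_Mapping.single (i, l) 1 + Poly_Mapping.single (k, j) 1 :: nat \<times> nat \<Rightarrow>\<^sub>0 nat"
    have "same_weight ?V ?\<Omega> ?a ?b"
      using V p by (auto simp: same_weight_def weight_add weight_single)
    then show ?thesis using p g by (intro exI[of _ ?a] exI[of _ ?b]) (auto simp: monom_two supp_add_nat)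
  qed
  show "\<exists>e\<in>supp a. \<exists>f\<in>supp a. diag_T mu e f"
    if sV: "supp a \<subseteq> ?V" and "b < a" and eq: "same_weight ?V ?\<Omega> b a" for a b
  proof (rule ccontr)
    assume no: "\<not> ?thesis"
    obtain x where "coeff b x < coeff a x" "\<forall>u<x. coeff b u = coeff a u"
      using \<open>b < a\<close> less_monomial_iff by blast
    moreover obtain i j where "x = (i, j)" by (cases x)
    ultimately have x: "coeff b (i, j) < coeff a (i, j)" "\<And>u. u < (i, j) \<Longrightarrow> coeff b u = coeff a u" by auto
    then have ij: "(i, j) \<in> supp a" by (simp add: in_keys_iff)
    \<comment> \<open>The weight is 1 at \<open>(i, j)\<close>. At later positions of the tableau it
      is -1 exactly where the position forms an edge with \<open>(i, j)\<close>, and 0 elsewhere, so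
      an edge-free support meets the hypotheses of \<open>weight_less\<close>.\<close>
    define r :: "nat \<Rightarrow> int" where "r k = (if k \<le> i \<or> j \<le> mu k then 0 else - 1)" for k
    define s :: "nat \<Rightarrow> int" where "s l = (if l \<le> j then 1 else 0)" for l
    let ?w = "\<lambda>(a, b). r a + s b"
    have "weight ?V ?w b < weight ?V ?w a"
    proof (rule weight_less[OF V _ x])
      show "(i, j) \<in> ?V" using ij sV by blast
      show "0 < ?w (i, j)" by (simp add: r_def s_def)
      show "?w v \<le> 0" if "v \<in> ?V" "(i, j) < v" for v
        using that by (auto simp: r_def s_def tab_T_def)
      show "?w v = 0" if "v \<in> ?V" "(i, j) < v" "v \<in> supp a" for v
      proof -
        obtain k l where v: "v = (k, l)" by (cases v)
        have "\<not> diag_T mu (i, j) v" using no ij that by blast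
        then show ?thesis using that by (auto simp: v r_def s_def tab_T_def diag_T_def)
      qed
    qed
    moreover have "?w \<in> ?\<Omega>" by blast
    ultimately show False using eq by (auto simp: same_weight_def)
  qed
  show "e \<noteq> f \<and> (\<exists>b<Poly_Mapping.single e 1 + Poly_Mapping.single f 1.
      monom (Poly_Mapping.single e 1 + Poly_Mapping.single f 1) - monom b
        \<in> ideal_gen ?V (two_minors ?V var :: (nat \<times> nat, 'k) mpoly set))"
    if ef: "e \<in> ?V" "f \<in> ?V" "diag_T mu e f" for e f
  proof -
    obtain i j k l where e: "e = (i, j)" and f: "f = (k, l)" by (cases e, cases f)
    have *: "i < k" "j < l" "mu k < j" using ef(3) by (auto simp: e f diag_T_def)
    have p: "(i, l) \<in> ?V" "(k, j) \<in> ?V"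
      using ef * lam_mono[of i k] mu_mono[of i k] by (auto simp: e f tab_T_def)
    let ?b = "Poly_Mapping.single (i, l) 1 + Poly_Mapping.single (k, j) 1 :: nat \<times> nat \<Rightarrow>\<^sub>0 nat"
    have "?b < Poly_Mapping.single e 1 + Poly_Mapping.single f 1"
      using * by (intro sum_singles_less) (auto simp: e f)
    moreover have "var e * var f - var (i, l) * var (k, j) \<in> (two_minors ?V var :: (nat \<times> nat, 'k) mpoly set)"
      unfolding two_minors_def e f using * p ef e f by blast
    then have "monom (Poly_Mapping.single e 1 + Poly_Mapping.single f 1) - monom ?b
        \<in> ideal_gen ?V (two_minors ?V var :: (nat \<times> nat, 'k) mpoly set)"
      unfolding monom_two using ideal_gen_superset by blast
    ultimately show ?thesis using * by (auto simp: e f)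
  qed
qed

lemma initial_I2_S:
  "initial_ideal (tab_T n lam mu) (I2_S n lam mu) = (sr_ideal (tab_T n lam mu) (indep (diag_S mu) (tab_T n lam mu)) :: (nat \<times> nat, 'k::field) mpoly set)"
  unfolding I2_S_def
proof (rule initial_ideal_eq_sr_ideal[where \<Omega> = "{\<lambda>(a, b). w a + w b | w. True}"])
  let ?V = "tab_T n lam mu"
  let ?S = "tab_S n lam mu"
  let ?G = "two_minors ?S (entry_S n lam mu) :: (nat \<times> nat, 'k) mpoly set"
  let ?\<Omega> = "{\<lambda>(a, b). w a + w b | w. True} :: (nat \<times> nat \<Rightarrow> int) set"
  show V: "finite ?V" by (rule finite_tab_T)
  have reflect_weight: "(\<lambda>(a, b). w a + w b) (reflect n lam mu (i, j)) = w i + w j" for i j and w :: "nat \<Rightarrow> int"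
    by (simp add: reflect_def)
  show "\<exists>a b. g = monom a - monom b \<and> supp a \<subseteq> ?V \<and> supp b \<subseteq> ?V \<and> same_weight ?V ?\<Omega> a b"
    if "g \<in> ?G" for g
  proof -
    obtain i j k l where g: "g = entry_S n lam mu (i, j) * entry_S n lam mu (k, l)
        - entry_S n lam mu (i, l) * entry_S n lam mu (k, j)"
      and "(i, j) \<in> ?S" "(i, l) \<in> ?S" "(k, j) \<in> ?S" "(k, l) \<in> ?S"
      using \<open>g \<in> ?G\<close> unfolding two_minors_def by blast
    then have p: "reflect n lam mu (i, j) \<in> ?V" "reflect n lam mu (i, l) \<in> ?V" "reflect n lam mu (k, j) \<in> ?V" "reflect n lam mu (k, l) \<in> ?V"
      using reflect_in_tab_T by blast+
    let ?a = "Poly_Mapping.single (reflect n lam mu (i, j)) 1 + Poly_Mapping.single (reflect n lam mu (k, l)) 1 :: nat \<times> nat \<Rightarrow>\<^sub>0 nat"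
    let ?b = "Poly_Mapping.single (reflect n lam mu (i, l)) 1 + Poly_Mapping.single (reflect n lam mu (k, j)) 1 :: nat \<times> nat \<Rightarrow>\<^sub>0 nat"
    have "same_weight ?V ?\<Omega> ?a ?b" unfolding same_weight_def
    proof
      fix w' assume "w' \<in> ?\<Omega>"
      then obtain w where w: "w' = (\<lambda>(a, b). w a + w b)" by blast
      show "weight ?V w' ?a = weight ?V w' ?b"
        unfolding w weight_add weight_single[OF V p(1)] weight_single[OF V p(2)] weight_single[OF V p(3)] weight_single[OF V p(4)] reflect_weight
        by simp
    qed
    then show ?thesis using p g
      by (intro exI[of _ ?a] exI[of _ ?b]) (auto simp: entry_S_eq_var monom_two supp_add_nat)
  qed
  show "\<exists>e\<in>supp a. \<exists>f\<in>supp a. diag_S mu e f"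
    if sV: "supp a \<subseteq> ?V" and "b < a" and eq: "same_weight ?V ?\<Omega> b a" for a b
  proof (rule ccontr)
    assume no: "\<not> ?thesis"
    obtain x where "coeff b x < coeff a x" "\<forall>u<x. coeff b u = coeff a u"
      using \<open>b < a\<close> less_monomial_iff by blast
    moreover obtain i j where "x = (i, j)" by (cases x)
    ultimately have x: "coeff b (i, j) < coeff a (i, j)" "\<And>u. u < (i, j) \<Longrightarrow> coeff b u = coeff a u" by auto
    then have ij: "(i, j) \<in> supp a" by (simp add: in_keys_iff)
    then have ijV: "(i, j) \<in> ?V" using sV by blast
    have "i \<le> j" by (rule tab_T_upper[OF ijV])
    have indep: "\<not> diag_S mu e f" if "e \<in> supp a" "f \<in> supp a" for e f using no that by blast
    have "\<exists>w. weight ?V (\<lambda>(a, b). w a + w b) b < weight ?V (\<lambda>(a, b). w a + w b) a"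
    \<comment> \<open>Row and column indices share one weight function here, which leaves less
      freedom than in the ordinary case; the choice depends on whether the support reaches both
      below and to the right of \<open>(i, j)\<close>.\<close>
    proof (cases "\<exists>k l. (k, l) \<in> supp a \<and> i < k \<and> j < l")
      case False
      \<comment> \<open>In row \<open>i\<close> beyond column \<open>j\<close> the values 1 and -1
        cancel. A later position has negative weight only if its row is below \<open>i\<close> and
        its column beyond \<open>j\<close>, which this case excludes on the support.\<close>
      define w :: "nat \<Rightarrow> int" where "w v = (if v \<le> i then 1 else if v \<le> j then 0 else - 1)" for v
      let ?w = "\<lambda>(a, b). w a + w b"
      have "weight ?V ?w b < weight ?V ?w a"
      proof (rule weight_less[OF V ijV x])
        show "0 < ?w (i, j)" by (simp add: w_def)
        show "?w v \<le> 0" if "v \<in> ?V" "(i, j) < v" for v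
          using that tab_T_upper[of "fst v" "snd v"] \<open>i \<le> j\<close> by (cases v) (auto simp: w_def)
        show "?w v = 0" if "v \<in> ?V" "(i, j) < v" "v \<in> supp a" for v
        proof (cases v)
          case (Pair p q)
          then have "p \<le> q" using that(1) tab_T_upper by simp
          moreover have "i < p \<longrightarrow> q \<le> j" using False that(3) Pair by (metis not_less)
          ultimately show ?thesis using that(2) Pair \<open>i \<le> j\<close> by (auto simp: w_def)
        qed
      qed
      then show ?thesis by blast
    next
      case True
      then obtain k l where kl: "(k, l) \<in> supp a" "i < k" "j < l" by blast
      then have klV: "(k, l) \<in> ?V" using sV by blast
      have k: "1 \<le> k" "k \<le> n" using klV by (auto simp: tab_T_def)
      have muk: "j \<le> mu k" "k \<le> j" using indep[OF ij kl(1)] kl by (auto simp: diag_S_def)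
      \<comment> \<open>The value 1 goes to indices up to \<open>i\<close> and to those up to
        \<open>j\<close> whose row, if there is one, starts beyond column \<open>j\<close>. Since
        \<open>(i, j)\<close> and \<open>(k, l)\<close> form no edge, all rows from \<open>k\<close>
        on start beyond \<open>j\<close>; as \<open>k \<le> j\<close>, the index \<open>j\<close>
        has value 1 and \<open>(i, j)\<close> has weight 2.\<close>
      define w :: "nat \<Rightarrow> int" where "w v = (if v \<le> i \<or> v \<le> j \<and> \<not> (v \<le> n \<and> mu v < j) then 1 else - 1)" for v
      have mu_k: "j \<le> mu v" if "k \<le> v" "v \<le> n" for v using mu_mono[of k v] that k muk by auto
      let ?w = "\<lambda>(a, b). w a + w b"
      have "weight ?V ?w b < weight ?V ?w a"
      proof (rule weight_less[OF V ijV x])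
        show "0 < ?w (i, j)" using mu_k[of j] muk by (auto simp: w_def)
        show "?w v \<le> 0" if v: "v \<in> ?V" "(i, j) < v" for v
        proof -
          obtain p q where pq: "v = (p, q)" by (cases v)
          have "p \<le> q" "p \<le> n" "mu p < q" using tab_T_upper[of p q] v by (auto simp: pq tab_T_def)
          moreover have "i < p \<or> p = i \<and> j < q" using v(2) pq by auto
          ultimately have "\<not> (p \<le> i \<or> p \<le> j \<and> \<not> (p \<le> n \<and> mu p < j)) \<or> j < q" by linarith
          moreover have "w q = - 1" if "j < q" using that \<open>i \<le> j\<close> by (simp add: w_def)
          moreover have "w v \<le> 1" for v by (simp add: w_def)
          ultimately show ?thesis unfolding pq by (auto simp: w_def[of p])
        qed
        show "?w v = 0" if v: "v \<in> ?V" "(i, j) < v" "v \<in> supp a" for v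
        proof (cases v)
          case (Pair p q)
          have pq: "p \<le> q" "p \<le> n" "mu p < q" using tab_T_upper[of p q] v by (auto simp: Pair tab_T_def)
          show ?thesis
          proof (cases "p = i")
            case True
            then show ?thesis using v(2) muk kl Pair by (auto simp: w_def)
          next
            case False
            then have "i < p" using v(2) Pair by auto
            show ?thesis
            proof (cases "j < q")
              case True
              then have "j \<le> mu p" "p \<le> j" using indep[OF ij v(3)] \<open>i < p\<close> by (auto simp: diag_S_def Pair)
              then show ?thesis using True \<open>i < p\<close> \<open>p \<le> q\<close> by (auto simp: w_def Pair)
            next
              case False
              then have "w p = - 1" using pq \<open>i < p\<close> by (auto simp: w_def)
              moreover have "w q = 1"
              proof (rule ccontr)
                \<comment> \<open>Such a \<open>q\<close> would be a row index less than
                  \<open>k\<close>, and then \<open>(p, q)\<close> and \<open>(k, l)\<close> would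
                  form an edge through \<open>q < k\<close>.\<close>
                assume "w q \<noteq> 1"
                then have "q \<le> n" "mu q < j" using False by (auto simp: w_def split: if_splits)
                then have "q < k" using mu_k[of q] by (meson not_less)
                then have "diag_S mu v (k, l)" using pq muk kl False by (auto simp: diag_S_def Pair)
                then show False using indep[OF v(3) kl(1)] by blast
              qed
              ultimately show ?thesis by (simp add: Pair)
            qed
          qed
        qed
      qed
      then show ?thesis by blast
    qed
    then obtain w where "weight ?V (\<lambda>(a, b). w a + w b) b < weight ?V (\<lambda>(a, b). w a + w b) a" by blast
    moreover have "weight ?V (\<lambda>(a, b). w a + w b) b = weight ?V (\<lambda>(a, b). w a + w b) a"
      using eq unfolding same_weight_def by (rule bspec) blast
    ultimately show False by simp
  qed
  show "e \<noteq> f \<and> (\<exists>b<Poly_Mapping.single e 1 + Poly_Mapping.single f 1.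
      monom (Poly_Mapping.single e 1 + Poly_Mapping.single f 1) - monom b \<in> ideal_gen ?V ?G)"
    if ef: "e \<in> ?V" "f \<in> ?V" "diag_S mu e f" for e f
  proof -
    obtain i j k l where e: "e = (i, j)" and f: "f = (k, l)" by (cases e, cases f)
    have *: "i < k" "j < l" "mu k < j \<or> j < k" using ef(3) by (auto simp: e f diag_S_def)
    have bounds: "1 \<le> i" "k \<le> n" "mu i < j" "j \<le> lam i" "mu k < l" "l \<le> lam k"
      using ef by (auto simp: e f tab_T_def)
    have upper: "i \<le> j" "k \<le> l" using ef(1,2) tab_T_upper by (auto simp: e f)
    have TS: "(p, q) \<in> ?S" "(q, p) \<in> ?S" "reflect n lam mu (p, q) = (p, q)" "reflect n lam mu (q, p) = (p, q)" if "(p, q) \<in> ?V" for p q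
      using that tab_T_upper[of p q] tab_T_upper[of q p] by (auto simp: tab_S_def reflect_def)
    obtain g h where gh: "g \<in> ?V" "h \<in> ?V" "e < g" "e < h" "var e * var f - var g * var h \<in> ?G"
    proof (cases "mu k < j")
      case True
      have p: "(i, l) \<in> ?V" "(k, j) \<in> ?V"
        using * True bounds lam_mono[of i k] mu_mono[of i k] by (auto simp: tab_T_def)
      have "entry_S n lam mu (i, j) * entry_S n lam mu (k, l) - entry_S n lam mu (i, l) * entry_S n lam mu (k, j) \<in> ?G"
        unfolding two_minors_def using * TS(1) p ef(1,2) unfolding e f by blast
      then have "var e * var f - var (i, l) * var (k, j) \<in> ?G"
        using TS(3) p ef(1,2) by (simp add: entry_S_eq_var e f)
      then show ?thesis using that[OF p] * by (auto simp: e)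
    next
      case False
      then have jk: "j < k" using * by simp
      have p: "(i, k) \<in> ?V" "(j, l) \<in> ?V"
        using * jk bounds upper lam_mono[of i k] mu_mono[of i k] lam_mono[of j k] mu_mono[of j k] by (auto simp: tab_T_def)
      have "i < l" using *(1) upper by simp
      \<comment> \<open>The minor on rows \<open>i\<close>, \<open>l\<close> and columns
        \<open>j\<close>, \<open>k\<close>. Its lower entries are reflections of
        \<open>(j, l)\<close> and \<open>(k, l)\<close>.\<close>
      then have "entry_S n lam mu (i, j) * entry_S n lam mu (l, k) - entry_S n lam mu (i, k) * entry_S n lam mu (l, j) \<in> ?G"
        unfolding two_minors_def using jk TS(1,2) p ef(1,2) unfolding e f by blast
      then have "var e * var f - var (i, k) * var (j, l) \<in> ?G"
        using TS(3,4) p ef(1,2) by (simp add: entry_S_eq_var e f)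
      then show ?thesis using that[OF p] * jk upper by (auto simp: e)
    qed
    let ?b = "Poly_Mapping.single g 1 + Poly_Mapping.single h 1 :: nat \<times> nat \<Rightarrow>\<^sub>0 nat"
    have "?b < Poly_Mapping.single e 1 + Poly_Mapping.single f 1"
      using * gh by (intro sum_singles_less) (auto simp: e f)
    moreover have "monom (Poly_Mapping.single e 1 + Poly_Mapping.single f 1) - monom ?b \<in> ideal_gen ?V ?G"
      using gh(5) unfolding monom_two using ideal_gen_superset by blast
    ultimately show ?thesis using * by (auto simp: e f)
  qed
qed

end

theorem theorem3p3:
  fixes n :: nat and lam mu :: "nat \<Rightarrow> nat"
  assumes n: "n \<ge> 1"
    and lam_pos: "\<forall>i\<in>{1..n}. lam i > 0"
    and lam_mono: "\<forall>i\<in>{1..n}. \<forall>j\<in>{1..n}. i \<le> j \<longrightarrow> lam j \<le> lam i"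
    and mu_mono: "\<forall>i\<in>{1..n}. \<forall>j\<in>{1..n}. i \<le> j \<longrightarrow> mu i \<le> mu j"
    and mu_lt: "mu n < lam n"
    and mu_ge: "\<forall>i\<in>{1..n}. i - 1 \<le> mu i"
  defines "inT \<equiv> initial_ideal (tab_T n lam mu) (I2_T n lam mu :: (nat \<times> nat, 'k::field) mpoly set)"
    and "inS \<equiv> initial_ideal (tab_T n lam mu) (I2_S n lam mu :: (nat \<times> nat, 'k::field) mpoly set)"
  shows
    "(squarefree_monomial_ideal (tab_T n lam mu) inT
      \<and> height (tab_T n lam mu) inT = enat (\<Sum>i=2..n. lam i - mu i - 1)
      \<and> vertex_decomposable (sr_complex (tab_T n lam mu) inT)
      \<and> cohen_macaulay (tab_T n lam mu) inT)
   \<and> (squarefree_monomial_ideal (tab_T n lam mu) inS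
      \<and> height (tab_T n lam mu) inS = enat ((n - 1 - mu 1) + (\<Sum>i=2..n. lam i - mu i - 1))
      \<and> vertex_decomposable (sr_complex (tab_T n lam mu) inS)
      \<and> cohen_macaulay (tab_T n lam mu) inS)
   \<and> (inT \<noteq> {0} \<longrightarrow> obtained_by_bdl_from_variables (tab_T n lam mu) inT)
   \<and> (inS \<noteq> {0} \<longrightarrow> obtained_by_bdl_from_variables (tab_T n lam mu) inS)"
proof -
  let ?V = "tab_T n lam mu"
  have lam: "lam j \<le> lam i" and mu: "mu i \<le> mu j" if "1 \<le> i" "i \<le> j" "j \<le> n" for i j
    using that lam_mono mu_mono by auto
  have ge: "i - 1 \<le> mu i" if "1 \<le> i" "i \<le> n" for i using that mu_ge by auto
  have row: "mu i < lam i" if "1 \<le> i" "i \<le> n" for i using lam[of i n] mu[of i n] mu_lt that by auto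
  have V: "finite ?V" by (rule finite_tab_T)
  have properties: "squarefree_monomial_ideal ?V I \<and> height ?V I = enat (card ?V - d)
      \<and> vertex_decomposable (sr_complex ?V I) \<and> cohen_macaulay ?V I \<and> obtained_by_bdl_from_variables ?V I"
    if "I = sr_ideal ?V (indep E ?V)" "pure_decomposable d (indep E ?V)"
    for I :: "(nat \<times> nat, 'k) mpoly set" and E d
  proof -
    have sub: "indep E ?V \<subseteq> Pow ?V" by (auto simp: indep_def)
    note sd = pure_decomposable_imp_star_decomposable[OF that(2)]
    show ?thesis unfolding that(1) sr_complex_sr_ideal[OF V sub]
      using squarefree_sr_ideal[OF down_closed_indep] star_decomposable_cohen_macaulay(1,2)[OF V sd sub]
        pure_decomposable_vertex_decomposable[OF that(2)] star_decomposable_obtained_by_bdl[OF V sd sub] by blast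
  qed
  have "card ?V = (\<Sum>i=1..n. lam i - mu i)"
  proof -
    have "?V = (SIGMA i : {1..n}. {mu i<..lam i})" by (auto simp: tab_T_def)
    then show ?thesis by simp
  qed
  also have "\<dots> = (lam 1 - mu 1) + (\<Sum>i=2..n. lam i - mu i)"
    using n by (simp add: sum.atLeast_Suc_atMost numeral_2_eq_2 One_nat_def)
  \<comment> \<open>Rows are nonempty, so taking one position from each is not truncated; the
    resulting \<open>n - 1\<close> cancels against the facet size.\<close>
  also have "(\<Sum>i=2..n. lam i - mu i) = (\<Sum>i=2..n. (lam i - mu i - 1) + 1)"
  proof (intro sum.cong refl)
    fix i assume "i \<in> {2..n}"
    then show "lam i - mu i = (lam i - mu i - 1) + 1" using row[of i] by simp
  qed
  also have "\<dots> = (\<Sum>i=2..n. lam i - mu i - 1) + (n - 1)" using n by (simp add: sum.distrib)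
  finally have card: "card ?V = (lam 1 - mu 1) + ((\<Sum>i=2..n. lam i - mu i - 1) + (n - 1))" .
  have r1: "mu 1 < lam 1" using row[of 1] n by simp
  have pd_T: "pure_decomposable (card {mu 1<..lam 1} + n - 1) (indep (diag_T mu) ?V)"
    unfolding tab_T_eq_rows
  proof (rule pure_decomposable_nested_rows[OF n])
    show "{mu j<..lam j} \<subseteq> {mu i<..lam i}" if "1 \<le> i" "i \<le> j" "j \<le> n" for i j
      using lam[OF that] mu[OF that] by auto
  qed (use mu_lt in \<open>auto simp: rows_def diag_T_def\<close>)
  have card_T: "card ?V - (card {mu 1<..lam 1} + n - 1) = (\<Sum>i=2..n. lam i - mu i - 1)"
    using card n r1 by simp
  have eq_T: "inT = sr_ideal ?V (indep (diag_T mu) ?V)"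
    unfolding inT_def by (rule initial_I2_T[OF lam mu ge])
  have T: "squarefree_monomial_ideal ?V inT \<and> height ?V inT = enat (\<Sum>i=2..n. lam i - mu i - 1)
      \<and> vertex_decomposable (sr_complex ?V inT) \<and> cohen_macaulay ?V inT \<and> obtained_by_bdl_from_variables ?V inT"
    using properties[OF eq_T pd_T] unfolding card_T .
  have pd_S: "pure_decomposable (lam 1 + n - 1 - max (mu 1) (n - 1)) (indep (diag_S mu) ?V)"
    by (rule pure_decomposable_symmetric_tableau) (use n lam mu mu_lt ge in \<open>auto simp: diag_S_def\<close>)
  \<comment> \<open>Both \<open>mu 1\<close> and \<open>n - 1\<close> are below
    \<open>lam 1\<close>, so the facet size is not truncated. What is left over is
    \<open>max (mu 1) (n - 1) - mu 1\<close>, which equals the truncated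
    \<open>n - 1 - mu 1\<close>.\<close>
  have card_S: "card ?V - (lam 1 + n - 1 - max (mu 1) (n - 1)) = (n - 1 - mu 1) + (\<Sum>i=2..n. lam i - mu i - 1)"
  proof -
    have "n - 1 < lam 1" using ge[of n] n mu_lt lam[of 1 n] by simp
    then show ?thesis using card n r1 by simp
  qed
  have eq_S: "inS = sr_ideal ?V (indep (diag_S mu) ?V)"
    unfolding inS_def by (rule initial_I2_S[OF lam mu ge])
  have S: "squarefree_monomial_ideal ?V inS \<and> height ?V inS = enat ((n - 1 - mu 1) + (\<Sum>i=2..n. lam i - mu i - 1))
      \<and> vertex_decomposable (sr_complex ?V inS) \<and> cohen_macaulay ?V inS \<and> obtained_by_bdl_from_variables ?V inS"
    using properties[OF eq_S pd_S] unfolding card_S .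
  show ?thesis using T S by blast
qed

end
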